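(* Let $\mu$ be an absolutely continuous invariant measure of $(\mathsf P^t)_{t\ge0}$ with invariant densities $(\rho_i)_{i\in S}$. Assume that $u_1(0)=0$, that $u_i(0)\ne0$ for all $i\in S\setminus\{1\}$, and that there is a constant $a\neq 0$ with $u_1(\eta)=-a\eta+O(\eta^2)$ as $\eta\downarrow0$. With cases B and C as defined in the context: (1) If $\lambda_1<a$, then $\rho_1$ is unbounded to the right of $0$ in cases B and C. (2) If $\lambda_1>a>0$, then $\rho_1$ is bounded to the right of $0$ in cases B and C. (3) If $\lambda_1=a$, then $\rho_1$ is unbounded to the right of $0$ in case B. Here $\rho_1$ is bounded to the right of $0$ if it is bounded on $(0,\epsilon)$ for some $\epsilon>0$, and unbounded to the right of $0$ otherwise.
   Context: Setting. Let $S=\{1,\dots,N\}$ with $N\ge 2$, and let $D=\{u_i: i\in S\}$ be a finite collection of continuously differentiable vector fields on $\mathbb R$ that are forward-complete (for every $\xi\in\mathbb R$ the problem $\dot x=u_i(x)$, $x(0)=\xi$ has a unique solution $\Phi_i^t(\xi)$ for all $t\ge 0$). For $i\ne j$ in $S$ let $\lambda_{i,j}>0$ be the (constant) rate of switching from $i$ to $j$, and put $\lambda_i=\sum_{j\neq i}\lambda_{i,j}$. The switching process $(X,A)=(X_t,A_t)_{t\ge0}$ is the Markov process on $\mathbb R\times S$ in which $A$ is the continuous-time Markov chain on $S$ with jump rates $\lambda_{i,j}$, and $X$ is continuous and follows $\dot X_t=u_{A_t}(X_t)$ between the jumps of $A$. Its Markov semigroup is $(\mathsf P^t)_{t\ge0}$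 with transition probabilities $\mathsf P^t_{\xi,i}$. A probability measure $\mu$ on $\mathbb R\times S$ is invariant if $\mu(E\times\{i\})=\sum_{j\in S}\int_{\mathbb R}\mathsf P^t_{\xi,j}(E\times\{i\})\,\mu(d\xi\times\{j\})$ for all Borel $E\subset\mathbb R$, $i\in S$, $t\ge0$. Put $\mu_i=\mu(\cdot\times\{i\})$. If $\mu$ is absolutely continuous (with respect to Lebesgue measure times counting measure), $\rho_i\in L^1(\mathbb R)$ denotes the Lebesgue density of $\mu_i$ (invariant density). A regularity property of $\rho_i$ means that the class $\rho_i$ has a representative with that property. A point is a critical point of $u_i$ if $u_i$ vanishes there. Standing assumption: the set of critical points of the vector fields in $D$ has no accumulation points. Cases. A nonempty set $J\subset\mathbb R$ is invariant if every finite composition of flow maps $\Phi_{i_m}^{t_m}\circ\dots\circ\Phi_{i_1}^{t_1}$ with $i_k\in S$, $t_k\ge0$ maps $J$ into $J$; it is minimal invariant if no nonempty strict subset of it is invariant. For absolutely continuous invariant $\mu$, all measures $\mu_i$, $i\in S$, have the same support, called the support of $(\mu_i)_{i\in S}$; it is the union of a collection $\mathscr I$ of closed intervals of positive length, namely the closures of the minimal invariant sets $J$ with $\mu(J\times S)>0$. Exactly one of the following holds: (A) $0$ is the left endpoint of an open interval that contains no points of the support of $(\mu_i)_{i\in S}$; (B) $0$ is contained in the interior of an interval $I\in\mathscr I$; (C) $0$ is the left endpoint of an interval $I\in\mathscr I$. (Since $0$ is critical only for $u_1$, in case C the point $0$ is also the right endpoint of an open interval containing no points of the support.) *)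

theory Defs
  imports "HOL-Probability.Probability" "HOL-Library.Landau_Symbols"
begin

definition solves_ivp :: "(real \<Rightarrow> real) \<Rightarrow> real \<Rightarrow> (real \<Rightarrow> real) \<Rightarrow> bool" where
  "solves_ivp v \<xi> x \<longleftrightarrow>
     x 0 = \<xi> \<and> (\<forall>t\<ge>0. (x has_real_derivative v (x t)) (at t within {0..}))"

definition forward_complete :: "(real \<Rightarrow> real) \<Rightarrow> bool" where
  "forward_complete v \<longleftrightarrow>
     (\<forall>\<xi>. \<exists>x. solves_ivp v \<xi> x \<and> (\<forall>y. solves_ivp v \<xi> y \<longrightarrow> (\<forall>t\<ge>0. y t = x t)))"

text \<open>Only meaningful for a forward-complete \<open>v\<close> and \<open>t \<ge> 0\<close>.\<close>

definition flow :: "(real \<Rightarrow> real) \<Rightarrow> real \<Rightarrow> real \<Rightarrow> real" where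
  "flow v t \<xi> = (THE y. \<exists>x. solves_ivp v \<xi> x \<and> x t = y)"

definition critical_points :: "nat \<Rightarrow> (nat \<Rightarrow> real \<Rightarrow> real) \<Rightarrow> real set" where
  "critical_points N u = {x. \<exists>i\<in>{1..N}. u i x = 0}"

text \<open>
  The index set is \<open>{1..N}\<close>. The diagonal entries \<open>lam i i\<close> and the values of \<open>lam\<close>
  outside the index set are never used.
\<close>

definition exit_rate :: "nat \<Rightarrow> (nat \<Rightarrow> nat \<Rightarrow> real) \<Rightarrow> nat \<Rightarrow> real" where
  "exit_rate N lam i = (\<Sum>j\<in>{1..N} - {i}. lam i j)"

definition jump_law :: "nat \<Rightarrow> (nat \<Rightarrow> nat \<Rightarrow> real) \<Rightarrow> nat \<Rightarrow> nat measure" where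
  "jump_law N lam i = density (count_space {1..N})
     (\<lambda>j. ennreal (if j = i then 0 else lam i j / exit_rate N lam i))"

text \<open>
  The chain with jump rates \<open>lam\<close> is realized by its holding times and its embedded
  jump chain. A sample point \<open>\<omega>\<close> assigns to each \<open>n\<close> and each state \<open>i\<close> a pair \<open>\<omega> n i\<close>: if the
  sojourn number \<open>n\<close> (counted from 0) takes place in the state \<open>i\<close>, it lasts
  \<open>fst (\<omega> n i)\<close> and is followed by a switch to \<open>snd (\<omega> n i)\<close>. All these
  random variables are independent.
\<close>

type_synonym sample = "nat \<Rightarrow> nat \<Rightarrow> real \<times> nat"

definition sojourn_space :: "nat \<Rightarrow> (nat \<Rightarrow> nat \<Rightarrow> real) \<Rightarrow> (nat \<Rightarrow> real \<times> nat) measure" where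
  "sojourn_space N lam = (\<Pi>\<^sub>M i\<in>{1..N}.
     density lborel (\<lambda>x. ennreal (exponential_density (exit_rate N lam i) x))
       \<Otimes>\<^sub>M jump_law N lam i)"

definition sample_space :: "nat \<Rightarrow> (nat \<Rightarrow> nat \<Rightarrow> real) \<Rightarrow> sample measure" where
  "sample_space N lam = (\<Pi>\<^sub>M n\<in>(UNIV :: nat set). sojourn_space N lam)"

primrec jump_chain :: "nat \<Rightarrow> sample \<Rightarrow> nat \<Rightarrow> nat" where
  "jump_chain i \<omega> 0 = i"
| "jump_chain i \<omega> (Suc n) = snd (\<omega> n (jump_chain i \<omega> n))"

definition holding_time :: "nat \<Rightarrow> sample \<Rightarrow> nat \<Rightarrow> real" where
  "holding_time i \<omega> n = fst (\<omega> n (jump_chain i \<omega> n))"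

definition jump_time :: "nat \<Rightarrow> sample \<Rightarrow> nat \<Rightarrow> real" where
  "jump_time i \<omega> n = (\<Sum>k<n. holding_time i \<omega> k)"

primrec jump_position ::
    "(nat \<Rightarrow> real \<Rightarrow> real) \<Rightarrow> real \<Rightarrow> nat \<Rightarrow> sample \<Rightarrow> nat \<Rightarrow> real" where
  "jump_position u \<xi> i \<omega> 0 = \<xi>"
| "jump_position u \<xi> i \<omega> (Suc n) =
     flow (u (jump_chain i \<omega> n)) (holding_time i \<omega> n) (jump_position u \<xi> i \<omega> n)"

text \<open>
  The jump times tend to infinity almost surely, so the minimum below exists for all
  \<open>t\<close> outside a null set of sample points.
\<close>

definition num_jumps :: "nat \<Rightarrow> sample \<Rightarrow> real \<Rightarrow> nat" where
  "num_jumps i \<omega> t = (LEAST n. t < jump_time i \<omega> (Suc n))"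

definition switching_process ::
    "(nat \<Rightarrow> real \<Rightarrow> real) \<Rightarrow> real \<Rightarrow> nat \<Rightarrow> real \<Rightarrow> sample \<Rightarrow> real \<times> nat" where
  "switching_process u \<xi> i t \<omega> =
     (let n = num_jumps i \<omega> t; k = jump_chain i \<omega> n
      in (flow (u k) (t - jump_time i \<omega> n) (jump_position u \<xi> i \<omega> n), k))"

definition state_space :: "nat \<Rightarrow> (real \<times> nat) measure" where
  "state_space N = borel \<Otimes>\<^sub>M count_space {1..N}"

definition transition_prob ::
    "nat \<Rightarrow> (nat \<Rightarrow> real \<Rightarrow> real) \<Rightarrow> (nat \<Rightarrow> nat \<Rightarrow> real) \<Rightarrow> real \<Rightarrow> real \<Rightarrow> nat \<Rightarrow> (real \<times> nat) measure"
  where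
  "transition_prob N u lam t \<xi> i =
     distr (sample_space N lam) (state_space N) (switching_process u \<xi> i t)"

definition component :: "(real \<times> nat) measure \<Rightarrow> nat \<Rightarrow> real measure" where
  "component \<mu> i = distr (restrict_space \<mu> (UNIV \<times> {i})) borel fst"

definition invariant_measure ::
    "nat \<Rightarrow> (nat \<Rightarrow> real \<Rightarrow> real) \<Rightarrow> (nat \<Rightarrow> nat \<Rightarrow> real) \<Rightarrow> (real \<times> nat) measure \<Rightarrow> bool" where
  "invariant_measure N u lam \<mu> \<longleftrightarrow>
     prob_space \<mu> \<and> sets \<mu> = sets (state_space N) \<and>
     (\<forall>E\<in>sets borel. \<forall>i\<in>{1..N}. \<forall>t\<ge>0.
        emeasure \<mu> (E \<times> {i}) =
          (\<Sum>j\<in>{1..N}. \<integral>\<^sup>+\<xi>. emeasure (transition_prob N u lam t \<xi> j) (E \<times> {i}) \<partial>component \<mu> j))"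

definition lebesgue_density :: "real measure \<Rightarrow> (real \<Rightarrow> real) \<Rightarrow> bool" where
  "lebesgue_density \<nu> r \<longleftrightarrow>
     integrable lborel r \<and> (AE x in lborel. 0 \<le> r x) \<and> \<nu> = density lborel (\<lambda>x. ennreal (r x))"

text \<open>This is a property of the class of \<open>f\<close> modulo equality almost everywhere.\<close>

definition bounded_right_of_zero :: "(real \<Rightarrow> real) \<Rightarrow> bool" where
  "bounded_right_of_zero f \<longleftrightarrow>
     (\<exists>g\<in>borel_measurable lborel. (AE x in lborel. g x = f x) \<and>
        (\<exists>\<epsilon>>0. bounded (g ` {0<..<\<epsilon>})))"

primrec flow_composition ::
    "(nat \<Rightarrow> real \<Rightarrow> real) \<Rightarrow> (nat \<times> real) list \<Rightarrow> real \<Rightarrow> real" where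
  "flow_composition u [] x = x"
| "flow_composition u (p # ps) x = flow (u (fst p)) (snd p) (flow_composition u ps x)"

definition invariant_set :: "nat \<Rightarrow> (nat \<Rightarrow> real \<Rightarrow> real) \<Rightarrow> real set \<Rightarrow> bool" where
  "invariant_set N u J \<longleftrightarrow> J \<noteq> {} \<and>
     (\<forall>ps. set ps \<subseteq> {1..N} \<times> {0..} \<longrightarrow> flow_composition u ps ` J \<subseteq> J)"

definition minimal_invariant_set :: "nat \<Rightarrow> (nat \<Rightarrow> real \<Rightarrow> real) \<Rightarrow> real set \<Rightarrow> bool" where
  "minimal_invariant_set N u J \<longleftrightarrow> invariant_set N u J \<and> (\<forall>K. K \<subset> J \<longrightarrow> \<not> invariant_set N u K)"

definition support_intervals ::
    "nat \<Rightarrow> (nat \<Rightarrow> real \<Rightarrow> real) \<Rightarrow> (real \<times> nat) measure \<Rightarrow> real set set" where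
  "support_intervals N u \<mu> =
     {closure J | J. minimal_invariant_set N u J \<and> emeasure \<mu> (J \<times> {1..N}) > 0}"

definition case_B :: "nat \<Rightarrow> (nat \<Rightarrow> real \<Rightarrow> real) \<Rightarrow> (real \<times> nat) measure \<Rightarrow> bool" where
  "case_B N u \<mu> \<longleftrightarrow> (\<exists>I\<in>support_intervals N u \<mu>. 0 \<in> interior I)"

definition case_C :: "nat \<Rightarrow> (nat \<Rightarrow> real \<Rightarrow> real) \<Rightarrow> (real \<times> nat) measure \<Rightarrow> bool" where
  "case_C N u \<mu> \<longleftrightarrow> (\<exists>I\<in>support_intervals N u \<mu>. 0 \<in> I \<and> (\<forall>x\<in>I. 0 \<le> x))"

end

theory Submission
  imports Defs
begin

text \<open>
  The invariant densities satisfy the stationary Kolmogorov forward equation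
  \<open>(u\<^sub>i \<rho>\<^sub>i)' = (\<Sum>j\<noteq>i. lam j i \<rho>\<^sub>j) - rate i \<rho>\<^sub>i\<close> in the sense of distributions. Hence the fluxes
  \<open>w\<^sub>i = u\<^sub>i \<rho>\<^sub>i\<close> have continuous representatives (\<open>flux_eq\<close>). The equation is derived from the
  pathwise construction of the process: over a short time \<open>t\<close> at most one switch occurs up to
  probability \<open>O(t\<^sup>2)\<close> (\<open>short_time_expansion\<close>), and invariance divided by \<open>t\<close> is tested with
  ramp functions, along which every flow is Lipschitz in time uniformly in the starting point.

  Only \<open>u\<^sub>1\<close> vanishes at \<open>0\<close>, so the densities \<open>\<rho>\<^sub>j = w\<^sub>j / u\<^sub>j\<close> with \<open>j \<noteq> 1\<close> are continuous there. Let
  \<open>a > 0\<close>, which is implied by the hypothesis in each of the three parts. To the right of \<open>0\<close> the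
  function \<open>v = - w\<^sub>1 \<ge> 0\<close> solves \<open>v' = (p / x + O(1)) v - h\<close> with \<open>p = rate 1 / a\<close> and a bounded inflow
  \<open>h = (\<Sum>j\<noteq>1. lam j 1 \<rho>\<^sub>j) \<ge> 0\<close>, while \<open>\<rho>\<^sub>1\<close> behaves like \<open>v / (a x)\<close>. Multiplication with \<open>x powr (- p)\<close>
  separates the three regimes:

  \<^item> If \<open>p < 1\<close>, then \<open>v\<close> is at least of order \<open>x powr p\<close> as soon as it is positive somewhere close
    to \<open>0\<close>, and \<open>\<rho>\<^sub>1\<close> is at least of order \<open>x powr (p - 1)\<close>.
  \<^item> If \<open>p > 1\<close>, then \<open>v\<close> is at most linear and \<open>\<rho>\<^sub>1\<close> is bounded.
  \<^item> If \<open>p = 1\<close> and \<open>h\<close> is positive at \<open>0\<close>, then \<open>v / x\<close> grows at least like \<open>- ln x\<close>.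

  What remains is the positivity required in the first and the last item, and this is where the
  support enters. Minimality of an invariant set \<open>J\<close> implies that at each interior point some field
  points to the left and some field points to the right
  (\<open>minimal_invariant_set_crossing\<close>). If the flux of a field that points to the left is zero at an
  interior point, then all densities vanish immediately to the right of that point
  (\<open>densities_vanish_on_side\<close>), and likewise with left and right exchanged. The set where
  all fluxes vanish is therefore open and closed in the interior of \<open>J\<close>; if it were not empty, \<open>J\<close>
  would carry no mass (\<open>minimal_set_null_if_densities_vanish\<close>).
\<close>

section \<open>One-dimensional flows\<close>

lemma solves_ivp_shift:
  assumes "solves_ivp v \<xi> x" "s \<ge> 0"
  shows "solves_ivp v (x s) (\<lambda>r. x (s + r))"
  unfolding solves_ivp_def
proof (intro conjI allI impI)
  fix t :: real assume t: "t \<ge> 0"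
  have "(x has_real_derivative v (x (s + t))) (at (s + t) within {0..})"
    using assms t by (auto simp: solves_ivp_def)
  hence "(x has_real_derivative v (x (s + t))) (at (s + t) within (+) s ` {0..})"
    by (rule has_field_derivative_subset) (use assms in auto)
  hence "((\<lambda>r. x (s + r)) has_real_derivative v (x (s + t)) * 1) (at t within {0..})"
    by (intro DERIV_image_chain[unfolded o_def, where f = x and g = "\<lambda>r. s + r"])
       (auto intro!: derivative_eq_intros)
  thus "((\<lambda>r. x (s + r)) has_real_derivative v (x (s + t))) (at t within {0..})" by simp
qed auto

lemma solves_ivp_continuous_on: "solves_ivp v \<xi> x \<Longrightarrow> continuous_on {0..} x"
  unfolding solves_ivp_def by (meson DERIV_continuous_on atLeast_iff)

lemma flow_solves_ivp:
  assumes "forward_complete v"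
  shows "solves_ivp v \<xi> (\<lambda>t. flow v t \<xi>)"
proof -
  obtain x where x: "solves_ivp v \<xi> x" "\<And>y t. solves_ivp v \<xi> y \<Longrightarrow> t \<ge> 0 \<Longrightarrow> y t = x t"
    using assms unfolding forward_complete_def by meson
  have eq: "flow v t \<xi> = x t" if "t \<ge> 0" for t
    unfolding flow_def by (rule the_equality) (use x that in blast)+
  have "((\<lambda>t. flow v t \<xi>) has_real_derivative v (flow v t \<xi>)) (at t within {0..})"
    if "t \<ge> 0" for t
  proof -
    have "(x has_real_derivative v (x t)) (at t within {0..})"
      using x(1) that by (auto simp: solves_ivp_def)
    thus ?thesis
      using that eq
      by (subst has_field_derivative_cong_ev[where g = x and y = t]) (auto simp: eventually_at_filter)
  qed
  moreover have "flow v 0 \<xi> = \<xi>" using eq[of 0] x(1) by (simp add: solves_ivp_def)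
  ultimately show ?thesis by (auto simp: solves_ivp_def)
qed

lemma solves_ivp_eq_flow:
  assumes "forward_complete v" "solves_ivp v \<xi> x" "t \<ge> 0"
  shows "x t = flow v t \<xi>"
  using assms flow_solves_ivp[OF assms(1), of \<xi>] unfolding forward_complete_def by metis

lemma flow_0 [simp]: "forward_complete v \<Longrightarrow> flow v 0 \<xi> = \<xi>"
  using flow_solves_ivp[of v \<xi>] by (simp add: solves_ivp_def)

lemma flow_DERIV:
  "forward_complete v \<Longrightarrow> t \<ge> 0 \<Longrightarrow>
    ((\<lambda>t. flow v t \<xi>) has_real_derivative v (flow v t \<xi>)) (at t within {0..})"
  using flow_solves_ivp[of v \<xi>] by (simp add: solves_ivp_def)

lemma flow_continuous_on: "forward_complete v \<Longrightarrow> continuous_on {0..} (\<lambda>t. flow v t \<xi>)"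
  using solves_ivp_continuous_on flow_solves_ivp by blast

lemma flow_add:
  assumes "forward_complete v" "s \<ge> 0" "t \<ge> 0"
  shows "flow v (s + t) \<xi> = flow v t (flow v s \<xi>)"
  using solves_ivp_eq_flow[OF assms(1) solves_ivp_shift[OF flow_solves_ivp[OF assms(1)] assms(2)] assms(3)]
  by simp

lemma flow_equilibrium:
  assumes "forward_complete v" "v \<beta> = 0" "t \<ge> 0"
  shows "flow v t \<beta> = \<beta>"
  using solves_ivp_eq_flow[OF assms(1) _ assms(3), of \<beta> "\<lambda>_. \<beta>"] assms(2)
  by (simp add: solves_ivp_def)

text \<open>Two trajectories that meet coincide afterwards, so trajectories cannot overtake each other.
  On the line this makes the flow maps monotone, hence Borel, without any regularity
  theory for the dependence on the initial value.\<close>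

lemma flow_mono:
  assumes v: "forward_complete v" and "\<xi> \<le> \<eta>" "t \<ge> 0"
  shows "flow v t \<xi> \<le> flow v t \<eta>"
proof (rule ccontr)
  assume less: "\<not> flow v t \<xi> \<le> flow v t \<eta>"
  define d where "d s = flow v s \<eta> - flow v s \<xi>" for s
  have "continuous_on {0..t} d"
    unfolding d_def
    by (intro continuous_intros continuous_on_subset[OF flow_continuous_on[OF v]]) auto
  then obtain s where s: "0 \<le> s" "s \<le> t" "d s = 0"
    using IVT2'[of d t 0 0] assms less by (auto simp: d_def)
  have "flow v (s + (t - s)) \<xi> = flow v (s + (t - s)) \<eta>"
    using s by (subst (1 2) flow_add[OF v]) (auto simp: d_def)
  thus False using less by simp
qed

text \<open>At \<open>\<beta>\<close> a trajectory can only move in the direction of \<open>v \<beta>\<close>, and no trajectory can overtake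
  the one that starts at \<open>\<beta>\<close>. The sign \<open>\<sigma>\<close> treats both sides of \<open>\<beta>\<close> at once.\<close>

lemma flow_stays_on_side:
  fixes \<sigma> :: real
  assumes v: "forward_complete v" and sg: "\<bar>\<sigma>\<bar> = 1" and "\<sigma> * v \<beta> \<ge> 0" and le: "\<sigma> * \<beta> \<le> \<sigma> * x"
    and t: "t \<ge> 0"
  shows "\<sigma> * \<beta> \<le> \<sigma> * flow v t x"
proof -
  have main: "\<sigma> * \<beta> \<le> \<sigma> * flow v t \<beta>"
  proof (cases "v \<beta> = 0")
    case True
    thus ?thesis using flow_equilibrium[OF v True t] by simp
  next
    case False
    hence pos: "\<sigma> * v \<beta> > 0" using assms by (auto simp: less_le)
    define y where "y s = \<sigma> * flow v s \<beta>" for s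
    have cont: "continuous_on {0..t} y"
      unfolding y_def
      by (intro continuous_intros continuous_on_subset[OF flow_continuous_on[OF v]]) auto
    show ?thesis
    proof (rule ccontr)
      assume "\<not> ?thesis"
      hence neg: "y t < \<sigma> * \<beta>" by (simp add: y_def)
      \<comment> \<open>the last time at which the trajectory has not yet passed \<open>\<beta>\<close>\<close>
      define S where "S = {0..t} \<inter> y -` {\<sigma> * \<beta>..}"
      have "closed S"
        unfolding S_def by (rule continuous_closed_preimage[OF cont]) auto
      moreover have "S \<subseteq> {0..t}" by (auto simp: S_def)
      ultimately have "compact S"
        by (meson bounded_closed_interval bounded_subset compact_eq_bounded_closed)
      moreover have "0 \<in> S" using v t by (simp add: S_def y_def)
      ultimately obtain s where s: "s \<in> S" "\<And>r. r \<in> S \<Longrightarrow> r \<le> s"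
        using compact_attains_sup[of S] by auto
      have s': "0 \<le> s" "s < t" using s neg by (auto simp: S_def less_le)
      have ys: "y s = \<sigma> * \<beta>"
      proof (rule ccontr)
        assume "y s \<noteq> \<sigma> * \<beta>"
        hence "y s > \<sigma> * \<beta>" using s by (auto simp: S_def)
        have "continuous_on {s..t} y" by (rule continuous_on_subset[OF cont]) (use s' in auto)
        then obtain r where r: "s \<le> r" "r \<le> t" "y r = \<sigma> * \<beta>"
          using IVT2'[of y t "\<sigma> * \<beta>" s] neg \<open>y s > \<sigma> * \<beta>\<close> s' by auto
        with s' have "r \<in> S" by (auto simp: S_def)
        with s r \<open>y s > \<sigma> * \<beta>\<close> show False by force
      qed
      have "flow v s \<beta> = \<beta>" using ys sg by (auto simp: y_def)
      hence "(y has_real_derivative \<sigma> * v \<beta>) (at s within {0..})"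
        unfolding y_def using flow_DERIV[OF v s'(1), of \<beta>] by (auto intro!: derivative_eq_intros)
      from has_real_derivative_pos_inc_right[OF this pos]
      obtain d where d: "d > 0" "\<And>h. h > 0 \<Longrightarrow> s + h \<in> {0..} \<Longrightarrow> h < d \<Longrightarrow> y s < y (s + h)"
        by auto
      define h where "h = min (d / 2) (t - s)"
      have "h > 0" "h < d" "s + h \<le> t" using d s' by (auto simp: h_def)
      hence "s + h \<in> S" using d(2)[of h] s' ys by (auto simp: S_def)
      thus False using s(2) \<open>h > 0\<close> by force
    qed
  qed
  show ?thesis
  proof (cases "\<sigma> = 1")
    case True
    thus ?thesis using main flow_mono[OF v _ t, of \<beta> x] le by simp
  next
    case False
    hence "\<sigma> = -1" using sg by auto
    thus ?thesis using main flow_mono[OF v _ t, of x \<beta>] le by simp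
  qed
qed

lemma flow_measurable [measurable]:
  assumes v: "forward_complete v"
  shows "(\<lambda>(t, \<xi>). flow v t \<xi>) \<in> borel_measurable (borel \<Otimes>\<^sub>M borel)"
proof -
  define c where "c = (THE y::real. True)"
  have neg: "flow v t \<xi> = c" if "t < 0" for t \<xi>
  proof -
    have "\<exists>x. solves_ivp v \<xi> x \<and> x t = y" for y
    proof -
      obtain x where x: "solves_ivp v \<xi> x" using flow_solves_ivp[OF v] by blast
      have "solves_ivp v \<xi> (x(t := y))"
        unfolding solves_ivp_def
      proof (intro conjI allI impI)
        fix s :: real assume "s \<ge> 0"
        hence "(x has_real_derivative v (x s)) (at s within {0..})"
          using x by (auto simp: solves_ivp_def)
        thus "(x(t := y) has_real_derivative v ((x(t := y)) s)) (at s within {0..})"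
          using \<open>s \<ge> 0\<close> \<open>t < 0\<close>
          by (subst has_field_derivative_cong_ev[where g = x and y = s]) (auto simp: eventually_at_filter)
      qed (use x that in \<open>auto simp: solves_ivp_def\<close>)
      thus ?thesis by (intro exI[of _ "x(t := y)"]) auto
    qed
    thus ?thesis unfolding flow_def c_def by presburger
  qed
  have step: "(\<lambda>\<xi>. flow v (real k / real n) \<xi>) \<in> borel_measurable borel" for k n
    by (rule borel_measurable_mono) (auto intro!: monoI flow_mono[OF v])
  \<comment> \<open>the value at \<open>t\<close> is the limit of the values at the grid points just below \<open>t\<close>\<close>
  define F where "F n z = flow v (real (nat \<lfloor>fst z * real n\<rfloor>) / real n) (snd z)"
    for n :: nat and z :: "real \<times> real"
  have F: "F n \<in> borel_measurable (borel \<Otimes>\<^sub>M borel)" for n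
    unfolding F_def
    by (rule measurable_compose_countable[where f = "\<lambda>k z. flow v (real k / real n) (snd z)"])
       (use measurable_compose[OF measurable_snd step] in measurable)
  have lim: "(\<lambda>n. F n z) \<longlonglongrightarrow> flow v (fst z) (snd z)" if "fst z \<ge> 0" for z
  proof -
    have "(\<lambda>n. real (nat \<lfloor>fst z * real n\<rfloor>) / real n) \<longlonglongrightarrow> fst z"
    proof (rule real_tendsto_sandwich)
      show "\<forall>\<^sub>F n in sequentially. fst z - 1 / real n \<le> real (nat \<lfloor>fst z * real n\<rfloor>) / real n"
        using eventually_gt_at_top[of 0]
      proof eventually_elim
        case (elim n)
        have "real (nat \<lfloor>fst z * real n\<rfloor>) \<ge> fst z * real n - 1"
          using that by linarith
        hence "fst z \<le> (real (nat \<lfloor>fst z * real n\<rfloor>) + 1) / real n"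
          using elim by (subst le_divide_eq) auto
        thus ?case by (simp add: add_divide_distrib)
      qed
      show "\<forall>\<^sub>F n in sequentially. real (nat \<lfloor>fst z * real n\<rfloor>) / real n \<le> fst z"
        using eventually_gt_at_top[of 0]
      proof eventually_elim
        case (elim n)
        have "real (nat \<lfloor>fst z * real n\<rfloor>) \<le> fst z * real n"
          using that by (simp add: of_nat_nat)
        thus ?case using elim by (simp add: field_simps)
      qed
      have "(\<lambda>n. fst z - 1 / real n) \<longlonglongrightarrow> fst z - 0"
        by (intro tendsto_intros lim_1_over_n)
      thus "(\<lambda>n. fst z - 1 / real n) \<longlonglongrightarrow> fst z" by simp
    qed auto
    thus ?thesis
      unfolding F_def
      by (rule continuous_on_tendsto_compose[OF flow_continuous_on[OF v, of "snd z"]]) (use that in auto)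
  qed
  have "(\<lambda>z. if fst z < 0 then c else flow v (fst z) (snd z)) \<in> borel_measurable (borel \<Otimes>\<^sub>M borel)"
  proof (rule borel_measurable_LIMSEQ_real)
    show "(\<lambda>n. if fst z < 0 then c else F n z) \<longlonglongrightarrow> (if fst z < 0 then c else flow v (fst z) (snd z))" for z
      using lim[of z] by auto
    show "(\<lambda>z. if fst z < 0 then c else F n z) \<in> borel_measurable (borel \<Otimes>\<^sub>M borel)" for n
      using F[of n] by measurable
  qed
  also have "(\<lambda>z. if fst z < 0 then c else flow v (fst z) (snd z)) = (\<lambda>(t, \<xi>). flow v t \<xi>)"
    using neg by (auto simp: fun_eq_iff)
  finally show ?thesis .
qed

text \<open>Clamping to a compact interval makes a trajectory Lipschitz in time, uniformly in the
  initial value: the clamped trajectory moves only while the speed is at most the maximum of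
  \<open>\<bar>v\<bar>\<close> on that interval.\<close>

lemma clamped_flow_lipschitz:
  fixes p q M :: real
  assumes v: "forward_complete v" and pq: "p \<le> q"
    and M: "\<And>x. x \<in> {p..q} \<Longrightarrow> \<bar>v x\<bar> \<le> M" and t: "t \<ge> 0"
  shows "\<bar>max p (min q (flow v t \<xi>)) - max p (min q \<xi>)\<bar> \<le> M * t"
proof -
  have "M \<ge> 0" using M[of p] pq by auto
  define c where "c = (\<lambda>x. max p (min q x) :: real)"
  define y where "y s = c (flow v s \<xi>)" for s
  have fl: "continuous_on {0..t} (\<lambda>s. flow v s \<xi>)"
    by (rule continuous_on_subset[OF flow_continuous_on[OF v]]) auto
  have cont: "continuous_on {0..t} y"
    unfolding y_def c_def by (intro continuous_intros fl)
  show ?thesis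
  proof (cases "y t = y 0")
    case True
    thus ?thesis using v t \<open>M \<ge> 0\<close> by (simp add: y_def c_def)
  next
    case False
    define lo where "lo = min (y 0) (y t)"
    define hi where "hi = max (y 0) (y t)"
    have "lo < hi" using False unfolding lo_def hi_def by linarith
    moreover have "y s \<in> {p..q}" for s using pq by (simp add: y_def c_def)
    hence "p \<le> lo" "hi \<le> q" unfolding lo_def hi_def by simp_all
    ultimately have lohi: "p \<le> lo" "lo < hi" "hi \<le> q" by simp_all
    \<comment> \<open>last visit to the initial clamped value, then first visit to the final one\<close>
    define S where "S = {s \<in> {0..t}. y s = y 0}"
    have "closed S"
      unfolding S_def using continuous_closed_preimage_constant[OF cont] by auto
    moreover have "S \<subseteq> {0..t}" by (auto simp: S_def)
    ultimately have "compact S"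
      by (meson bounded_closed_interval bounded_subset compact_eq_bounded_closed)
    moreover have "0 \<in> S" using t by (simp add: S_def)
    ultimately obtain s1 where s1: "s1 \<in> S" "\<And>r. r \<in> S \<Longrightarrow> r \<le> s1"
      using compact_attains_sup[of S] by auto
    have s1': "0 \<le> s1" "s1 < t" "y s1 = y 0" using s1 False by (auto simp: S_def less_le)
    define T where "T = {s \<in> {s1..t}. y s = y t}"
    have cont1: "continuous_on {s1..t} y" by (rule continuous_on_subset[OF cont]) (use s1' in auto)
    have "closed T" unfolding T_def using continuous_closed_preimage_constant[OF cont1] by auto
    moreover have "T \<subseteq> {s1..t}" by (auto simp: T_def)
    ultimately have "compact T"
      by (meson bounded_closed_interval bounded_subset compact_eq_bounded_closed)
    moreover have "t \<in> T" using s1' by (simp add: T_def)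
    ultimately obtain s2 where s2: "s2 \<in> T" "\<And>r. r \<in> T \<Longrightarrow> s2 \<le> r"
      using compact_attains_inf[of T] by auto
    have s2'': "s1 \<le> s2" "s2 \<le> t" "y s2 = y t" using s2(1) by (simp_all add: T_def)
    moreover have "s1 \<noteq> s2" using s2''(3) s1'(3) False by metis
    ultimately have s2': "s1 < s2" "s2 \<le> t" "y s2 = y t" by simp_all
    have btw: "lo < y r \<and> y r < hi" if r: "s1 < r" "r < s2" for r
    proof (rule ccontr)
      assume out: "\<not> ?thesis"
      have "r \<notin> S" "r \<notin> T" using s1(2)[of r] s2(2)[of r] r by linarith+
      hence ne: "y r \<noteq> y 0" "y r \<noteq> y t" using r s1' s2' by (simp_all add: S_def T_def)
      have c1: "continuous_on {s1..r} y" "continuous_on {r..s2} y"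
        by (rule continuous_on_subset[OF cont], use s1' s2' r in auto)+
      have "(y 0 < y t \<and> y r < y 0) \<or> (y 0 < y t \<and> y r > y t) \<or>
          (y t < y 0 \<and> y r > y 0) \<or> (y t < y 0 \<and> y r < y t)"
        using out ne False unfolding lo_def hi_def by linarith
      then consider "y 0 < y t" "y r < y 0" | "y 0 < y t" "y r > y t"
        | "y t < y 0" "y r > y 0" | "y t < y 0" "y r < y t"
        by blast
      thus False
      proof cases
        case 1
        then obtain z where "r \<le> z" "z \<le> s2" "y z = y 0"
          using IVT'[of y r "y 0" s2] c1 s2' r by auto
        moreover from this have "z \<in> S" using r s1' s2' by (simp add: S_def)
        ultimately show False using s1(2)[of z] r by linarith
      next
        case 2
        then obtain z where "s1 \<le> z" "z \<le> r" "y z = y t"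
          using IVT'[of y s1 "y t" r] c1 s1' r by auto
        moreover from this have "z \<in> T" using r s1' s2' by (simp add: T_def)
        ultimately show False using s2(2)[of z] r by linarith
      next
        case 3
        then obtain z where "r \<le> z" "z \<le> s2" "y z = y 0"
          using IVT2'[of y s2 "y 0" r] c1 s2' r by auto
        moreover from this have "z \<in> S" using r s1' s2' by (simp add: S_def)
        ultimately show False using s1(2)[of z] r by linarith
      next
        case 4
        then obtain z where "s1 \<le> z" "z \<le> r" "y z = y t"
          using IVT2'[of y r "y t" s1] c1 s1' r by auto
        moreover from this have "z \<in> T" using r s1' s2' by (simp add: T_def)
        ultimately show False using s2(2)[of z] r by linarith
      qed
    qed
    have inn: "y r = flow v r \<xi> \<and> y r \<in> {p..q}" if "s1 < r" "r < s2" for r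
    proof -
      have "p < y r" "y r < q" using btw[OF that] lohi by linarith+
      thus ?thesis unfolding y_def c_def by simp linarith
    qed
    have deriv: "(y has_real_derivative v (flow v z \<xi>)) (at z)" if z: "s1 < z" "z < s2" for z
    proof -
      have "((\<lambda>s. flow v s \<xi>) has_real_derivative v (flow v z \<xi>)) (at z within {s1<..<s2})"
        by (rule has_field_derivative_subset[OF flow_DERIV[OF v]]) (use z s1' in auto)
      hence "((\<lambda>s. flow v s \<xi>) has_real_derivative v (flow v z \<xi>)) (at z)"
        using z by (subst (asm) at_within_open) auto
      moreover have "\<forall>\<^sub>F s in nhds z. y s = flow v s \<xi>"
        using eventually_nhds_in_open[of "{s1<..<s2}" z] z
        by (auto elim!: eventually_mono simp: inn)
      ultimately show ?thesis by (subst DERIV_cong_ev[OF refl _ refl])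
    qed
    have "\<exists>l z. s1 < z \<and> z < s2 \<and> DERIV y z :> l \<and> y s2 - y s1 = (s2 - s1) * l"
    proof (rule MVT)
      show "continuous_on {s1..s2} y"
        by (rule continuous_on_subset[OF cont]) (use s1' s2' in auto)
    qed (use s2' deriv in \<open>auto simp: real_differentiable_def\<close>)
    then obtain l z where z: "s1 < z" "z < s2" "DERIV y z :> l" "y s2 - y s1 = (s2 - s1) * l" by blast
    have "(y has_real_derivative v (flow v z \<xi>)) (at z)" using deriv z by blast
    hence "l = v (flow v z \<xi>)" using z(3) DERIV_unique by blast
    hence "\<bar>l\<bar> \<le> M" using M[of "flow v z \<xi>"] inn[OF z(1,2)] by simp
    have "\<bar>y t - y 0\<bar> = (s2 - s1) * \<bar>l\<bar>"
      using z(4) s1'(3) s2'(1,3) by (simp add: abs_mult)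
    also have "\<dots> \<le> t * M" using \<open>\<bar>l\<bar> \<le> M\<close> s1'(1) s2'(2) t \<open>M \<ge> 0\<close> by (intro mult_mono) simp_all
    finally show ?thesis unfolding y_def c_def flow_0[OF v] by (simp only: mult.commute)
  qed
qed

section \<open>Minimal invariant sets\<close>

lemma invariant_setI:
  assumes "J \<noteq> {}" "\<And>i t x. i \<in> {1..N} \<Longrightarrow> t \<ge> 0 \<Longrightarrow> x \<in> J \<Longrightarrow> flow (u i) t x \<in> J"
  shows "invariant_set N u J"
proof -
  have "flow_composition u ps x \<in> J" if "set ps \<subseteq> {1..N} \<times> {0..}" "x \<in> J" for ps x
    using that by (induction ps) (auto intro!: assms(2))
  thus ?thesis using assms(1) by (auto simp: invariant_set_def)
qed

lemma invariant_set_flow: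
  assumes "invariant_set N u J" "i \<in> {1..N}" "t \<ge> 0" "x \<in> J"
  shows "flow (u i) t x \<in> J"
proof -
  have "flow_composition u [(i, t)] ` J \<subseteq> J"
    using assms unfolding invariant_set_def by (metis SigmaI atLeast_iff empty_iff insert_iff list.set(1) list.simps(15) subsetI)
  thus ?thesis using assms by auto
qed

text \<open>A trajectory that starts in \<open>J\<close> cannot pass a point outside \<open>J\<close>, so a gap
  in \<open>J\<close> would split it into smaller invariant sets.\<close>

lemma minimal_invariant_set_convex:
  assumes fc: "\<And>i. i \<in> {1..N} \<Longrightarrow> forward_complete (u i)"
    and J: "minimal_invariant_set N u J"
  shows "convex J"
proof -
  have inv: "invariant_set N u J" using J by (simp add: minimal_invariant_set_def)
  have "z \<in> J" if "x \<in> J" "y \<in> J" "x < z" "z < y" for x y z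
  proof (rule ccontr)
    assume z: "z \<notin> J"
    have "invariant_set N u (J \<inter> {z<..})"
    proof (rule invariant_setI)
      fix i and t \<xi> :: real assume i: "i \<in> {1..N}" "t \<ge> 0" "\<xi> \<in> J \<inter> {z<..}"
      have inJ: "flow (u i) s \<xi> \<in> J" if "s \<ge> 0" for s
        using invariant_set_flow[OF inv i(1) that] i(3) by auto
      have "flow (u i) t \<xi> > z"
      proof (rule ccontr)
        assume "\<not> ?thesis"
        hence le: "flow (u i) t \<xi> \<le> z" by simp
        have "continuous_on {0..t} (\<lambda>s. flow (u i) s \<xi>)"
          by (rule continuous_on_subset[OF flow_continuous_on[OF fc[OF i(1)]]]) auto
        moreover have "z \<le> flow (u i) 0 \<xi>" using i fc[OF i(1)] by simp
        ultimately obtain s where "0 \<le> s" "s \<le> t" "flow (u i) s \<xi> = z"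
          using IVT2'[of "\<lambda>s. flow (u i) s \<xi>" t z 0] i(2) le by blast
        thus False using inJ z by auto
      qed
      thus "flow (u i) t \<xi> \<in> J \<inter> {z<..}" using inJ i by auto
    next
      show "J \<inter> {z<..} \<noteq> {}" using that by blast
    qed
    moreover have "x \<notin> J \<inter> {z<..}" using that by simp
    hence "J \<inter> {z<..} \<subset> J" using that(1) by blast
    ultimately show False using J unfolding minimal_invariant_set_def by blast
  qed
  hence "is_interval J"
    unfolding is_interval_1 by (metis less_eq_real_def)
  thus ?thesis by (simp add: is_interval_convex_1)
qed

text \<open>If all fields pointed to the same side at an interior point \<open>\<beta>\<close> of \<open>J\<close>, then the
  part of \<open>J\<close> on that side of \<open>\<beta>\<close> would be invariant.\<close>

lemma minimal_invariant_set_crossing: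
  fixes \<sigma> :: real
  assumes fc: "\<And>i. i \<in> {1..N} \<Longrightarrow> forward_complete (u i)"
    and J: "minimal_invariant_set N u J" and \<beta>: "\<beta> \<in> interior J" and sg: "\<bar>\<sigma>\<bar> = 1"
  obtains i where "i \<in> {1..N}" "\<sigma> * u i \<beta> < 0"
proof (rule ccontr)
  assume "\<not> thesis"
  with that have ge: "\<sigma> * u i \<beta> \<ge> 0" if "i \<in> {1..N}" for i using that by force
  have inv: "invariant_set N u J" using J by (simp add: minimal_invariant_set_def)
  define K where "K = J \<inter> {x. \<sigma> * \<beta> \<le> \<sigma> * x}"
  have "invariant_set N u K"
  proof (rule invariant_setI)
    show "K \<noteq> {}" using interior_subset \<beta> by (auto simp: K_def)
  next
    fix i and t \<xi> :: real assume i: "i \<in> {1..N}" "t \<ge> 0" "\<xi> \<in> K"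
    show "flow (u i) t \<xi> \<in> K"
      using invariant_set_flow[OF inv i(1,2)] i ge
        flow_stays_on_side[OF fc[OF i(1)] sg _ _ i(2)] by (auto simp: K_def)
  qed
  moreover have "K \<subset> J"
  proof -
    obtain e where e: "e > 0" "ball \<beta> e \<subseteq> J" using \<beta> by (auto simp: mem_interior)
    have "\<beta> - \<sigma> * (e / 2) \<in> J" using e sg by (intro subsetD[OF e(2)]) (auto simp: dist_real_def abs_mult)
    moreover have "\<sigma> * (\<beta> - \<sigma> * (e / 2)) < \<sigma> * \<beta>"
    proof -
      have "\<sigma> * \<sigma> = 1" using sg by (metis abs_mult_self_eq mult_1)
      thus ?thesis using e by (simp add: right_diff_distrib flip: mult.assoc)
    qed
    ultimately have "\<beta> - \<sigma> * (e / 2) \<in> J" "\<beta> - \<sigma> * (e / 2) \<notin> K"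
      unfolding K_def by (blast dest: leD)+
    moreover have "K \<subseteq> J" by (simp add: K_def)
    ultimately show ?thesis by blast
  qed
  ultimately show False using J unfolding minimal_invariant_set_def by blast
qed

section \<open>The switching process for short times\<close>

(* the index set is written {1..N}; it should not be rewritten to {Suc 0..N} *)
declare One_nat_def [simp del]

locale switching =
  fixes N :: nat and u :: "nat \<Rightarrow> real \<Rightarrow> real" and lam :: "nat \<Rightarrow> nat \<Rightarrow> real"
  assumes two_states: "N \<ge> 2"
    and continuous_field: "\<And>i. i \<in> {1..N} \<Longrightarrow> continuous_on UNIV (u i)"
    and complete: "\<And>i. i \<in> {1..N} \<Longrightarrow> forward_complete (u i)"
    and rate_pos: "\<And>i j. i \<in> {1..N} \<Longrightarrow> j \<in> {1..N} \<Longrightarrow> i \<noteq> j \<Longrightarrow> lam i j > 0"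
begin

abbreviation \<Omega> :: "sample measure" where "\<Omega> \<equiv> sample_space N lam"
abbreviation rate :: "nat \<Rightarrow> real" where "rate \<equiv> exit_rate N lam"

definition switch_prob :: "nat \<Rightarrow> nat \<Rightarrow> real" where
  "switch_prob i j = (if j = i then 0 else lam i j / rate i)"

definition sojourn_law :: "nat \<Rightarrow> (real \<times> nat) measure" where
  "sojourn_law i = density lborel (\<lambda>x. ennreal (exponential_density (rate i) x)) \<Otimes>\<^sub>M jump_law N lam i"

lemma exit_rate_pos: "i \<in> {1..N} \<Longrightarrow> rate i > 0"
proof -
  assume i: "i \<in> {1..N}"
  define j where "j = (if i = 1 then 2 else 1 :: nat)"
  have "j \<in> {1..N} - {i}" using two_states i by (auto simp: j_def)
  thus ?thesis
    unfolding exit_rate_def using i by (intro sum_pos) (auto intro!: rate_pos)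
qed

lemma switch_prob_nonneg: "i \<in> {1..N} \<Longrightarrow> j \<in> {1..N} \<Longrightarrow> switch_prob i j \<ge> 0"
  using exit_rate_pos[of i] rate_pos[of i j] by (auto simp: switch_prob_def less_imp_le)

lemma rate_switch_prob: "i \<in> {1..N} \<Longrightarrow> rate i * switch_prob i j = (if j = i then 0 else lam i j)"
  using exit_rate_pos[of i] by (simp add: switch_prob_def)

lemma sum_switch_prob: "i \<in> {1..N} \<Longrightarrow> (\<Sum>j\<in>{1..N}. switch_prob i j) = 1"
proof -
  assume i: "i \<in> {1..N}"
  have "(\<Sum>j\<in>{1..N}. switch_prob i j) = (\<Sum>j\<in>{1..N}-{i}. lam i j / rate i)"
    using i by (intro sum.mono_neutral_cong_right) (auto simp: switch_prob_def)
  also have "\<dots> = 1" using exit_rate_pos[OF i] by (simp add: exit_rate_def flip: sum_divide_distrib)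
  finally show ?thesis .
qed

lemma space_jump_law [simp]: "space (jump_law N lam i) = {1..N}"
  and sets_jump_law [measurable_cong, simp]: "sets (jump_law N lam i) = sets (count_space {1..N})"
  by (simp_all add: jump_law_def)

lemma emeasure_jump_law:
  assumes "i \<in> {1..N}" "A \<subseteq> {1..N}"
  shows "emeasure (jump_law N lam i) A = ennreal (\<Sum>j\<in>A. switch_prob i j)"
proof -
  have "emeasure (jump_law N lam i) A =
      (\<Sum>j\<in>{1..N}. ennreal (switch_prob i j) * indicator A j)"
    unfolding jump_law_def switch_prob_def using assms(2)
    by (subst emeasure_density) (auto simp: nn_integral_count_space_finite)
  also have "\<dots> = (\<Sum>j\<in>A. ennreal (switch_prob i j))"
    using assms(2) by (intro sum.mono_neutral_cong_right) (auto simp: indicator_def)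
  also have "\<dots> = ennreal (\<Sum>j\<in>A. switch_prob i j)"
    using assms switch_prob_nonneg by (intro sum_ennreal) auto
  finally show ?thesis .
qed

lemma prob_space_jump_law: "i \<in> {1..N} \<Longrightarrow> prob_space (jump_law N lam i)"
  by (intro prob_spaceI) (simp add: emeasure_jump_law sum_switch_prob)

lemma prob_space_holding_law:
  "i \<in> {1..N} \<Longrightarrow> prob_space (density lborel (\<lambda>x. ennreal (exponential_density (rate i) x)))"
  using prob_space_exponential_density[OF exit_rate_pos] .

lemma prob_space_sojourn_law: "i \<in> {1..N} \<Longrightarrow> prob_space (sojourn_law i)"
proof -
  assume i: "i \<in> {1..N}"
  interpret A: prob_space "density lborel (\<lambda>x. ennreal (exponential_density (rate i) x))"
    by (rule prob_space_holding_law[OF i])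
  interpret B: prob_space "jump_law N lam i" by (rule prob_space_jump_law[OF i])
  interpret pair_prob_space "density lborel (\<lambda>x. ennreal (exponential_density (rate i) x))" "jump_law N lam i" ..
  show ?thesis unfolding sojourn_law_def by (rule prob_space_axioms)
qed

lemma space_sojourn_law [simp]: "space (sojourn_law i) = UNIV \<times> {1..N}"
  by (simp add: sojourn_law_def space_pair_measure)

lemma sets_sojourn_law [measurable_cong, simp]:
  "sets (sojourn_law i) = sets (borel \<Otimes>\<^sub>M count_space {1..N})"
  unfolding sojourn_law_def by (intro sets_pair_measure_cong) auto

lemma sojourn_space_eq: "sojourn_space N lam = (\<Pi>\<^sub>M i\<in>{1..N}. sojourn_law i)"
  by (simp add: sojourn_space_def sojourn_law_def)

lemma prob_space_sojourn_space: "prob_space (sojourn_space N lam)"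
  unfolding sojourn_space_eq by (intro prob_space_PiM prob_space_sojourn_law)

lemma prob_space_sample_space: "prob_space \<Omega>"
  unfolding sample_space_def by (intro prob_space_PiM prob_space_sojourn_space)

sublocale prob_space \<Omega> by (rule prob_space_sample_space)

lemma sojourn_measurable [measurable]:
  assumes "k \<in> {1..N}"
  shows "(\<lambda>\<omega>. \<omega> n k) \<in> \<Omega> \<rightarrow>\<^sub>M borel \<Otimes>\<^sub>M count_space {1..N}"
proof -
  have "(\<lambda>\<omega>. \<omega> n) \<in> \<Omega> \<rightarrow>\<^sub>M sojourn_space N lam"
    unfolding sample_space_def by (rule measurable_component_singleton) simp
  moreover have "(\<lambda>x. x k) \<in> sojourn_space N lam \<rightarrow>\<^sub>M sojourn_law k"
    unfolding sojourn_space_eq by (rule measurable_component_singleton) (rule assms)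
  ultimately have "(\<lambda>\<omega>. \<omega> n k) \<in> \<Omega> \<rightarrow>\<^sub>M sojourn_law k" by (rule measurable_compose)
  thus ?thesis by (simp cong: measurable_cong_sets)
qed

lemma emeasure_sojourn:
  assumes "k \<in> {1..N}" "A \<in> sets (borel \<Otimes>\<^sub>M count_space {1..N})"
  shows "emeasure \<Omega> {\<omega>\<in>space \<Omega>. \<omega> n k \<in> A} = emeasure (sojourn_law k) A"
proof -
  have "distr \<Omega> (sojourn_space N lam) (\<lambda>\<omega>. \<omega> n) = sojourn_space N lam"
    unfolding sample_space_def by (rule distr_PiM_component) (simp_all add: prob_space_sojourn_space)
  moreover have "distr (sojourn_space N lam) (sojourn_law k) (\<lambda>x. x k) = sojourn_law k"
    unfolding sojourn_space_eq by (rule distr_PiM_component[OF prob_space_sojourn_law assms(1)])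
  moreover have "(\<lambda>\<omega>. \<omega> n) \<in> \<Omega> \<rightarrow>\<^sub>M sojourn_space N lam"
    unfolding sample_space_def by (rule measurable_component_singleton) simp
  moreover have "(\<lambda>x. x k) \<in> sojourn_space N lam \<rightarrow>\<^sub>M sojourn_law k"
    unfolding sojourn_space_eq by (rule measurable_component_singleton) (rule assms)
  ultimately have "distr \<Omega> (sojourn_law k) ((\<lambda>x. x k) \<circ> (\<lambda>\<omega>. \<omega> n)) = sojourn_law k"
    by (metis distr_distr)
  moreover have "emeasure (distr \<Omega> (sojourn_law k) (\<lambda>\<omega>. \<omega> n k)) A = emeasure \<Omega> {\<omega>\<in>space \<Omega>. \<omega> n k \<in> A}"
    using assms sojourn_measurable[OF assms(1), of n]
    by (subst emeasure_distr) (auto simp: vimage_def Int_def conj_commute cong: measurable_cong_sets)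
  ultimately show ?thesis by (simp add: o_def)
qed

lemma emeasure_sojourn_law_box:
  assumes "k \<in> {1..N}" "t \<ge> 0" "A \<subseteq> {1..N}"
  shows "emeasure (sojourn_law k) ({..t} \<times> A) = ennreal ((1 - exp (- rate k * t)) * (\<Sum>j\<in>A. switch_prob k j))"
proof -
  interpret B: prob_space "jump_law N lam k" by (rule prob_space_jump_law[OF assms(1)])
  have "emeasure (density lborel (\<lambda>x. ennreal (exponential_density (rate k) x))) {..t} =
      ennreal (1 - exp (- rate k * t))"
    using emeasure_erlang_density[OF exit_rate_pos[OF assms(1)], of 0 t] assms(2)
    by (simp add: erlang_CDF_0)
  thus ?thesis
    unfolding sojourn_law_def using assms exit_rate_pos[OF assms(1)]
    by (subst B.emeasure_pair_measure_Times)
       (auto simp: emeasure_jump_law ennreal_mult sum_nonneg switch_prob_nonneg subset_iff)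
qed

lemma prob_holding_le_switch:
  assumes "k \<in> {1..N}" "t \<ge> 0" "j \<in> {1..N}"
  shows "prob {\<omega>\<in>space \<Omega>. fst (\<omega> n k) \<le> t \<and> snd (\<omega> n k) = j} = (1 - exp (- rate k * t)) * switch_prob k j"
proof -
  have "{\<omega>\<in>space \<Omega>. fst (\<omega> n k) \<le> t \<and> snd (\<omega> n k) = j} = {\<omega>\<in>space \<Omega>. \<omega> n k \<in> {..t} \<times> {j}}"
    by (auto simp: mem_Times_iff)
  moreover have "emeasure \<Omega> {\<omega>\<in>space \<Omega>. \<omega> n k \<in> {..t} \<times> {j}} = emeasure (sojourn_law k) ({..t} \<times> {j})"
    by (rule emeasure_sojourn) (use assms in auto)
  ultimately show ?thesis
    using assms exit_rate_pos[OF assms(1)] switch_prob_nonneg[OF assms(1,3)]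
    by (auto simp: emeasure_sojourn_law_box measure_def intro!: enn2real_ennreal mult_nonneg_nonneg)
qed

lemma prob_holding_le:
  assumes "k \<in> {1..N}" "t \<ge> 0"
  shows "prob {\<omega>\<in>space \<Omega>. fst (\<omega> n k) \<le> t} = 1 - exp (- rate k * t)"
proof -
  have "(\<lambda>\<omega>. \<omega> n k) \<in> space \<Omega> \<rightarrow> UNIV \<times> {1..N}"
    using measurable_space[OF sojourn_measurable[OF assms(1), of n]] by (auto simp: space_pair_measure)
  hence "{\<omega>\<in>space \<Omega>. fst (\<omega> n k) \<le> t} = {\<omega>\<in>space \<Omega>. \<omega> n k \<in> {..t} \<times> {1..N}}"
    by (auto simp: mem_Times_iff Pi_iff)
  moreover have "emeasure \<Omega> {\<omega>\<in>space \<Omega>. \<omega> n k \<in> {..t} \<times> {1..N}} = emeasure (sojourn_law k) ({..t} \<times> {1..N})"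
    by (rule emeasure_sojourn) (use assms in auto)
  ultimately show ?thesis
    using assms exit_rate_pos[OF assms(1)]
    by (auto simp: emeasure_sojourn_law_box sum_switch_prob measure_def intro!: enn2real_ennreal)
qed

lemma holding_time_nonneg_AE:
  assumes "k \<in> {1..N}"
  shows "AE \<omega> in \<Omega>. fst (\<omega> n k) \<ge> 0"
proof -
  have [measurable]: "(\<lambda>\<omega>. \<omega> n k) \<in> \<Omega> \<rightarrow>\<^sub>M borel \<Otimes>\<^sub>M count_space {1..N}" using assms by measurable
  have "{\<omega>\<in>space \<Omega>. fst (\<omega> n k) \<le> 0} \<in> null_sets \<Omega>"
    using prob_holding_le[OF assms, of 0 n] by (intro null_setsI) (auto simp: emeasure_eq_measure)
  from AE_not_in[OF this] AE_space show ?thesis by eventually_elim auto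
qed

text \<open>The sojourns number 0 and 1 use different coordinates of the sample point, so their
  durations are independent. Hence two switches before \<open>t\<close> have probability \<open>O(t\<^sup>2)\<close>.\<close>

lemma prob_two_holdings_le:
  assumes "j \<in> {1..N}" "k \<in> {1..N}" "t \<ge> 0"
  shows "prob {\<omega>\<in>space \<Omega>. fst (\<omega> 0 j) \<le> t \<and> fst (\<omega> 1 k) \<le> t} =
    (1 - exp (- rate j * t)) * (1 - exp (- rate k * t))"
proof -
  define c :: "nat \<Rightarrow> nat" where "c n = (if n = 0 then j else k)" for n
  define A where "A n = {x \<in> space (sojourn_space N lam). fst (x (c n)) \<le> t}" for n
  have c: "c n \<in> {1..N}" for n using assms by (simp add: c_def)
  have [measurable]: "(\<lambda>x. x (c n)) \<in> sojourn_space N lam \<rightarrow>\<^sub>M borel \<Otimes>\<^sub>M count_space {1..N}" for n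
  proof -
    have "(\<lambda>x. x (c n)) \<in> sojourn_space N lam \<rightarrow>\<^sub>M sojourn_law (c n)"
      unfolding sojourn_space_eq by (rule measurable_component_singleton) (rule c)
    thus ?thesis by (simp cong: measurable_cong_sets)
  qed
  have A: "A n \<in> sets (sojourn_space N lam)" for n unfolding A_def by measurable
  have emb: "emeasure \<Omega> (prod_emb UNIV (\<lambda>_. sojourn_space N lam) J (Pi\<^sub>E J A)) = (\<Prod>n\<in>J. emeasure (sojourn_space N lam) (A n))"
    if "finite J" for J
    unfolding sample_space_def using that A
    by (intro emeasure_PiM_emb) (auto simp: prob_space_sojourn_space)
  have sp: "\<omega> n \<in> space (sojourn_space N lam)" if "\<omega> \<in> space \<Omega>" for \<omega> n
    using that by (auto simp: sample_space_def space_PiM)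
  have set_eq: "prod_emb UNIV (\<lambda>_. sojourn_space N lam) J (Pi\<^sub>E J A) = {\<omega>\<in>space \<Omega>. \<forall>n\<in>J. fst (\<omega> n (c n)) \<le> t}" for J
    using sp by (auto simp: prod_emb_def A_def sample_space_def PiE_iff space_PiM restrict_def Pi_iff)
  have single: "emeasure (sojourn_space N lam) (A n) = ennreal (1 - exp (- rate (c n) * t))" for n
    using emb[of "{n}"] prob_holding_le[OF c assms(3), of n n] unfolding set_eq
    by (simp add: emeasure_eq_measure)
  have "emeasure \<Omega> {\<omega>\<in>space \<Omega>. \<forall>n\<in>{0,1}. fst (\<omega> n (c n)) \<le> t} =
      ennreal (1 - exp (- rate j * t)) * ennreal (1 - exp (- rate k * t))"
    using emb[of "{0,1}"] unfolding set_eq single by (simp add: c_def)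
  also have "\<dots> = ennreal ((1 - exp (- rate j * t)) * (1 - exp (- rate k * t)))"
    using assms exit_rate_pos[of j] exit_rate_pos[of k] by (subst ennreal_mult) auto
  also have "{\<omega>\<in>space \<Omega>. \<forall>n\<in>{0,1}. fst (\<omega> n (c n)) \<le> t} = {\<omega>\<in>space \<Omega>. fst (\<omega> 0 j) \<le> t \<and> fst (\<omega> 1 k) \<le> t}"
    by (auto simp: c_def)
  finally show ?thesis
    using assms exit_rate_pos[of j] exit_rate_pos[of k]
    by (auto simp: measure_def intro!: enn2real_ennreal mult_nonneg_nonneg)
qed

lemma jump_chain_measurable [measurable]:
  assumes "i \<in> {1..N}"
  shows "(\<lambda>\<omega>. jump_chain i \<omega> n) \<in> \<Omega> \<rightarrow>\<^sub>M count_space {1..N}"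
proof (induction n)
  case 0
  show ?case using assms by simp
next
  case (Suc n)
  have "(\<lambda>\<omega>. snd (\<omega> n k)) \<in> \<Omega> \<rightarrow>\<^sub>M count_space {1..N}" if "k \<in> {1..N}" for k
    using that by measurable
  from measurable_compose_countable'[OF this Suc] show ?case by simp
qed

lemma holding_time_measurable [measurable]:
  assumes i: "i \<in> {1..N}"
  shows "(\<lambda>\<omega>. holding_time i \<omega> n) \<in> borel_measurable \<Omega>"
proof -
  have "(\<lambda>\<omega>. fst (\<omega> n k)) \<in> borel_measurable \<Omega>" if "k \<in> {1..N}" for k
    using that by measurable
  from measurable_compose_countable'[OF this jump_chain_measurable[OF i]] show ?thesis
    by (simp add: holding_time_def)
qed

lemma jump_time_measurable [measurable]:
  "i \<in> {1..N} \<Longrightarrow> (\<lambda>\<omega>. jump_time i \<omega> n) \<in> borel_measurable \<Omega>"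
  unfolding jump_time_def by measurable

lemma num_jumps_measurable [measurable]:
  "i \<in> {1..N} \<Longrightarrow> (\<lambda>\<omega>. num_jumps i \<omega> t) \<in> \<Omega> \<rightarrow>\<^sub>M count_space UNIV"
  unfolding num_jumps_def by measurable

lemma flow_compose_measurable:
  assumes "k \<in> {1..N}" "f \<in> borel_measurable M" "g \<in> borel_measurable M"
  shows "(\<lambda>z. flow (u k) (f z) (g z)) \<in> borel_measurable M"
  using measurable_compose[OF measurable_Pair[OF assms(2,3)] flow_measurable[OF complete[OF assms(1)]]]
  by simp

text \<open>Joint measurability in the starting point and the sample point is needed to integrate the
  process against an initial distribution. It comes from that of the flows, because
  the indices that select a flow or a number of jumps are countable-valued.\<close>

lemma jump_position_measurable:
  assumes i: "i \<in> {1..N}"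
  shows "(\<lambda>z. jump_position u (fst z) i (snd z) n) \<in> borel_measurable (borel \<Otimes>\<^sub>M \<Omega>)"
proof (induction n)
  case 0
  show ?case by simp
next
  case (Suc n)
  have ht: "(\<lambda>z. holding_time i (snd z) n) \<in> borel_measurable (borel \<Otimes>\<^sub>M \<Omega>)"
    by (rule measurable_compose[OF measurable_snd holding_time_measurable[OF i]])
  have "(\<lambda>z. flow (u k) (holding_time i (snd z) n) (jump_position u (fst z) i (snd z) n))
      \<in> borel_measurable (borel \<Otimes>\<^sub>M \<Omega>)" if "k \<in> {1..N}" for k
    by (rule flow_compose_measurable[OF that ht Suc])
  from measurable_compose_countable'[OF this measurable_compose[OF measurable_snd jump_chain_measurable[OF i]]]
  show ?case by simp
qed

lemma switching_process_measurable:
  assumes i: "i \<in> {1..N}"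
  shows "(\<lambda>z. switching_process u (fst z) i t (snd z)) \<in> borel \<Otimes>\<^sub>M \<Omega> \<rightarrow>\<^sub>M borel \<Otimes>\<^sub>M count_space {1..N}"
proof -
  have nj: "(\<lambda>z. num_jumps i (snd z) t) \<in> borel \<Otimes>\<^sub>M \<Omega> \<rightarrow>\<^sub>M count_space UNIV"
    by (rule measurable_compose[OF measurable_snd num_jumps_measurable[OF i]])
  have jc: "(\<lambda>z. jump_chain i (snd z) n) \<in> borel \<Otimes>\<^sub>M \<Omega> \<rightarrow>\<^sub>M count_space {1..N}" for n
    by (rule measurable_compose[OF measurable_snd jump_chain_measurable[OF i]])
  have jt: "(\<lambda>z. t - jump_time i (snd z) n) \<in> borel_measurable (borel \<Otimes>\<^sub>M \<Omega>)" for n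
    by (intro borel_measurable_diff borel_measurable_const measurable_compose[OF measurable_snd jump_time_measurable[OF i]])
  have "(\<lambda>z. flow (u k) (t - jump_time i (snd z) n) (jump_position u (fst z) i (snd z) n))
      \<in> borel_measurable (borel \<Otimes>\<^sub>M \<Omega>)" if "k \<in> {1..N}" for k n
    by (rule flow_compose_measurable[OF that jt jump_position_measurable[OF i]])
  from measurable_compose_countable'[OF this jc]
  have "(\<lambda>z. (flow (u (jump_chain i (snd z) n)) (t - jump_time i (snd z) n) (jump_position u (fst z) i (snd z) n),
       jump_chain i (snd z) n)) \<in> borel \<Otimes>\<^sub>M \<Omega> \<rightarrow>\<^sub>M borel \<Otimes>\<^sub>M count_space {1..N}" for n
    using jc by (intro measurable_Pair) auto
  from measurable_compose_countable[OF this nj] show ?thesis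
    unfolding switching_process_def Let_def .
qed

definition observe :: "(real \<Rightarrow> real) \<Rightarrow> nat \<Rightarrow> real \<times> nat \<Rightarrow> real" where
  "observe f i z = (if snd z = i then f (fst z) else 0)"

lemma observe_measurable:
  assumes [measurable]: "f \<in> borel_measurable borel"
  shows "observe f i \<in> borel_measurable (borel \<Otimes>\<^sub>M count_space {1..N})"
proof -
  have [measurable]: "Measurable.pred (borel \<Otimes>\<^sub>M count_space {1..N}) (\<lambda>z. snd z = i)"
    by (rule measurable_compose[OF measurable_snd]) simp
  show ?thesis unfolding observe_def[abs_def] by measurable
qed

lemma observe_process_measurable:
  assumes "j \<in> {1..N}" "f \<in> borel_measurable borel"
  shows "(\<lambda>z. observe f i (switching_process u (fst z) j t (snd z))) \<in> borel_measurable (borel \<Otimes>\<^sub>M \<Omega>)"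
  by (rule measurable_compose[OF switching_process_measurable[OF assms(1)] observe_measurable[OF assms(2)]])

lemma observe_process_measurable':
  assumes "j \<in> {1..N}" "f \<in> borel_measurable borel"
  shows "(\<lambda>\<omega>. observe f i (switching_process u \<xi> j t \<omega>)) \<in> borel_measurable \<Omega>"
  using measurable_compose[OF measurable_Pair1' observe_process_measurable[OF assms], of \<xi> i t]
  by simp

lemma switching_process_no_jump:
  assumes "t < fst (\<omega> 0 j)"
  shows "switching_process u \<xi> j t \<omega> = (flow (u j) t \<xi>, j)"
proof -
  have "num_jumps j \<omega> t = 0"
    unfolding num_jumps_def using assms by (intro Least_eq_0) (simp add: jump_time_def holding_time_def)
  thus ?thesis by (simp add: switching_process_def jump_time_def)
qed

lemma switching_process_one_jump:
  assumes k_def: "k = snd (\<omega> 0 j)" and s_def: "s = fst (\<omega> 0 j)"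
    and "s \<le> t" "t < s + fst (\<omega> 1 k)"
  shows "switching_process u \<xi> j t \<omega> = (flow (u k) (t - s) (flow (u j) s \<xi>), k)"
proof -
  have ht: "holding_time j \<omega> 0 = s" "holding_time j \<omega> (Suc 0) = fst (\<omega> 1 k)"
    by (simp_all add: holding_time_def k_def s_def One_nat_def)
  have "num_jumps j \<omega> t = 1"
    unfolding num_jumps_def
  proof (rule Least_equality)
    show "t < jump_time j \<omega> (Suc 1)" using assms ht by (simp add: jump_time_def One_nat_def)
  next
    fix n assume "t < jump_time j \<omega> (Suc n)"
    thus "1 \<le> n" using assms ht by (cases n) (auto simp: jump_time_def One_nat_def)
  qed
  thus ?thesis using ht by (simp add: switching_process_def jump_time_def k_def Let_def One_nat_def)
qed

text \<open>Up to an event of probability \<open>O(t\<^sup>2)\<close> at most one switch happens before \<open>t\<close>, and a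
  switched path moves by at most \<open>O(t)\<close> as seen by \<open>f\<close>. The bound is uniform in the
  starting point, so it survives integration against any finite measure.\<close>

lemma short_time_expansion:
  assumes ij: "i \<in> {1..N}" "j \<in> {1..N}" and f: "f \<in> borel_measurable borel" "\<And>x. 0 \<le> f x" "\<And>x. f x \<le> 1"
    and L: "\<And>k s x. k \<in> {1..N} \<Longrightarrow> s \<ge> 0 \<Longrightarrow> \<bar>f (flow (u k) s x) - f x\<bar> \<le> L * s" and t: "t \<ge> 0"
  shows "\<bar>expectation (\<lambda>\<omega>. observe f i (switching_process u \<xi> j t \<omega>)) -
      ((if i = j then exp (- rate j * t) * f (flow (u j) t \<xi>) else 0)
        + (1 - exp (- rate j * t)) * switch_prob j i * f \<xi>)\<bar>
    \<le> (rate j * L + (\<Sum>k\<in>{1..N}. rate j * rate k)) * t\<^sup>2"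
proof -
  define q where "q = 1 - exp (- rate j * t)"
  have q: "0 \<le> q" "q \<le> rate j * t"
    using exit_rate_pos[OF ij(2)] t exp_ge_add_one_self[of "- rate j * t"] by (auto simp: q_def)
  have L0: "L \<ge> 0" using L[OF ij(1), of 1 0] by simp
  define H where "H = {\<omega>\<in>space \<Omega>. fst (\<omega> 0 j) \<le> t}"
  define G where "G = {\<omega>\<in>space \<Omega>. fst (\<omega> 0 j) \<le> t \<and> snd (\<omega> 0 j) = i}"
  define D where "D k = {\<omega>\<in>space \<Omega>. fst (\<omega> 0 j) \<le> t \<and> fst (\<omega> 1 k) \<le> t}" for k
  have [measurable]: "(\<lambda>\<omega>. \<omega> n k) \<in> \<Omega> \<rightarrow>\<^sub>M borel \<Otimes>\<^sub>M count_space {1..N}" if "k \<in> {1..N}" for n k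
    using that by measurable
  have Hm: "H \<in> events" unfolding H_def using ij by measurable
  have Gm: "G \<in> events" unfolding G_def using ij by measurable
  have Dm: "D k \<in> events" if "k \<in> {1..N}" for k unfolding D_def using ij that by measurable
  define c where "c = (if i = j then f (flow (u j) t \<xi>) else 0)"
  define main where "main \<omega> = c * (1 - indicator H \<omega>) + f \<xi> * indicator G \<omega>" for \<omega>
  define err where "err \<omega> = L * t * indicator H \<omega> + (\<Sum>k\<in>{1..N}. indicator (D k) \<omega>)" for \<omega>
  define F where "F \<omega> = observe f i (switching_process u \<xi> j t \<omega>)" for \<omega>
  have Fb: "0 \<le> F \<omega>" "F \<omega> \<le> 1" for \<omega> using f by (auto simp: F_def observe_def)
  have Fm: "F \<in> borel_measurable \<Omega>"
    unfolding F_def by (rule observe_process_measurable'[OF ij(2) f(1)])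
  have Fi: "integrable \<Omega> F"
    by (rule integrable_const_bound[where B = 1]) (use Fb Fm in auto)
  have int_ind: "integrable \<Omega> (indicator A :: _ \<Rightarrow> real)" if "A \<in> events" for A
    by (rule integrable_real_indicator) (use that in \<open>simp_all add: emeasure_eq_measure\<close>)
  have maini: "integrable \<Omega> main" unfolding main_def using int_ind Hm Gm
    by (intro Bochner_Integration.integrable_add Bochner_Integration.integrable_mult_right
        Bochner_Integration.integrable_diff) auto
  have erri: "integrable \<Omega> err" unfolding err_def using int_ind Hm Dm
    by (intro Bochner_Integration.integrable_add Bochner_Integration.integrable_mult_right
        Bochner_Integration.integrable_sum) auto
  have bound: "AE \<omega> in \<Omega>. \<bar>F \<omega> - main \<omega>\<bar> \<le> err \<omega>"
    using holding_time_nonneg_AE[OF ij(2), of 0] AE_space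
  proof eventually_elim
    case (elim \<omega>)
    define s where "s = fst (\<omega> 0 j)"
    define k where "k = snd (\<omega> 0 j)"
    have k: "k \<in> {1..N}"
      using measurable_space[OF sojourn_measurable[OF ij(2), of 0] elim(2)]
      by (auto simp: space_pair_measure k_def mem_Times_iff)
    have s0: "0 \<le> s" using elim by (simp add: s_def)
    have sumD: "0 \<le> (\<Sum>k\<in>{1..N}. indicator (D k) \<omega> :: real)" by (intro sum_nonneg) auto
    consider "t < s" | "s \<le> t" "fst (\<omega> 1 k) \<le> t" | "s \<le> t" "t < fst (\<omega> 1 k)" by linarith
    thus ?case
    proof cases
      case 1
      hence "F \<omega> = c"
        unfolding F_def s_def by (subst switching_process_no_jump) (auto simp: observe_def c_def)
      moreover have "\<omega> \<notin> H" "\<omega> \<notin> G" using 1 by (auto simp: H_def G_def s_def)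
      ultimately have "F \<omega> - main \<omega> = 0" by (simp add: main_def)
      thus ?thesis using sumD \<open>\<omega> \<notin> H\<close> by (simp add: err_def)
    next
      case 2
      have "\<omega> \<in> D k" using 2 elim by (simp add: D_def s_def)
      hence "1 \<le> (\<Sum>k\<in>{1..N}. indicator (D k) \<omega> :: real)"
        using k sum_nonneg_leq_bound[of "{1..N}" "\<lambda>k. indicator (D k) \<omega> :: real"]
          member_le_sum[of k "{1..N}" "\<lambda>k. indicator (D k) \<omega> :: real"] by auto
      moreover have "\<omega> \<in> H" using 2 elim by (simp add: H_def s_def)
      moreover have "0 \<le> main \<omega>" "main \<omega> \<le> 1"
        using \<open>\<omega> \<in> H\<close> f(2,3)[of \<xi>] by (auto simp: main_def indicator_def)
      moreover have "0 \<le> L * t" using L0 t by simp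
      ultimately have "\<bar>F \<omega> - main \<omega>\<bar> \<le> L * t + (\<Sum>k\<in>{1..N}. indicator (D k) \<omega>)"
        using Fb[of \<omega>] by linarith
      thus ?thesis using \<open>\<omega> \<in> H\<close> by (simp add: err_def)
    next
      case 3
      have H: "\<omega> \<in> H" using 3 elim by (simp add: H_def s_def)
      have "switching_process u \<xi> j t \<omega> = (flow (u k) (t - s) (flow (u j) s \<xi>), k)"
        by (rule switching_process_one_jump[where \<omega> = \<omega> and j = j, OF k_def s_def]) (use 3 s0 in auto)
      hence Feq: "F \<omega> = (if k = i then f (flow (u k) (t - s) (flow (u j) s \<xi>)) else 0)"
        by (simp add: F_def observe_def)
      have "\<omega> \<in> G \<longleftrightarrow> k = i" using 3 elim by (auto simp: G_def s_def k_def)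
      hence meq: "main \<omega> = (if k = i then f \<xi> else 0)" using H by (simp add: main_def)
      have "\<bar>f (flow (u k) (t - s) (flow (u j) s \<xi>)) - f \<xi>\<bar> \<le> L * (t - s) + L * s"
        using L[OF k, of "t - s" "flow (u j) s \<xi>"] L[OF ij(2) s0, of \<xi>] 3 by linarith
      also have "\<dots> = L * t" by (simp add: algebra_simps)
      finally have "\<bar>F \<omega> - main \<omega>\<bar> \<le> L * t" using L0 t by (cases "k = i") (simp_all add: Feq meq)
      thus ?thesis using sumD H by (simp add: err_def)
    qed
  qed
  have "\<bar>expectation F - expectation main\<bar> = \<bar>expectation (\<lambda>\<omega>. F \<omega> - main \<omega>)\<bar>"
    using Fi maini by simp
  also have "\<dots> \<le> expectation (\<lambda>\<omega>. \<bar>F \<omega> - main \<omega>\<bar>)" by (rule integral_abs_bound)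
  also have "\<dots> \<le> expectation err"
    by (rule integral_mono_AE) (use Fi maini erri bound in auto)
  also have "expectation err = L * t * prob H + (\<Sum>k\<in>{1..N}. prob (D k))"
    unfolding err_def using int_ind Hm Dm
    by (subst Bochner_Integration.integral_add)
       (auto intro!: Bochner_Integration.integrable_sum simp: Bochner_Integration.integral_sum)
  also have "prob H = q" unfolding H_def q_def by (rule prob_holding_le[OF ij(2) t])
  also have "(\<Sum>k\<in>{1..N}. prob (D k)) \<le> (\<Sum>k\<in>{1..N}. (rate j * t) * (rate k * t))"
  proof (rule sum_mono)
    fix k assume k: "k \<in> {1..N}"
    have "1 - exp (- rate k * t) \<le> rate k * t" using exp_ge_add_one_self[of "- rate k * t"] by simp
    moreover have "0 \<le> 1 - exp (- rate k * t)" using exit_rate_pos[OF k] t by simp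
    ultimately show "prob (D k) \<le> (rate j * t) * (rate k * t)"
      unfolding D_def prob_two_holdings_le[OF ij(2) k t] using q
      by (intro mult_mono) (auto simp: q_def)
  qed
  also have "L * t * q \<le> L * t * (rate j * t)" using q L0 t by (intro mult_left_mono) auto
  finally have "\<bar>expectation F - expectation main\<bar> \<le> L * t * (rate j * t) + (\<Sum>k\<in>{1..N}. (rate j * t) * (rate k * t))"
    by simp
  also have "\<dots> = (rate j * L + (\<Sum>k\<in>{1..N}. rate j * rate k)) * t\<^sup>2"
    by (simp add: algebra_simps power2_eq_square sum_distrib_left)
  finally have *: "\<bar>expectation F - expectation main\<bar> \<le> \<dots>" .
  have "expectation main = c * (1 - prob H) + f \<xi> * prob G"
    unfolding main_def using int_ind Hm Gm by (simp add: prob_space)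
  also have "prob H = q" unfolding H_def q_def by (rule prob_holding_le[OF ij(2) t])
  also have "prob G = q * switch_prob j i"
    unfolding G_def q_def by (rule prob_holding_le_switch[OF ij(2) t ij(1)])
  finally have "expectation main = (if i = j then exp (- rate j * t) * f (flow (u j) t \<xi>) else 0)
        + (1 - exp (- rate j * t)) * switch_prob j i * f \<xi>"
    by (simp add: c_def q_def)
  with * show ?thesis unfolding F_def by simp
qed

end

section \<open>The stationary equation\<close>

text \<open>The positive and the negative part of the difference, cut off outside the interval, are
  densities of measures that agree on all half-lines, hence coincide.\<close>

lemma AE_eq_if_interval_integrals_eq:
  fixes f g :: "real \<Rightarrow> real"
  assumes int: "\<And>p q. p < q \<Longrightarrow> set_integrable lborel {p<..<q} f" "\<And>p q. p < q \<Longrightarrow> set_integrable lborel {p<..<q} g"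
    and eq: "\<And>p q. a \<le> p \<Longrightarrow> p < q \<Longrightarrow> q \<le> b \<Longrightarrow> (LINT x:{p<..<q}|lborel. f x) = (LINT x:{p<..<q}|lborel. g x)"
  shows "AE x in lborel. x \<in> {a<..<b} \<longrightarrow> f x = g x"
proof (cases "a < b")
  case False
  thus ?thesis by auto
next
  case ab: True
  define h where "h x = indicator {a<..<b} x * (f x - g x)" for x
  have "set_integrable lborel {a<..<b} (\<lambda>x. f x - g x)"
    by (intro set_integral_diff int ab)
  hence h: "integrable lborel h" unfolding set_integrable_def real_scaleR_def h_def[abs_def] .
  hence [measurable]: "h \<in> borel_measurable borel" by simp
  have pos: "integrable lborel (\<lambda>x. max 0 (h x))" "integrable lborel (\<lambda>x. max 0 (- h x))"
    using h integrable_max[of lborel "\<lambda>_. 0" h]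
      integrable_max[of lborel "\<lambda>_. 0" "\<lambda>x. - h x"] Bochner_Integration.integrable_minus[OF h] by simp_all
  have pos': "set_integrable lborel {x<..} (\<lambda>y. max 0 (h y))"
    "set_integrable lborel {x<..} (\<lambda>y. max 0 (- h y))" for x
    unfolding set_integrable_def by (rule integrable_mult_indicator[OF _ pos(1)] integrable_mult_indicator[OF _ pos(2)], simp)+
  have zero: "(LINT y:{x<..}|lborel. h y) = 0" for x
  proof -
    have "(LINT y:{x<..}|lborel. h y) = (LINT y:{max a x<..<b}|lborel. f y - g y)"
      unfolding set_lebesgue_integral_def h_def
      by (intro Bochner_Integration.integral_cong) (auto simp: indicator_def)
    also have "\<dots> = 0"
    proof (cases "max a x < b")
      case True
      thus ?thesis using eq[of "max a x" b] int[OF True] by (subst set_integral_diff) auto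
    next
      case False
      hence "{max a x<..<b} = {}" by auto
      thus ?thesis by (simp add: set_lebesgue_integral_def)
    qed
    finally show ?thesis .
  qed
  define M where "M s = density lborel (\<lambda>x. ennreal (max 0 (s * h x)))" for s :: real
  have em: "emeasure (M s) {x<..} = ennreal (LINT y:{x<..}|lborel. max 0 (s * h y))"
    if "s \<in> {1, -1}" for s x
  proof -
    have i: "integrable lborel (\<lambda>y. indicator {x<..} y * max 0 (s * h y))"
      using integrable_mult_indicator[of "{x<..}" lborel "\<lambda>y. max 0 (s * h y)"] that pos by auto
    have "emeasure (M s) {x<..} = (\<integral>\<^sup>+y. ennreal (indicator {x<..} y * max 0 (s * h y)) \<partial>lborel)"
      unfolding M_def
      by (subst emeasure_density) (auto intro!: nn_integral_cong simp: indicator_def ennreal_mult)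
    also have "\<dots> = ennreal (LINT y:{x<..}|lborel. max 0 (s * h y))"
      unfolding set_lebesgue_integral_def real_scaleR_def
      by (rule nn_integral_eq_integral[OF i]) (auto simp: indicator_def)
    finally show ?thesis .
  qed
  have "M 1 = M (-1)"
  proof (rule measure_eqI_lessThan)
    fix x
    show "emeasure (M 1) {x<..} < \<infinity>" by (simp add: em)
    have "(LINT y:{x<..}|lborel. max 0 (1 * h y)) - (LINT y:{x<..}|lborel. max 0 (- 1 * h y))
        = (LINT y:{x<..}|lborel. max 0 (1 * h y) - max 0 (- 1 * h y))"
      using pos' by (subst set_integral_diff) simp_all
    also have "(\<lambda>y. max 0 (1 * h y) - max 0 (- 1 * h y)) = h" by (auto simp: fun_eq_iff)
    finally show "emeasure (M 1) {x<..} = emeasure (M (-1)) {x<..}" using zero[of x] by (simp add: em)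
  qed (simp_all add: M_def)
  hence "AE x in lborel. ennreal (max 0 (1 * h x)) = ennreal (max 0 (- 1 * h x))"
    unfolding M_def by (subst (asm) sigma_finite_measure.density_unique_iff[OF lborel.sigma_finite_measure_axioms]) auto
  thus ?thesis
  proof eventually_elim
    case (elim x)
    hence "max 0 (1 * h x) = max 0 (- 1 * h x)" by (subst (asm) ennreal_inj) auto
    hence "h x = 0" by (auto simp: max_def split: if_splits)
    thus ?case by (auto simp: h_def indicator_def)
  qed
qed

lemma continuous_nonneg_if_AE:
  fixes f :: "real \<Rightarrow> real"
  assumes "continuous_on {a<..<b} f" "AE x in lborel. x \<in> {a<..<b} \<longrightarrow> 0 \<le> f x" "x \<in> {a<..<b}"
  shows "0 \<le> f x"
proof (rule ccontr)
  assume neg: "\<not> 0 \<le> f x"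
  have "open ({a<..<b} \<inter> f -` {..<0})"
    using continuous_on_open_vimage[OF open_greaterThanLessThan] assms(1)
    by (metis open_lessThan Int_commute)
  moreover have "x \<in> {a<..<b} \<inter> f -` {..<0}" using neg assms(3) by auto
  ultimately obtain e where e: "e > 0" "ball x e \<subseteq> {a<..<b} \<inter> f -` {..<0}"
    by (meson openE)
  have "AE y in lborel. y \<notin> ball x e" using assms(2) by eventually_elim (use e in auto)
  hence "emeasure lborel (ball x e) = 0"
    by (subst (asm) AE_iff_null_sets[symmetric]) auto
  moreover have "ball x e = {x - e<..<x + e}" by (auto simp: ball_def dist_real_def)
  ultimately show False using e(1) by simp
qed

lemma continuous_zero_if_AE:
  fixes f :: "real \<Rightarrow> real"
  assumes "continuous_on {a<..<b} f" "AE x in lborel. x \<in> {a<..<b} \<longrightarrow> f x = 0" "x \<in> {a<..<b}"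
  shows "f x = 0"
proof (rule antisym)
  have "AE x in lborel. x \<in> {a<..<b} \<longrightarrow> 0 \<le> - f x" "AE x in lborel. x \<in> {a<..<b} \<longrightarrow> 0 \<le> f x"
    by (use assms(2) in eventually_elim, simp)+
  thus "0 \<le> f x" "f x \<le> 0"
    using continuous_nonneg_if_AE[of a b f x] continuous_nonneg_if_AE[of a b "\<lambda>x. - f x" x]
      assms(1,3) continuous_on_minus[OF assms(1)] by simp_all
qed

locale stationary_switching = switching +
  fixes \<mu> :: "(real \<times> nat) measure" and \<rho> :: "nat \<Rightarrow> real \<Rightarrow> real"
  assumes invariant: "invariant_measure N u lam \<mu>"
    and component_density: "\<And>i. i \<in> {1..N} \<Longrightarrow> lebesgue_density (component \<mu> i) (\<rho> i)"
begin

lemma sets_mu: "sets \<mu> = sets (borel \<Otimes>\<^sub>M count_space {1..N})"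
  using invariant by (simp add: invariant_measure_def state_space_def)

lemma space_mu: "space \<mu> = UNIV \<times> {1..N}"
  using sets_eq_imp_space_eq[OF sets_mu] by (simp add: space_pair_measure)

lemma sets_component [simp, measurable_cong]: "sets (component \<mu> i) = sets borel"
  by (simp add: component_def)

lemma space_component [simp]: "space (component \<mu> i) = UNIV"
  by (simp add: component_def)

lemma emeasure_component:
  assumes i: "i \<in> {1..N}" and E: "E \<in> sets borel"
  shows "emeasure (component \<mu> i) E = emeasure \<mu> (E \<times> {i})"
proof -
  have [simp]: "UNIV \<times> {i} \<inter> space \<mu> = UNIV \<times> {i}" "UNIV \<times> {i} \<in> sets \<mu>"
    using i by (auto simp: space_mu sets_mu)
  have "fst \<in> restrict_space \<mu> (UNIV \<times> {i}) \<rightarrow>\<^sub>M borel"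
    by (rule measurable_restrict_space1) (simp cong: measurable_cong_sets add: sets_mu)
  hence "emeasure (component \<mu> i) E = emeasure (restrict_space \<mu> (UNIV \<times> {i})) (fst -` E \<inter> space (restrict_space \<mu> (UNIV \<times> {i})))"
    unfolding component_def using E by (rule emeasure_distr)
  also have "fst -` E \<inter> space (restrict_space \<mu> (UNIV \<times> {i})) = E \<times> {i}"
    using i by (auto simp: space_restrict_space space_mu)
  also have "emeasure (restrict_space \<mu> (UNIV \<times> {i})) (E \<times> {i}) = emeasure \<mu> (E \<times> {i})"
    by (rule emeasure_restrict_space) auto
  finally show ?thesis .
qed

lemma finite_measure_component: "i \<in> {1..N} \<Longrightarrow> finite_measure (component \<mu> i)"
proof
  assume i: "i \<in> {1..N}"
  interpret M: prob_space \<mu> using invariant by (simp add: invariant_measure_def)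
  show "emeasure (component \<mu> i) (space (component \<mu> i)) \<noteq> \<infinity>"
    using i by (simp add: emeasure_component M.emeasure_eq_measure)
qed

text \<open>Invariance is assumed for sets only; it extends to nonnegative functions by linearity and
  monotone limits.\<close>

lemma invariance_nn:
  assumes i: "i \<in> {1..N}" and t: "t \<ge> 0" and g: "g \<in> borel_measurable borel"
  shows "(\<integral>\<^sup>+x. g x \<partial>component \<mu> i) = (\<Sum>j\<in>{1..N}. \<integral>\<^sup>+\<xi>. \<integral>\<^sup>+\<omega>.
    (if snd (switching_process u \<xi> j t \<omega>) = i then g (fst (switching_process u \<xi> j t \<omega>)) else 0) \<partial>\<Omega> \<partial>component \<mu> j)"
proof -
  define T where "T g j z = (if snd (switching_process u (fst z) j t (snd z)) = i
    then g (fst (switching_process u (fst z) j t (snd z))) else 0)" for g :: "real \<Rightarrow> ennreal" and j z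
  have T: "T g j \<in> borel_measurable (borel \<Otimes>\<^sub>M \<Omega>)" if j: "j \<in> {1..N}" and [measurable]: "g \<in> borel_measurable borel" for g j
  proof -
    have [measurable]: "(\<lambda>z. switching_process u (fst z) j t (snd z)) \<in> borel \<Otimes>\<^sub>M \<Omega> \<rightarrow>\<^sub>M borel \<Otimes>\<^sub>M count_space {1..N}"
      by (rule switching_process_measurable[OF j])
    have [measurable]: "Measurable.pred (borel \<Otimes>\<^sub>M count_space {1..N}) (\<lambda>z. snd z = i)"
      by (rule measurable_compose[OF measurable_snd]) simp
    have [measurable]: "Measurable.pred (borel \<Otimes>\<^sub>M \<Omega>) (\<lambda>z. snd (switching_process u (fst z) j t (snd z)) = i)"
      by (rule measurable_compose[OF switching_process_measurable[OF j]]) measurable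
    show ?thesis unfolding T_def[abs_def] by measurable
  qed
  have T1: "(\<lambda>\<omega>. T g j (\<xi>, \<omega>)) \<in> borel_measurable \<Omega>" if "j \<in> {1..N}" "g \<in> borel_measurable borel" for g j \<xi>
    by (rule measurable_compose[OF measurable_Pair1' T[OF that]]) simp
  have T2: "(\<lambda>\<xi>. \<integral>\<^sup>+\<omega>. T g j (\<xi>, \<omega>) \<partial>\<Omega>) \<in> borel_measurable (component \<mu> k)"
    if "j \<in> {1..N}" "g \<in> borel_measurable borel" for g j k
    using borel_measurable_nn_integral_fst[OF T[OF that]] by (simp cong: measurable_cong_sets)
  have "(\<integral>\<^sup>+x. g x \<partial>component \<mu> i) = (\<Sum>j\<in>{1..N}. \<integral>\<^sup>+\<xi>. \<integral>\<^sup>+\<omega>. T g j (\<xi>, \<omega>) \<partial>\<Omega> \<partial>component \<mu> j)"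
    using g
  proof (induction rule: borel_measurable_induct)
    case (cong f g)
    thus ?case by (metis (no_types, lifting) ext UNIV_I space_borel)
  next
    case (set E)
    have trans: "emeasure (transition_prob N u lam t \<xi> j) (E \<times> {i}) = (\<integral>\<^sup>+\<omega>. T (indicator E) j (\<xi>, \<omega>) \<partial>\<Omega>)"
      if j: "j \<in> {1..N}" for \<xi> j
    proof -
      have m: "switching_process u \<xi> j t \<in> \<Omega> \<rightarrow>\<^sub>M state_space N"
        unfolding state_space_def
        using measurable_compose[OF measurable_Pair1' switching_process_measurable[OF j], of \<xi> t] by simp
      have Em: "E \<times> {i} \<in> sets (state_space N)" using set i by (simp add: state_space_def)
      have "emeasure (transition_prob N u lam t \<xi> j) (E \<times> {i}) =
          emeasure \<Omega> (switching_process u \<xi> j t -` (E \<times> {i}) \<inter> space \<Omega>)"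
        unfolding transition_prob_def by (rule emeasure_distr[OF m Em])
      also have "\<dots> = (\<integral>\<^sup>+\<omega>. indicator (switching_process u \<xi> j t -` (E \<times> {i}) \<inter> space \<Omega>) \<omega> \<partial>\<Omega>)"
        by (rule nn_integral_indicator[symmetric]) (rule measurable_sets[OF m Em])
      also have "\<dots> = (\<integral>\<^sup>+\<omega>. T (indicator E) j (\<xi>, \<omega>) \<partial>\<Omega>)"
        by (intro nn_integral_cong) (auto simp: T_def indicator_def mem_Times_iff)
      finally show ?thesis .
    qed
    have "(\<integral>\<^sup>+x. indicator E x \<partial>component \<mu> i) = emeasure \<mu> (E \<times> {i})"
      using set i by (simp add: emeasure_component)
    also have "\<dots> = (\<Sum>j\<in>{1..N}. \<integral>\<^sup>+\<xi>. emeasure (transition_prob N u lam t \<xi> j) (E \<times> {i}) \<partial>component \<mu> j)"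
      using invariant set i t unfolding invariant_measure_def by blast
    also have "\<dots> = (\<Sum>j\<in>{1..N}. \<integral>\<^sup>+\<xi>. \<integral>\<^sup>+\<omega>. T (indicator E) j (\<xi>, \<omega>) \<partial>\<Omega> \<partial>component \<mu> j)"
      by (intro sum.cong nn_integral_cong refl trans)
    finally show ?case .
  next
    case (mult g c)
    have "T (\<lambda>x. c * g x) j z = c * T g j z" for j z by (simp add: T_def)
    hence "(\<Sum>j\<in>{1..N}. \<integral>\<^sup>+\<xi>. \<integral>\<^sup>+\<omega>. T (\<lambda>x. c * g x) j (\<xi>, \<omega>) \<partial>\<Omega> \<partial>component \<mu> j) =
        (\<Sum>j\<in>{1..N}. c * (\<integral>\<^sup>+\<xi>. \<integral>\<^sup>+\<omega>. T g j (\<xi>, \<omega>) \<partial>\<Omega> \<partial>component \<mu> j))"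
      using mult by (intro sum.cong refl) (simp add: nn_integral_cmult T1 T2)
    thus ?case using mult by (simp add: nn_integral_cmult sum_distrib_left cong: measurable_cong_sets)
  next
    case (add f g)
    have "T (\<lambda>x. g x + f x) j z = T g j z + T f j z" for j z by (simp add: T_def)
    hence "(\<Sum>j\<in>{1..N}. \<integral>\<^sup>+\<xi>. \<integral>\<^sup>+\<omega>. T (\<lambda>x. g x + f x) j (\<xi>, \<omega>) \<partial>\<Omega> \<partial>component \<mu> j) =
        (\<Sum>j\<in>{1..N}. (\<integral>\<^sup>+\<xi>. \<integral>\<^sup>+\<omega>. T g j (\<xi>, \<omega>) \<partial>\<Omega> \<partial>component \<mu> j)
          + (\<integral>\<^sup>+\<xi>. \<integral>\<^sup>+\<omega>. T f j (\<xi>, \<omega>) \<partial>\<Omega> \<partial>component \<mu> j))"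
      using add by (intro sum.cong refl) (simp add: nn_integral_add T1 T2)
    thus ?case using add by (simp add: nn_integral_add sum.distrib cong: measurable_cong_sets)
  next
    case (seq U)
    have inc: "incseq (\<lambda>n. T (U n) j z)" for j z
      using seq(3) by (auto simp: T_def incseq_def le_fun_def)
    have "T (\<lambda>x. (SUP n. U n x)) j z = (SUP n. T (U n) j z)" for j z by (simp add: T_def)
    hence "(\<Sum>j\<in>{1..N}. \<integral>\<^sup>+\<xi>. \<integral>\<^sup>+\<omega>. T (\<lambda>x. SUP n. U n x) j (\<xi>, \<omega>) \<partial>\<Omega> \<partial>component \<mu> j) =
        (\<Sum>j\<in>{1..N}. \<integral>\<^sup>+\<xi>. \<integral>\<^sup>+\<omega>. (SUP n. T (U n) j (\<xi>, \<omega>)) \<partial>\<Omega> \<partial>component \<mu> j)" by simp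
    also have "\<dots> = (\<Sum>j\<in>{1..N}. \<integral>\<^sup>+\<xi>. (SUP n. \<integral>\<^sup>+\<omega>. T (U n) j (\<xi>, \<omega>) \<partial>\<Omega>) \<partial>component \<mu> j)"
      by (intro sum.cong refl nn_integral_cong nn_integral_monotone_convergence_SUP T1 seq)
         (use inc in \<open>auto simp: incseq_def le_fun_def\<close>)
    also have "\<dots> = (\<Sum>j\<in>{1..N}. SUP n. \<integral>\<^sup>+\<xi>. \<integral>\<^sup>+\<omega>. T (U n) j (\<xi>, \<omega>) \<partial>\<Omega> \<partial>component \<mu> j)"
      by (intro sum.cong refl nn_integral_monotone_convergence_SUP T2 seq)
         (use inc in \<open>auto simp: incseq_def le_fun_def intro!: nn_integral_mono\<close>)
    also have "\<dots> = (SUP n. \<Sum>j\<in>{1..N}. \<integral>\<^sup>+\<xi>. \<integral>\<^sup>+\<omega>. T (U n) j (\<xi>, \<omega>) \<partial>\<Omega> \<partial>component \<mu> j)"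
      by (rule ennreal_SUP_sum[symmetric])
         (use inc in \<open>auto simp: incseq_def le_fun_def intro!: nn_integral_mono\<close>)
    also have "\<dots> = (SUP n. \<integral>\<^sup>+x. U n x \<partial>component \<mu> i)" using seq by simp
    also have "\<dots> = (\<integral>\<^sup>+x. (SUP n. U n x) \<partial>component \<mu> i)"
      using seq by (intro nn_integral_monotone_convergence_SUP[symmetric]) (auto cong: measurable_cong_sets)
    finally show ?case by (simp add: image_comp o_def SUP_apply)
  qed
  thus ?thesis unfolding T_def fst_conv snd_conv .
qed

lemma expectation_observe_bounds:
  assumes j: "j \<in> {1..N}" and f: "f \<in> borel_measurable borel" "\<And>x. 0 \<le> f x" "\<And>x. f x \<le> 1"
  shows "integrable \<Omega> (\<lambda>\<omega>. observe f i (switching_process u \<xi> j t \<omega>))" (is ?A)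
    and "0 \<le> expectation (\<lambda>\<omega>. observe f i (switching_process u \<xi> j t \<omega>))" (is ?B)
    and "expectation (\<lambda>\<omega>. observe f i (switching_process u \<xi> j t \<omega>)) \<le> 1" (is ?C)
    and "integrable (component \<mu> j) (\<lambda>\<xi>. expectation (\<lambda>\<omega>. observe f i (switching_process u \<xi> j t \<omega>)))" (is ?D)
proof -
  have b: "0 \<le> observe f i z" "observe f i z \<le> 1" for z using f by (auto simp: observe_def)
  have int: "integrable \<Omega> (\<lambda>\<omega>. observe f i (switching_process u \<xi> j t \<omega>))" for \<xi>
    by (rule integrable_const_bound[where B = 1])
       (use b observe_process_measurable'[OF j f(1)] in auto)
  thus ?A .
  have B: "0 \<le> expectation (\<lambda>\<omega>. observe f i (switching_process u \<xi> j t \<omega>))" for \<xi>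
    using b by (intro integral_nonneg_AE) auto
  thus ?B .
  have C: "expectation (\<lambda>\<omega>. observe f i (switching_process u \<xi> j t \<omega>)) \<le> 1" for \<xi>
    using integral_mono[OF int, of "\<lambda>_. 1"] b by (simp add: prob_space)
  thus ?C .
  interpret C: finite_measure "component \<mu> j" by (rule finite_measure_component[OF j])
  have "(\<lambda>\<xi>. expectation (\<lambda>\<omega>. observe f i (switching_process u \<xi> j t \<omega>))) \<in> borel_measurable (component \<mu> j)"
    by (rule borel_measurable_lebesgue_integral)
       (use observe_process_measurable[OF j f(1), of i t] in \<open>simp add: case_prod_unfold cong: measurable_cong_sets\<close>)
  thus ?D by (rule C.integrable_const_bound[rotated, where B = 1]) (use B C in auto)
qed

lemma invariance:
  assumes i: "i \<in> {1..N}" and t: "t \<ge> 0" and f: "f \<in> borel_measurable borel" "\<And>x. 0 \<le> f x" "\<And>x. f x \<le> 1"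
  shows "(LINT x|component \<mu> i. f x) = (\<Sum>j\<in>{1..N}. LINT \<xi>|component \<mu> j.
    expectation (\<lambda>\<omega>. observe f i (switching_process u \<xi> j t \<omega>)))"
proof -
  interpret C: finite_measure "component \<mu> i" by (rule finite_measure_component[OF i])
  note b = expectation_observe_bounds[OF _ f]
  have fi: "integrable (component \<mu> i) f"
    by (rule C.integrable_const_bound[where B = 1]) (use f in \<open>auto cong: measurable_cong_sets\<close>)
  have obs: "(if snd z = i then ennreal (f (fst z)) else 0) = ennreal (observe f i z)" for z
    by (simp add: observe_def)
  have ob0: "0 \<le> observe f i z" for z using f by (auto simp: observe_def)
  have "ennreal (LINT x|component \<mu> i. f x) = (\<integral>\<^sup>+x. ennreal (f x) \<partial>component \<mu> i)"
    using fi f by (intro nn_integral_eq_integral[symmetric]) auto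
  also have "\<dots> = (\<Sum>j\<in>{1..N}. \<integral>\<^sup>+\<xi>. \<integral>\<^sup>+\<omega>. ennreal (observe f i (switching_process u \<xi> j t \<omega>)) \<partial>\<Omega> \<partial>component \<mu> j)"
    by (subst invariance_nn[OF i t]) (use f in \<open>simp_all add: obs\<close>)
  also have "\<dots> = (\<Sum>j\<in>{1..N}. \<integral>\<^sup>+\<xi>. ennreal (expectation (\<lambda>\<omega>. observe f i (switching_process u \<xi> j t \<omega>))) \<partial>component \<mu> j)"
    using b ob0 by (intro sum.cong refl nn_integral_cong nn_integral_eq_integral) auto
  also have "\<dots> = (\<Sum>j\<in>{1..N}. ennreal (LINT \<xi>|component \<mu> j. expectation (\<lambda>\<omega>. observe f i (switching_process u \<xi> j t \<omega>))))"
    using b by (intro sum.cong refl nn_integral_eq_integral) auto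
  also have "\<dots> = ennreal (\<Sum>j\<in>{1..N}. LINT \<xi>|component \<mu> j. expectation (\<lambda>\<omega>. observe f i (switching_process u \<xi> j t \<omega>)))"
    using b by (intro sum_ennreal integral_nonneg_AE) auto
  finally show ?thesis
    using b f by (subst (asm) ennreal_inj) (auto intro!: sum_nonneg integral_nonneg_AE)
qed

end

lemma tendsto_inverse_Suc: "filterlim (\<lambda>n. 1 / real (Suc n)) (at 0 within {0..}) sequentially"
proof -
  have "(\<lambda>n. 1 / real (Suc n)) \<longlonglongrightarrow> 0"
    using LIMSEQ_inverse_real_of_nat by (simp add: inverse_eq_divide)
  thus ?thesis unfolding filterlim_at by auto
qed

lemma exp_difference_quotient:
  "(\<lambda>n. (1 - exp (- r * (1 / real (Suc n)))) / (1 / real (Suc n))) \<longlonglongrightarrow> (r :: real)"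
proof -
  have "((\<lambda>x. - exp (- r * x)) has_real_derivative r) (at 0 within {0..})"
    by (auto intro!: derivative_eq_intros)
  hence "((\<lambda>y. (- exp (- r * y) - (- exp (- r * 0))) / (y - 0)) \<longlongrightarrow> r) (at 0 within {0..})"
    unfolding has_field_derivative_iff .
  from filterlim_compose[OF this tendsto_inverse_Suc] show ?thesis by simp
qed

lemma flow_difference_quotient:
  assumes "forward_complete v"
  shows "(\<lambda>n. (flow v (1 / real (Suc n)) \<xi> - \<xi>) / (1 / real (Suc n))) \<longlonglongrightarrow> v \<xi>"
proof -
  have "((\<lambda>t. flow v t \<xi>) has_real_derivative v \<xi>) (at 0 within {0..})"
    using flow_DERIV[OF assms, of 0 \<xi>] assms by simp
  hence "((\<lambda>y. (flow v y \<xi> - flow v 0 \<xi>) / (y - 0)) \<longlongrightarrow> v \<xi>) (at 0 within {0..})"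
    unfolding has_field_derivative_iff .
  from filterlim_compose[OF this tendsto_inverse_Suc] show ?thesis using assms by simp
qed

lemma flow_inverse_Suc_tendsto:
  assumes "forward_complete v"
  shows "(\<lambda>n. flow v (1 / real (Suc n)) \<xi>) \<longlonglongrightarrow> \<xi>"
proof -
  have "((\<lambda>t. flow v t \<xi>) \<longlongrightarrow> flow v 0 \<xi>) (at 0 within {0..})"
    using flow_continuous_on[OF assms, of \<xi>] by (auto simp: continuous_on_def)
  from filterlim_compose[OF this tendsto_inverse_Suc] show ?thesis using assms by simp
qed

context stationary_switching
begin

lemma density_integrable: "i \<in> {1..N} \<Longrightarrow> integrable lborel (\<rho> i)"
  and density_nonneg: "i \<in> {1..N} \<Longrightarrow> AE x in lborel. 0 \<le> \<rho> i x"
  and component_eq: "i \<in> {1..N} \<Longrightarrow> component \<mu> i = density lborel (\<lambda>x. ennreal (\<rho> i x))"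
  using component_density by (auto simp: lebesgue_density_def)

lemma density_measurable [measurable]: "i \<in> {1..N} \<Longrightarrow> \<rho> i \<in> borel_measurable borel"
  using borel_measurable_integrable[OF density_integrable] by simp

lemma integral_component:
  assumes "i \<in> {1..N}" and "f \<in> borel_measurable borel"
  shows "(LINT x|component \<mu> i. f x) = (LINT x|lborel. \<rho> i x * f x)"
  unfolding component_eq[OF assms(1)]
  using assms density_nonneg[OF assms(1)] by (subst integral_density) auto

lemma AE_component:
  assumes "i \<in> {1..N}" "AE x in lborel. P x"
  shows "AE x in component \<mu> i. P x"
  unfolding component_eq[OF assms(1)] using assms(2)
  by (subst AE_density) (use assms density_measurable in \<open>auto elim: eventually_mono\<close>)

lemma stationary_short_time:
  assumes i: "i \<in> {1..N}" and f: "f \<in> borel_measurable borel" "\<And>x. 0 \<le> f x" "\<And>x. f x \<le> 1"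
    and L: "\<And>k s x. k \<in> {1..N} \<Longrightarrow> s \<ge> 0 \<Longrightarrow> \<bar>f (flow (u k) s x) - f x\<bar> \<le> L * s"
  obtains K where "\<And>t. t \<ge> 0 \<Longrightarrow> \<bar>(LINT x|component \<mu> i. f x) -
      (exp (- rate i * t) * (LINT x|component \<mu> i. f (flow (u i) t x))
        + (\<Sum>j\<in>{1..N}. (1 - exp (- rate j * t)) * switch_prob j i * (LINT x|component \<mu> j. f x)))\<bar> \<le> K * t\<^sup>2"
proof
  fix t :: real assume t: "t \<ge> 0"
  define C where "C j = rate j * L + (\<Sum>k\<in>{1..N}. rate j * rate k)" for j
  define e where "e j \<xi> = expectation (\<lambda>\<omega>. observe f i (switching_process u \<xi> j t \<omega>))" for j \<xi>
  define a where "a j \<xi> = (if i = j then exp (- rate j * t) * f (flow (u j) t \<xi>) else 0)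
        + (1 - exp (- rate j * t)) * switch_prob j i * f \<xi>" for j \<xi>
  have fm: "integrable (component \<mu> j) f"
    "integrable (component \<mu> j) (\<lambda>\<xi>. f (flow (u j) t \<xi>))" if j: "j \<in> {1..N}" for j
  proof -
    interpret C: finite_measure "component \<mu> j" by (rule finite_measure_component[OF j])
    have fl: "(\<lambda>\<xi>. flow (u j) t \<xi>) \<in> borel_measurable borel"
      by (rule borel_measurable_mono) (auto intro!: monoI flow_mono[OF complete[OF j]] t)
    show "integrable (component \<mu> j) f" "integrable (component \<mu> j) (\<lambda>\<xi>. f (flow (u j) t \<xi>))"
      using f measurable_compose[OF fl f(1)]
      by (auto intro!: C.integrable_const_bound[where B = 1] cong: measurable_cong_sets)
  qed
  have ei: "integrable (component \<mu> j) (e j)" if "j \<in> {1..N}" for j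
    unfolding e_def using expectation_observe_bounds(4)[OF that f] .
  have ai: "integrable (component \<mu> j) (a j)" if "j \<in> {1..N}" for j
    unfolding a_def using fm[OF that] by (cases "i = j") auto
  have step: "\<bar>(LINT \<xi>|component \<mu> j. e j \<xi>) - (LINT \<xi>|component \<mu> j. a j \<xi>)\<bar>
      \<le> C j * t\<^sup>2 * measure (component \<mu> j) UNIV" if j: "j \<in> {1..N}" for j
  proof -
    interpret C: finite_measure "component \<mu> j" by (rule finite_measure_component[OF j])
    have "\<bar>(LINT \<xi>|component \<mu> j. e j \<xi>) - (LINT \<xi>|component \<mu> j. a j \<xi>)\<bar>
        = \<bar>LINT \<xi>|component \<mu> j. e j \<xi> - a j \<xi>\<bar>"
      using ei[OF j] ai[OF j] by simp
    also have "\<dots> \<le> (LINT \<xi>|component \<mu> j. \<bar>e j \<xi> - a j \<xi>\<bar>)" by (rule integral_abs_bound)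
    also have "\<dots> \<le> (LINT \<xi>|component \<mu> j. C j * t\<^sup>2)"
      by (intro integral_mono Bochner_Integration.integrable_abs Bochner_Integration.integrable_diff ei ai j)
         (use short_time_expansion[OF i j f L t] in \<open>auto simp: e_def a_def C_def\<close>)
    finally show ?thesis by (simp add: ac_simps)
  qed
  have "(LINT x|component \<mu> i. f x) = (\<Sum>j\<in>{1..N}. LINT \<xi>|component \<mu> j. e j \<xi>)"
    unfolding e_def by (rule invariance[OF i t f])
  moreover have "(\<Sum>j\<in>{1..N}. LINT \<xi>|component \<mu> j. a j \<xi>) =
      exp (- rate i * t) * (LINT x|component \<mu> i. f (flow (u i) t x))
        + (\<Sum>j\<in>{1..N}. (1 - exp (- rate j * t)) * switch_prob j i * (LINT x|component \<mu> j. f x))"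
  proof -
    have "(LINT \<xi>|component \<mu> j. a j \<xi>) =
        (if i = j then exp (- rate i * t) * (LINT x|component \<mu> i. f (flow (u i) t x)) else 0)
        + (1 - exp (- rate j * t)) * switch_prob j i * (LINT x|component \<mu> j. f x)" if j: "j \<in> {1..N}" for j
      unfolding a_def using fm[OF j] by (cases "i = j") auto
    thus ?thesis using i by (simp add: sum.distrib)
  qed
  ultimately have "\<bar>(LINT x|component \<mu> i. f x) -
      (exp (- rate i * t) * (LINT x|component \<mu> i. f (flow (u i) t x))
        + (\<Sum>j\<in>{1..N}. (1 - exp (- rate j * t)) * switch_prob j i * (LINT x|component \<mu> j. f x)))\<bar>
    = \<bar>\<Sum>j\<in>{1..N}. (LINT \<xi>|component \<mu> j. e j \<xi>) - (LINT \<xi>|component \<mu> j. a j \<xi>)\<bar>"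
    by (simp add: sum_subtractf)
  also have "\<dots> \<le> (\<Sum>j\<in>{1..N}. C j * t\<^sup>2 * measure (component \<mu> j) UNIV)"
    using step by (intro sum_abs[THEN order_trans] sum_mono)
  also have "\<dots> = (\<Sum>j\<in>{1..N}. (rate j * L + (\<Sum>k\<in>{1..N}. rate j * rate k)) * measure (component \<mu> j) UNIV) * t\<^sup>2"
    by (subst sum_distrib_right) (simp add: C_def ac_simps)
  finally show "\<bar>(LINT x|component \<mu> i. f x) -
      (exp (- rate i * t) * (LINT x|component \<mu> i. f (flow (u i) t x))
        + (\<Sum>j\<in>{1..N}. (1 - exp (- rate j * t)) * switch_prob j i * (LINT x|component \<mu> j. f x)))\<bar>
    \<le> (\<Sum>j\<in>{1..N}. (rate j * L + (\<Sum>k\<in>{1..N}. rate j * rate k)) * measure (component \<mu> j) UNIV) * t\<^sup>2" .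
qed

text \<open>This is the generator equation \<open>\<integral> L f d\<mu> = 0\<close> for test functions that are concentrated on the
  state \<open>i\<close>. It comes from dividing the invariance over a time \<open>t\<close> by \<open>t\<close>; the
  uniform Lipschitz bound along the flow justifies the limit under the integral. The function
  \<open>f\<close> may fail to be differentiable at the points of a null set, because \<open>\<mu>\<close> has densities.\<close>

lemma weak_stationary_equation:
  assumes i: "i \<in> {1..N}" and f: "f \<in> borel_measurable borel" "\<And>x. 0 \<le> f x" "\<And>x. f x \<le> 1"
    and L: "\<And>k s x. k \<in> {1..N} \<Longrightarrow> s \<ge> 0 \<Longrightarrow> \<bar>f (flow (u k) s x) - f x\<bar> \<le> L * s"
    and d: "d \<in> borel_measurable borel"
    and lim: "AE \<xi> in lborel. (\<lambda>n. (f (flow (u i) (1 / real (Suc n)) \<xi>) - f \<xi>) / (1 / real (Suc n))) \<longlonglongrightarrow> d \<xi>"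
  shows "(LINT x|component \<mu> i. d x) - rate i * (LINT x|component \<mu> i. f x)
    + (\<Sum>j\<in>{1..N} - {i}. lam j i * (LINT x|component \<mu> j. f x)) = 0"
proof -
  define \<tau> where "\<tau> n = 1 / real (Suc n)" for n
  have \<tau>: "\<tau> n > 0" for n by (simp add: \<tau>_def)
  define m where "m j = (LINT x|component \<mu> j. f x)" for j
  define B where "B n = (LINT x|component \<mu> i. (f (flow (u i) (\<tau> n) x) - f x) / \<tau> n)" for n
  interpret C: finite_measure "component \<mu> i" by (rule finite_measure_component[OF i])
  have fl: "(\<lambda>\<xi>. f (flow (u i) (\<tau> n) \<xi>)) \<in> borel_measurable borel" for n
    by (rule measurable_compose[OF borel_measurable_mono f(1)])
       (use \<tau>[of n] in \<open>auto intro!: monoI flow_mono[OF complete[OF i]]\<close>)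
  have fi: "integrable (component \<mu> i) f" "integrable (component \<mu> i) (\<lambda>\<xi>. f (flow (u i) (\<tau> n) \<xi>))" for n
    using f fl by (auto intro!: C.integrable_const_bound[where B = 1] cong: measurable_cong_sets)
  have A: "(LINT x|component \<mu> i. f (flow (u i) (\<tau> n) x)) = m i + \<tau> n * B n" for n
    using fi \<tau>[of n] by (simp add: B_def m_def)
  have B: "B \<longlonglongrightarrow> (LINT x|component \<mu> i. d x)"
    unfolding B_def
  proof (rule integral_dominated_convergence[where w = "\<lambda>_. L"])
    show "AE x in component \<mu> i. (\<lambda>n. (f (flow (u i) (\<tau> n) x) - f x) / \<tau> n) \<longlonglongrightarrow> d x"
      unfolding \<tau>_def by (rule AE_component[OF i lim])
    show "AE x in component \<mu> i. norm ((f (flow (u i) (\<tau> n) x) - f x) / \<tau> n) \<le> L" for n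
      using L[OF i, of "\<tau> n"] \<tau>[of n] by (auto simp: abs_divide pos_divide_le_eq)
  qed (use f fl d in \<open>auto cong: measurable_cong_sets\<close>)
  obtain K where K: "\<And>t. t \<ge> 0 \<Longrightarrow> \<bar>m i - (exp (- rate i * t) * (LINT x|component \<mu> i. f (flow (u i) t x))
        + (\<Sum>j\<in>{1..N}. (1 - exp (- rate j * t)) * switch_prob j i * m j))\<bar> \<le> K * t\<^sup>2"
    unfolding m_def using stationary_short_time[OF i f L] by blast
  define R where "R n = (1 - exp (- rate i * \<tau> n)) / \<tau> n * m i - exp (- rate i * \<tau> n) * B n
      - (\<Sum>j\<in>{1..N}. (1 - exp (- rate j * \<tau> n)) / \<tau> n * switch_prob j i * m j)" for n
  have "\<bar>R n\<bar> \<le> K * \<tau> n" for n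
  proof -
    have "m i - (exp (- rate i * \<tau> n) * (m i + \<tau> n * B n)
        + (\<Sum>j\<in>{1..N}. (1 - exp (- rate j * \<tau> n)) * switch_prob j i * m j)) = R n * \<tau> n"
      using \<tau>[of n] by (simp add: R_def algebra_simps sum_distrib_left sum_divide_distrib diff_divide_distrib)
    hence "\<bar>R n\<bar> * \<tau> n \<le> K * (\<tau> n)\<^sup>2"
      using K[of "\<tau> n"] \<tau>[of n] by (simp add: A abs_mult)
    thus ?thesis using \<tau>[of n] by (simp add: power2_eq_square)
  qed
  moreover have \<tau>0: "\<tau> \<longlonglongrightarrow> 0"
    unfolding \<tau>_def using LIMSEQ_inverse_real_of_nat by (simp add: inverse_eq_divide)
  have "(\<lambda>n. K * \<tau> n) \<longlonglongrightarrow> K * 0" by (intro tendsto_intros \<tau>0)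
  ultimately have "R \<longlonglongrightarrow> 0" by (intro Lim_null_comparison[of R "\<lambda>n. K * \<tau> n"]) auto
  moreover have "R \<longlonglongrightarrow> rate i * m i - exp (- rate i * 0) * (LINT x|component \<mu> i. d x)
      - (\<Sum>j\<in>{1..N}. rate j * switch_prob j i * m j)"
    unfolding R_def by (intro tendsto_intros B \<tau>0) (use exp_difference_quotient in \<open>simp add: \<tau>_def\<close>)+
  ultimately have "rate i * m i - (LINT x|component \<mu> i. d x)
      - (\<Sum>j\<in>{1..N}. rate j * switch_prob j i * m j) = 0"
    using LIMSEQ_unique by fastforce
  moreover have "(\<Sum>j\<in>{1..N}. rate j * switch_prob j i * m j) = (\<Sum>j\<in>{1..N} - {i}. lam j i * m j)"
    using i by (intro sum.mono_neutral_cong_right) (auto simp: rate_switch_prob)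
  ultimately show ?thesis by (simp add: m_def)
qed

text \<open>In the distributional sense the stationary equation is \<open>(u\<^sub>i \<rho>\<^sub>i)' = source i\<close>, and the flux
  is the solution that vanishes at plus infinity.\<close>

definition source :: "nat \<Rightarrow> real \<Rightarrow> real" where
  "source i x = (\<Sum>j\<in>{1..N} - {i}. lam j i * \<rho> j x) - rate i * \<rho> i x"

definition flux :: "nat \<Rightarrow> real \<Rightarrow> real" where
  "flux i x = - (LINT y:{x<..}|lborel. source i y)"

lemma source_integrable: "i \<in> {1..N} \<Longrightarrow> integrable lborel (source i)"
  unfolding source_def
  by (intro Bochner_Integration.integrable_diff Bochner_Integration.integrable_sum
      Bochner_Integration.integrable_mult_right density_integrable) auto

lemma source_set_integrable: "i \<in> {1..N} \<Longrightarrow> A \<in> sets borel \<Longrightarrow> set_integrable lborel A (source i)"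
  unfolding set_integrable_def by (intro integrable_mult_indicator source_integrable) auto

lemma flux_diff:
  assumes i: "i \<in> {1..N}" and "x \<le> y"
  shows "flux i y - flux i x = (LINT z:{x<..<y}|lborel. source i z)"
proof (cases "x = y")
  case True
  thus ?thesis by (simp add: set_lebesgue_integral_def)
next
  case False
  hence eq: "{x<..} = {x<..<y} \<union> {y..}" using assms by auto
  have "(LINT z:{x<..}|lborel. source i z) = (LINT z:{x<..<y}|lborel. source i z) + (LINT z:{y..}|lborel. source i z)"
    unfolding eq using i by (intro set_integral_Un source_set_integrable) auto
  also have "(LINT z:{y..}|lborel. source i z) = (LINT z:{y<..}|lborel. source i z)"
  proof (rule set_integral_cong_set)
    have "AE z in lborel. z \<noteq> y" by (rule AE_lborel_singleton)
    thus "AE z in lborel. (z \<in> {y<..}) = (z \<in> {y..})" by eventually_elim auto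
  qed (use source_set_integrable[OF i] in \<open>auto simp: set_integrable_def set_borel_measurable_def\<close>)
  finally show ?thesis by (simp add: flux_def)
qed

lemma flux_continuous:
  assumes i: "i \<in> {1..N}"
  shows "continuous_on UNIV (flux i)"
  unfolding continuous_on_eq_continuous_at[OF open_UNIV] continuous_at_sequentially o_def
proof (intro ballI allI impI)
  fix x :: real and X :: "nat \<Rightarrow> real" assume X: "X \<longlonglongrightarrow> x"
  have "(\<lambda>n. LINT y|lborel. indicator {X n<..} y *\<^sub>R source i y) \<longlonglongrightarrow> (LINT y|lborel. indicator {x<..} y *\<^sub>R source i y)"
  proof (rule integral_dominated_convergence[where w = "\<lambda>y. \<bar>source i y\<bar>"])
    show "AE y in lborel. (\<lambda>n. indicator {X n<..} y *\<^sub>R source i y) \<longlonglongrightarrow> indicator {x<..} y *\<^sub>R source i y"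
      using AE_lborel_singleton[of x]
    proof eventually_elim
      case (elim y)
      have "\<forall>\<^sub>F n in sequentially. indicator {X n<..} y = (indicator {x<..} y :: real)"
      proof (cases "x < y")
        case True
        from order_tendstoD(2)[OF X this] show ?thesis
          by eventually_elim (use True in auto)
      next
        case False
        hence "y < x" using elim by simp
        from order_tendstoD(1)[OF X this] show ?thesis
          by eventually_elim (use False in auto)
      qed
      hence "\<forall>\<^sub>F n in sequentially. indicator {X n<..} y *\<^sub>R source i y = indicator {x<..} y *\<^sub>R source i y"
        by eventually_elim simp
      thus ?case by (rule tendsto_eventually)
    qed
  qed (use source_integrable[OF i] in \<open>auto simp: indicator_def\<close>)
  thus "(\<lambda>n. flux i (X n)) \<longlonglongrightarrow> flux i x"
    unfolding flux_def set_lebesgue_integral_def by (rule tendsto_minus)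
qed

text \<open>Testing with the ramp from \<open>p\<close> to \<open>q\<close> says that \<open>u\<^sub>i \<rho>\<^sub>i\<close> and the flux have the same
  mean over \<open>(p, q)\<close>. The ramp is constant to the right of \<open>q\<close>, but still admissible as a test
  function because the measures are finite, and this fixes the constant of integration
  in the definition of the flux.\<close>

lemma flux_interval:
  assumes i: "i \<in> {1..N}" and pq: "p < q"
  shows "set_integrable lborel {p<..<q} (\<lambda>x. u i x * \<rho> i x)" (is ?int)
    and "(LINT x:{p<..<q}|lborel. u i x * \<rho> i x) = (LINT x:{p<..<q}|lborel. flux i x)" (is ?eq)
proof -
  have [measurable]: "u k \<in> borel_measurable borel" if "k \<in> {1..N}" for k
    by (rule borel_measurable_continuous_onI[OF continuous_field[OF that]])
  have "\<exists>M. \<forall>x\<in>{p..q}. \<bar>u k x\<bar> \<le> M" if "k \<in> {1..N}" for k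
  proof -
    have "bounded (u k ` {p..q})"
      by (intro compact_imp_bounded compact_continuous_image continuous_on_subset[OF continuous_field[OF that]]) auto
    thus ?thesis by (auto simp: bounded_iff)
  qed
  then obtain M where M: "\<And>k x. k \<in> {1..N} \<Longrightarrow> x \<in> {p..q} \<Longrightarrow> \<bar>u k x\<bar> \<le> M k" by metis
  define Mx where "Mx = Max (M ` {1..N})"
  have Mx: "\<bar>u k x\<bar> \<le> Mx" if "k \<in> {1..N}" "x \<in> {p..q}" for k x
    using M[OF that] that(1) by (auto simp: Mx_def intro: order_trans)
  define f where "f x = (max p (min q x) - p) / (q - p)" for x
  define d where "d x = indicator {p<..<q} x * u i x / (q - p)" for x
  have f: "f \<in> borel_measurable borel" "0 \<le> f x" "f x \<le> 1" for x
    using pq unfolding f_def by (measurable, auto simp: divide_simps)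
  have L: "\<bar>f (flow (u k) s x) - f x\<bar> \<le> Mx / (q - p) * s" if k: "k \<in> {1..N}" and s: "s \<ge> 0" for k s x
  proof -
    have "f (flow (u k) s x) - f x = (max p (min q (flow (u k) s x)) - max p (min q x)) / (q - p)"
      unfolding f_def by (simp flip: diff_divide_distrib)
    moreover have "\<bar>max p (min q (flow (u k) s x)) - max p (min q x)\<bar> \<le> Mx * s"
      by (rule clamped_flow_lipschitz[OF complete[OF k]]) (use pq Mx k s in auto)
    ultimately show ?thesis using pq by (simp add: abs_divide divide_right_mono)
  qed
  have lim: "AE \<xi> in lborel. (\<lambda>n. (f (flow (u i) (1 / real (Suc n)) \<xi>) - f \<xi>) / (1 / real (Suc n))) \<longlonglongrightarrow> d \<xi>"
    using AE_lborel_singleton[of p] AE_lborel_singleton[of q]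
  proof eventually_elim
    case (elim \<xi>)
    note conv = flow_inverse_Suc_tendsto[OF complete[OF i], of \<xi>]
    consider "\<xi> < p" | "q < \<xi>" | "p < \<xi>" "\<xi> < q" using elim by linarith
    thus ?case
    proof cases
      case 1
      from order_tendstoD(2)[OF conv 1]
      have "\<forall>\<^sub>F n in sequentially. (f (flow (u i) (1 / real (Suc n)) \<xi>) - f \<xi>) / (1 / real (Suc n)) = d \<xi>"
        by eventually_elim (use 1 pq in \<open>simp add: f_def d_def\<close>)
      thus ?thesis by (rule tendsto_eventually)
    next
      case 2
      from order_tendstoD(1)[OF conv 2]
      have "\<forall>\<^sub>F n in sequentially. (f (flow (u i) (1 / real (Suc n)) \<xi>) - f \<xi>) / (1 / real (Suc n)) = d \<xi>"
        by eventually_elim (use 2 pq in \<open>simp add: f_def d_def\<close>)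
      thus ?thesis by (rule tendsto_eventually)
    next
      case 3
      from order_tendstoD(1)[OF conv 3(1)] order_tendstoD(2)[OF conv 3(2)]
      have "\<forall>\<^sub>F n in sequentially. (flow (u i) (1 / real (Suc n)) \<xi> - \<xi>) / (1 / real (Suc n)) / (q - p) =
          (f (flow (u i) (1 / real (Suc n)) \<xi>) - f \<xi>) / (1 / real (Suc n))"
      proof eventually_elim
        case (elim n)
        hence "f (flow (u i) (1 / real (Suc n)) \<xi>) - f \<xi> = (flow (u i) (1 / real (Suc n)) \<xi> - \<xi>) / (q - p)"
          using 3 by (simp add: f_def flip: diff_divide_distrib)
        thus ?case by simp
      qed
      moreover have "(\<lambda>n. (flow (u i) (1 / real (Suc n)) \<xi> - \<xi>) / (1 / real (Suc n)) / (q - p)) \<longlonglongrightarrow> u i \<xi> / (q - p)"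
        by (intro tendsto_divide[OF flow_difference_quotient[OF complete[OF i]]]) (use pq in auto)
      ultimately have "(\<lambda>n. (f (flow (u i) (1 / real (Suc n)) \<xi>) - f \<xi>) / (1 / real (Suc n))) \<longlonglongrightarrow> u i \<xi> / (q - p)"
        by (rule Lim_transform_eventually[rotated])
      thus ?thesis using 3 by (simp add: d_def)
    qed
  qed
  have dm: "d \<in> borel_measurable borel" unfolding d_def using i by measurable
  have weak: "(LINT x|component \<mu> i. d x) - rate i * (LINT x|component \<mu> i. f x)
    + (\<Sum>j\<in>{1..N} - {i}. lam j i * (LINT x|component \<mu> j. f x)) = 0"
    by (rule weak_stationary_equation[OF i f L dm lim])
  have fi: "integrable lborel (\<lambda>x. \<rho> j x * f x)" if "j \<in> {1..N}" for j
    by (rule Bochner_Integration.integrable_bound[OF density_integrable[OF that]])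
       (use that f in \<open>auto simp: abs_mult intro!: mult_left_le\<close>)
  have "rate i * (LINT x|component \<mu> i. f x) - (\<Sum>j\<in>{1..N} - {i}. lam j i * (LINT x|component \<mu> j. f x))
      = rate i * (LINT x|lborel. \<rho> i x * f x) - (\<Sum>j\<in>{1..N} - {i}. lam j i * (LINT x|lborel. \<rho> j x * f x))"
    using i f by (simp add: integral_component)
  also have "\<dots> = (LINT x|lborel. rate i * (\<rho> i x * f x) - (\<Sum>j\<in>{1..N} - {i}. lam j i * (\<rho> j x * f x)))"
    using fi i by (subst Bochner_Integration.integral_diff)
      (auto intro!: Bochner_Integration.integrable_sum simp: Bochner_Integration.integral_sum)
  also have "\<dots> = - (LINT x|lborel. source i x * f x)"
    unfolding source_def
    by (subst Bochner_Integration.integral_minus[symmetric], intro Bochner_Integration.integral_cong)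
       (auto simp: algebra_simps sum_distrib_left)
  finally have weak': "(LINT x|lborel. \<rho> i x * d x) = - (LINT x|lborel. source i x * f x)"
    using weak integral_component[OF i dm] by simp

  \<comment> \<open>the ramp is the average over \<open>s\<close> of the unit steps at \<open>s\<close>\<close>
  define h where "h s x = indicator {p<..<q} s * (indicator {s<..} x * source i x)" for s x :: real
  have hm: "case_prod h \<in> borel_measurable (lborel \<Otimes>\<^sub>M lborel)"
  proof -
    have [measurable]: "source i \<in> borel_measurable borel" using source_integrable[OF i] by simp
    have "case_prod h = (\<lambda>z. indicator {p<..<q} (fst z) * ((if fst z < snd z then 1 else 0) * source i (snd z)))"
      by (auto simp: h_def fun_eq_iff indicator_def)
    thus ?thesis by simp
  qed
  have hint: "integrable (lborel \<Otimes>\<^sub>M lborel) (case_prod h)"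
  proof (rule lborel_pair.Fubini_integrable[OF hm])
    have "(LINT x|lborel. norm (h s x)) = indicator {p<..<q} s * (LINT x:{s<..}|lborel. \<bar>source i x\<bar>)" for s
      by (simp add: h_def set_lebesgue_integral_def abs_mult)
    moreover have "integrable lborel (\<lambda>s. indicator {p<..<q} s * (LINT x:{s<..}|lborel. \<bar>source i x\<bar>))"
    proof (rule Bochner_Integration.integrable_bound[where f = "\<lambda>s. indicator {p<..<q} s * (LINT x|lborel. \<bar>source i x\<bar>)"])
      show "integrable lborel (\<lambda>s. indicator {p<..<q} s * (LINT x|lborel. \<bar>source i x\<bar>))"
        by (intro Bochner_Integration.integrable_mult_left integrable_real_indicator) (use pq in auto)
      have "(\<lambda>s. LINT x|lborel. norm (h s x)) \<in> borel_measurable lborel"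
        using hm by (intro lborel.borel_measurable_lebesgue_integral) (simp add: case_prod_unfold)
      thus "(\<lambda>s. indicator {p<..<q} s * (LINT x:{s<..}|lborel. \<bar>source i x\<bar>)) \<in> borel_measurable lborel"
        by (simp only: calculation)
      have "(LINT x:{s<..}|lborel. \<bar>source i x\<bar>) \<le> (LINT x|lborel. \<bar>source i x\<bar>)" for s
        unfolding set_lebesgue_integral_def using source_integrable[OF i]
        by (intro integral_mono integrable_mult_indicator) (auto simp: indicator_def)
      moreover have "0 \<le> (LINT x:{s<..}|lborel. \<bar>source i x\<bar>)" for s
        unfolding set_lebesgue_integral_def by (intro integral_nonneg_AE) auto
      ultimately show "AE s in lborel. norm (indicator {p<..<q} s * (LINT x:{s<..}|lborel. \<bar>source i x\<bar>))
          \<le> norm (indicator {p<..<q} s * (LINT x|lborel. \<bar>source i x\<bar>))"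
        by (intro AE_I2) (auto simp: indicator_def intro: order_trans)
    qed
    ultimately show "integrable lborel (\<lambda>s. LINT x|lborel. norm (case (s, x) of (s, x) \<Rightarrow> h s x))"
      by simp
    show "AE s in lborel. integrable lborel (\<lambda>x. case (s, x) of (s, x) \<Rightarrow> h s x)"
      unfolding h_def using source_set_integrable[OF i, of "{_<..}"]
      by (intro AE_I2) (simp add: set_integrable_def)
  qed
  have inner: "(LINT s|lborel. h s x) = (q - p) * (source i x * f x)" for x
  proof -
    have "(LINT s|lborel. h s x) = (LINT s|lborel. indicator ({p<..<q} \<inter> {..<x}) s * source i x)"
      by (intro Bochner_Integration.integral_cong) (auto simp: h_def indicator_def)
    also have "\<dots> = measure lborel ({p<..<q} \<inter> {..<x}) * source i x" by simp
    also have "measure lborel ({p<..<q} \<inter> {..<x}) = max p (min q x) - p"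
    proof (cases "p < x")
      case True
      have "{p<..<q} \<inter> {..<x} = {p<..<min q x}" by auto
      thus ?thesis using True pq by simp
    next
      case False
      hence "{p<..<q} \<inter> {..<x} = {}" by auto
      thus ?thesis using False pq by simp
    qed
    finally show ?thesis using pq by (simp add: f_def)
  qed
  have "- (LINT s:{p<..<q}|lborel. flux i s) = (LINT s|lborel. LINT x|lborel. h s x)"
    by (simp add: h_def flux_def set_lebesgue_integral_def)
  also have "\<dots> = (LINT x|lborel. LINT s|lborel. h s x)"
    by (rule lborel_pair.Fubini_integral[OF hint, symmetric])
  also have "\<dots> = (q - p) * (LINT x|lborel. source i x * f x)" by (simp only: inner integral_mult_right_zero)
  finally have fub: "(LINT s:{p<..<q}|lborel. flux i s) = - ((q - p) * (LINT x|lborel. source i x * f x))"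
    by simp

  have dom: "integrable lborel (\<lambda>x. Mx * \<rho> i x)" using density_integrable[OF i] by simp
  have "norm (indicator {p<..<q} x *\<^sub>R (u i x * \<rho> i x)) \<le> norm (Mx * \<rho> i x)" for x
  proof (cases "x \<in> {p<..<q}")
    case True
    hence "\<bar>u i x\<bar> \<le> \<bar>Mx\<bar>" using Mx[OF i, of x] by auto
    thus ?thesis by (auto simp: indicator_def abs_mult intro!: mult_right_mono)
  qed auto
  thus ?int
    unfolding set_integrable_def
    by (intro Bochner_Integration.integrable_bound[OF dom]) (use i in auto)
  have "(LINT x|lborel. \<rho> i x * d x) = (LINT x:{p<..<q}|lborel. u i x * \<rho> i x) / (q - p)"
    unfolding set_lebesgue_integral_def
    by (subst integral_divide_zero[symmetric], intro Bochner_Integration.integral_cong) (auto simp: d_def)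
  with weak' fub pq show ?eq by (simp add: field_simps)
qed

text \<open>Thus \<open>u\<^sub>i \<rho>\<^sub>i\<close> has a continuous representative even where \<open>\<rho>\<^sub>i\<close> itself is unbounded.\<close>

lemma flux_eq:
  assumes i: "i \<in> {1..N}"
  shows "AE x in lborel. flux i x = u i x * \<rho> i x"
proof -
  have fl: "set_integrable lborel {p<..<q} (flux i)" if "p < q" for p q
  proof -
    have "set_integrable lborel {p..q} (flux i)"
      by (rule borel_integrable_atLeastAtMost'[OF continuous_on_subset[OF flux_continuous[OF i]]]) simp
    thus ?thesis by (rule set_integrable_subset) auto
  qed
  have "AE x in lborel. x \<in> {- real n<..<real n} \<longrightarrow> u i x * \<rho> i x = flux i x" for n
    by (rule AE_eq_if_interval_integrals_eq) (use flux_interval[OF i] fl in auto)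
  hence "AE x in lborel. \<forall>n. x \<in> {- real n<..<real n} \<longrightarrow> u i x * \<rho> i x = flux i x"
    unfolding AE_all_countable by blast
  thus ?thesis
  proof eventually_elim
    case (elim x)
    obtain n where "\<bar>x\<bar> < real n" using reals_Archimedean2 by blast
    thus ?case using elim by (auto simp: abs_less_iff)
  qed
qed

end

section \<open>The densities do not vanish inside the support\<close>

context stationary_switching
begin

lemma flux_times_field_nonneg:
  assumes i: "i \<in> {1..N}"
  shows "0 \<le> u i x * flux i x"
proof (rule continuous_nonneg_if_AE[where f = "\<lambda>x. u i x * flux i x" and a = "x - 1" and b = "x + 1"])
  show "continuous_on {x - 1<..<x + 1} (\<lambda>x. u i x * flux i x)"
    by (intro continuous_intros continuous_on_subset[OF continuous_field[OF i]]
        continuous_on_subset[OF flux_continuous[OF i]]) auto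
  show "AE y in lborel. y \<in> {x - 1<..<x + 1} \<longrightarrow> 0 \<le> u i y * flux i y"
    using flux_eq[OF i] density_nonneg[OF i]
    by eventually_elim (auto simp flip: mult.assoc)
qed auto

text \<open>Let \<open>u\<^sub>i\<close> point from the side \<open>\<sigma>\<close> towards \<open>\<beta>\<close>, and let the flux at \<open>\<beta>\<close> be zero. For a
  point \<open>x\<close> on that side, \<open>\<bar>flux i x\<bar>\<close> is then the mass that leaves the state \<open>i\<close> between \<open>x\<close> and \<open>\<beta>\<close> by
  switching minus the mass that enters it there. So it is at most \<open>rate i\<close> times the integral of
  \<open>\<rho>\<^sub>i = flux i / u\<^sub>i\<close>, and Gronwall's argument on a short segment makes it zero. The
  mass that enters the state \<open>i\<close> vanishes too, and since all switching rates are positive, all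
  densities vanish.\<close>

lemma densities_vanish_on_side:
  fixes \<sigma> :: real
  assumes i: "i \<in> {1..N}" and sg: "\<bar>\<sigma>\<bar> = 1" and into: "\<sigma> * u i \<beta> < 0" and zero: "flux i \<beta> = 0"
  obtains \<delta> where "\<delta> > 0"
    "AE x in lborel. 0 < \<sigma> * (x - \<beta>) \<and> \<sigma> * (x - \<beta>) < \<delta> \<longrightarrow> (\<forall>j\<in>{1..N}. \<rho> j x = 0)"
proof -
  define c where "c = - (\<sigma> * u i \<beta>) / 2"
  have c: "c > 0" using into by (simp add: c_def)
  have "isCont (\<lambda>x. \<sigma> * u i x) \<beta>"
    using continuous_field[OF i] by (auto simp: continuous_on_eq_continuous_at intro!: continuous_intros)
  hence "((\<lambda>x. \<sigma> * u i x) \<longlongrightarrow> \<sigma> * u i \<beta>) (nhds \<beta>)"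
    using tendsto_at_iff_tendsto_nhds[of "\<lambda>x. \<sigma> * u i x" \<beta>] by (simp add: isCont_def)
  from order_tendstoD(2)[OF this, of "- c"]
  have "\<forall>\<^sub>F x in nhds \<beta>. \<sigma> * u i x < - c" using into by (simp add: c_def)
  then obtain \<delta>0 where \<delta>0: "\<delta>0 > 0" "\<And>x. \<bar>x - \<beta>\<bar> < \<delta>0 \<Longrightarrow> \<sigma> * u i x < - c"
    unfolding eventually_nhds_metric dist_real_def by blast
  define \<delta> where "\<delta> = min (\<delta>0 / 2) (c / (2 * rate i))"
  have \<delta>: "\<delta> > 0" "\<delta> < \<delta>0" "rate i / c * \<delta> \<le> 1 / 2"
    using \<delta>0 c exit_rate_pos[OF i] by (auto simp: \<delta>_def min_def field_simps)
  define l where "l = min \<beta> (\<beta> + \<sigma> * \<delta>)"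
  define r where "r = max \<beta> (\<beta> + \<sigma> * \<delta>)"
  have \<sigma>: "\<sigma> = 1 \<or> \<sigma> = -1" using sg by linarith
  have lr: "l < r" "r - l = \<delta>" "\<beta> \<in> {l..r}" using \<sigma> \<delta> by (auto simp: l_def r_def)
  have near: "\<bar>x - \<beta>\<bar> < \<delta>0" if "x \<in> {l..r}" for x using \<sigma> \<delta> that by (auto simp: l_def r_def)
  define v where "v x = - \<sigma> * flux i x" for x
  have ucx: "\<sigma> * u i x < - c" if "x \<in> {l..r}" for x using \<delta>0(2) near that by blast
  have v0: "0 \<le> v x" if "x \<in> {l..r}" for x
    using flux_times_field_nonneg[OF i, of x] ucx[OF that] c \<sigma>
    by (auto simp: v_def zero_le_mult_iff)
  have seg: "v x = (LINT z:{min \<beta> x<..<max \<beta> x}|lborel. - source i z)" if x: "x \<in> {l..r}" for x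
  proof -
    have neg: "(LINT z:A|lborel. - source i z) = - (LINT z:A|lborel. source i z)" for A
      by (simp add: set_lebesgue_integral_def)
    show ?thesis
    proof (cases "\<sigma> = 1")
      case True
      hence "\<beta> \<le> x" using x \<delta> by (auto simp: l_def)
      thus ?thesis using flux_diff[OF i, of \<beta> x] zero True by (simp add: v_def neg)
    next
      case False
      hence "\<sigma> = -1" using \<sigma> by auto
      hence "x \<le> \<beta>" using x \<delta> by (auto simp: r_def)
      thus ?thesis using flux_diff[OF i, of x \<beta>] zero \<open>\<sigma> = -1\<close> by (simp add: v_def neg)
    qed
  qed
  have sum_nonneg: "AE x in lborel. 0 \<le> (\<Sum>j\<in>{1..N} - {i}. lam j i * \<rho> j x)"
  proof -
    have "AE x in lborel. \<forall>j\<in>{1..N}. 0 \<le> \<rho> j x"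
      using density_nonneg by (intro AE_finite_allI) auto
    thus ?thesis
      by eventually_elim (intro sum_nonneg mult_nonneg_nonneg, use i rate_pos in \<open>auto simp: less_imp_le\<close>)
  qed
  have rho_le: "\<rho> i x \<le> v x / c" if "x \<in> {l..r}" "flux i x = u i x * \<rho> i x" "0 \<le> \<rho> i x" for x
  proof -
    have "c * \<rho> i x \<le> (- \<sigma> * u i x) * \<rho> i x"
      using ucx[OF that(1)] that(3) by (intro mult_right_mono) auto
    thus ?thesis using that(2) c by (simp add: v_def field_simps)
  qed
  have "continuous_on {l..r} v"
    unfolding v_def by (intro continuous_intros continuous_on_subset[OF flux_continuous[OF i]]) auto
  then obtain x1 where x1: "x1 \<in> {l..r}" "\<And>x. x \<in> {l..r} \<Longrightarrow> v x \<le> v x1"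
    using continuous_attains_sup[of "{l..r}" v] lr by auto
  define I where "I = {min \<beta> x1<..<max \<beta> x1}"
  have "(LINT z:I|lborel. - source i z) \<le> (LINT z:I|lborel. rate i / c * v x1)"
    unfolding set_lebesgue_integral_def
  proof (rule integral_mono_AE)
    show "integrable lborel (\<lambda>z. indicator I z *\<^sub>R - source i z)"
      using source_set_integrable[OF i, of I] by (simp add: set_integrable_def I_def)
    show "integrable lborel (\<lambda>z. indicator I z *\<^sub>R (rate i / c * v x1))"
      unfolding I_def by (intro integrable_scaleR_left integrable_real_indicator) auto
    show "AE z in lborel. indicator I z *\<^sub>R - source i z \<le> indicator I z *\<^sub>R (rate i / c * v x1)"
      using sum_nonneg flux_eq[OF i] density_nonneg[OF i]
    proof eventually_elim
      case (elim z)
      show ?case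
      proof (cases "z \<in> I")
        case True
        hence z: "z \<in> {l..r}" using x1 lr by (auto simp: I_def)
        have "- source i z \<le> rate i * \<rho> i z" using elim by (simp add: source_def)
        also have "\<dots> \<le> rate i * (v z / c)"
          using rho_le[OF z] elim exit_rate_pos[OF i] by (intro mult_left_mono) auto
        also have "\<dots> \<le> rate i * (v x1 / c)"
          using x1(2)[OF z] exit_rate_pos[OF i] c by (intro mult_left_mono divide_right_mono) auto
        finally show ?thesis using True by simp
      qed simp
    qed
  qed
  hence "v x1 \<le> (LINT z:I|lborel. rate i / c * v x1)" using seg[OF x1(1)] by (simp add: I_def)
  also have "\<dots> = (max \<beta> x1 - min \<beta> x1) * (rate i / c * v x1)"
    by (simp add: set_lebesgue_integral_def I_def)
  also have "\<dots> \<le> \<delta> * (rate i / c * v x1)"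
    using x1 lr v0[OF x1(1)] exit_rate_pos[OF i] c
    by (intro mult_right_mono mult_nonneg_nonneg) auto
  also have "\<dots> = (rate i / c * \<delta>) * v x1" by simp
  also have "\<dots> \<le> 1 / 2 * v x1" using \<delta>(3) v0[OF x1(1)] by (rule mult_right_mono)
  finally have "v x1 \<le> 0" by simp
  hence v_zero: "v x = 0" if "x \<in> {l..r}" for x using x1(2)[OF that] v0[OF that] by linarith
  hence flux_zero: "flux i x = 0" if "x \<in> {l..r}" for x
    using that \<sigma> by (auto simp: v_def)
  have rho_i: "AE x in lborel. x \<in> {l<..<r} \<longrightarrow> \<rho> i x = 0"
    using flux_eq[OF i]
  proof eventually_elim
    case (elim x)
    show ?case
    proof
      assume x: "x \<in> {l<..<r}"
      hence "u i x * \<rho> i x = 0" using flux_zero[of x] elim by simp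
      moreover have "u i x \<noteq> 0" using ucx[of x] x c by auto
      ultimately show "\<rho> i x = 0" by simp
    qed
  qed
  define s where "s x = indicator {l<..<r} x * (\<Sum>j\<in>{1..N} - {i}. lam j i * \<rho> j x)" for x
  have s_eq: "AE x in lborel. indicator {l<..<r} x *\<^sub>R source i x = s x"
    using rho_i by eventually_elim (auto simp: s_def source_def indicator_def)
  have s_int: "integrable lborel s"
  proof -
    have "integrable lborel (\<lambda>x. \<Sum>j\<in>{1..N} - {i}. lam j i * \<rho> j x)"
      using density_integrable by (intro Bochner_Integration.integrable_sum integrable_mult_right) auto
    from integrable_mult_indicator[OF _ this, of "{l<..<r}"] show ?thesis by (simp add: s_def[abs_def])
  qed
  have "integral\<^sup>L lborel s = (LINT x:{l<..<r}|lborel. source i x)"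
    unfolding set_lebesgue_integral_def using s_eq s_int source_integrable[OF i]
    by (intro integral_cong_AE) (auto elim: eventually_mono)
  also have "\<dots> = 0" using flux_diff[OF i, of l r] flux_zero[of l] flux_zero[of r] lr by simp
  finally have "AE x in lborel. s x = 0"
    using s_int sum_nonneg
    by (subst (asm) integral_nonneg_eq_0_iff_AE) (auto simp: s_def elim!: eventually_mono)
  moreover have "AE x in lborel. \<forall>j\<in>{1..N}. 0 \<le> \<rho> j x"
    using density_nonneg by (intro AE_finite_allI) auto
  ultimately have "AE x in lborel. x \<in> {l<..<r} \<longrightarrow> (\<forall>j\<in>{1..N}. \<rho> j x = 0)"
    using rho_i
  proof eventually_elim
    case (elim x)
    show ?case
    proof (intro impI ballI)
      fix j assume x: "x \<in> {l<..<r}" and j: "j \<in> {1..N}"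
      show "\<rho> j x = 0"
      proof (cases "j = i")
        case False
        have "(\<Sum>k\<in>{1..N} - {i}. lam k i * \<rho> k x) = 0" using elim(1) x by (simp add: s_def)
        moreover have "0 \<le> lam k i * \<rho> k x" if "k \<in> {1..N} - {i}" for k
          using that elim(2) rate_pos[of k i] i by (intro mult_nonneg_nonneg) (auto simp: less_imp_le)
        ultimately have "lam j i * \<rho> j x = 0"
          using sum_nonneg_eq_0_iff[of "{1..N} - {i}" "\<lambda>k. lam k i * \<rho> k x"] j False by auto
        thus ?thesis using rate_pos[OF j i False] by simp
      qed (use elim x in auto)
    qed
  qed
  hence "AE x in lborel. 0 < \<sigma> * (x - \<beta>) \<and> \<sigma> * (x - \<beta>) < \<delta> \<longrightarrow> (\<forall>j\<in>{1..N}. \<rho> j x = 0)"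
  proof eventually_elim
    case (elim x)
    have "x \<in> {l<..<r}" if "0 < \<sigma> * (x - \<beta>)" "\<sigma> * (x - \<beta>) < \<delta>"
      using that \<sigma> \<delta> by (auto simp: l_def r_def)
    thus ?case using elim by blast
  qed
  with \<delta>(1) show thesis by (rule that)
qed

lemma densities_vanish_near:
  assumes J: "minimal_invariant_set N u J" and x: "x \<in> interior J"
    and zero: "\<And>i. i \<in> {1..N} \<Longrightarrow> flux i x = 0"
  obtains \<delta> where "\<delta> > 0" "ball x \<delta> \<subseteq> interior J"
    "AE y in lborel. y \<in> ball x \<delta> \<longrightarrow> (\<forall>j\<in>{1..N}. \<rho> j y = 0)"
proof -
  obtain i where i: "i \<in> {1..N}" "1 * u i x < 0"
    using minimal_invariant_set_crossing[OF complete J x, of 1] by auto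
  obtain i' where i': "i' \<in> {1..N}" "-1 * u i' x < 0"
    using minimal_invariant_set_crossing[OF complete J x, of "-1"] by auto
  obtain d where d: "d > 0"
    "AE y in lborel. 0 < 1 * (y - x) \<and> 1 * (y - x) < d \<longrightarrow> (\<forall>j\<in>{1..N}. \<rho> j y = 0)"
    using densities_vanish_on_side[OF i(1) _ i(2) zero[OF i(1)]] by auto
  obtain d' where d': "d' > 0"
    "AE y in lborel. 0 < -1 * (y - x) \<and> -1 * (y - x) < d' \<longrightarrow> (\<forall>j\<in>{1..N}. \<rho> j y = 0)"
    using densities_vanish_on_side[OF i'(1) _ i'(2) zero[OF i'(1)]] by auto
  obtain e where e: "e > 0" "ball x e \<subseteq> interior J"
    using x open_interior by (meson openE)
  define \<delta> where "\<delta> = min e (min d d')"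
  have "AE y in lborel. y \<in> ball x \<delta> \<longrightarrow> (\<forall>j\<in>{1..N}. \<rho> j y = 0)"
    using d(2) d'(2) AE_lborel_singleton[of x]
  proof eventually_elim
    case (elim y)
    thus ?case by (auto simp: \<delta>_def dist_real_def abs_if split: if_splits)
  qed
  moreover have "ball x \<delta> \<subseteq> interior J" using e by (force simp: \<delta>_def)
  moreover have "\<delta> > 0" using d d' e by (simp add: \<delta>_def)
  ultimately show thesis using that by blast
qed

text \<open>The points of the interior of \<open>J\<close> where all fluxes vanish form a closed set, and it is
  open because every such point has a neighbourhood without mass. Since the interior
  of \<open>J\<close> is connected, a single such point leaves all of \<open>J\<close> without mass.\<close>

lemma minimal_set_null_if_densities_vanish:
  assumes J: "minimal_invariant_set N u J" and ab: "a < b" "{a<..<b} \<subseteq> J"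
    and zero: "AE x in lborel. x \<in> {a<..<b} \<longrightarrow> (\<forall>j\<in>{1..N}. \<rho> j x = 0)"
  shows "emeasure \<mu> (J \<times> {1..N}) = 0"
proof -
  have conv: "convex J" by (rule minimal_invariant_set_convex[OF complete J])
  have flux_zero: "flux i x = 0" if i: "i \<in> {1..N}" and x: "x \<in> {p<..<q}"
    and z: "AE x in lborel. x \<in> {p<..<q} \<longrightarrow> (\<forall>j\<in>{1..N}. \<rho> j x = 0)" for p q x i
  proof (rule continuous_zero_if_AE[where f = "flux i", OF _ _ x])
    show "continuous_on {p<..<q} (flux i)" by (rule continuous_on_subset[OF flux_continuous[OF i]]) simp
    show "AE y in lborel. y \<in> {p<..<q} \<longrightarrow> flux i y = 0"
      using z flux_eq[OF i] by eventually_elim (use i in auto)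
  qed
  define Z where "Z = {x. \<forall>i\<in>{1..N}. flux i x = 0}"
  have "closed Z"
  proof -
    have "Z = (\<Inter>i\<in>{1..N}. {x. flux i x = 0})" by (auto simp: Z_def)
    moreover have "closed {x. flux i x = 0}" if "i \<in> {1..N}" for i
      using closed_Collect_eq[OF flux_continuous[OF that] continuous_on_const] .
    ultimately show ?thesis by auto
  qed
  hence cl: "closedin (top_of_set (interior J)) (interior J \<inter> Z)" by (rule closedin_closed_Int)
  have "open (interior J \<inter> Z)"
    unfolding open_contains_ball
  proof
    fix x assume x: "x \<in> interior J \<inter> Z"
    then obtain \<delta> where \<delta>: "\<delta> > 0" "ball x \<delta> \<subseteq> interior J"
      "AE y in lborel. y \<in> ball x \<delta> \<longrightarrow> (\<forall>j\<in>{1..N}. \<rho> j y = 0)"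
      using densities_vanish_near[OF J, of x] by (auto simp: Z_def)
    have ball: "ball x \<delta> = {x - \<delta><..<x + \<delta>}" by (auto simp: dist_real_def)
    have "ball x \<delta> \<subseteq> Z"
      unfolding Z_def using flux_zero[of _ _ "x - \<delta>" "x + \<delta>"] \<delta>(3) unfolding ball by blast
    with \<delta> show "\<exists>e>0. ball x e \<subseteq> interior J \<inter> Z" by blast
  qed
  hence op: "openin (top_of_set (interior J)) (interior J \<inter> Z)"
    by (intro open_openin_trans) auto
  have mid: "(a + b) / 2 \<in> interior J \<inter> Z"
  proof
    have "{a<..<b} \<subseteq> interior J" using ab by (intro interior_maximal) auto
    thus "(a + b) / 2 \<in> interior J" using ab by auto
    show "(a + b) / 2 \<in> Z" unfolding Z_def using flux_zero[OF _ _ zero] ab by auto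
  qed
  have "connected (interior J)" using conv by (intro convex_connected convex_interior)
  hence "interior J \<inter> Z = interior J"
    using cl op mid unfolding connected_clopen by (metis empty_iff)
  hence all: "x \<in> interior J \<Longrightarrow> i \<in> {1..N} \<Longrightarrow> flux i x = 0" for x i
    unfolding Z_def by blast
  define F where "F = {B. open B \<and> (AE y in lborel. y \<in> B \<longrightarrow> (\<forall>j\<in>{1..N}. \<rho> j y = 0))}"
  obtain F' where F': "F' \<subseteq> F" "countable F'" "\<Union>F' = \<Union>F"
    using Lindelof[of F] by (auto simp: F_def)
  have van_F': "AE y in lborel. \<forall>B\<in>F'. y \<in> B \<longrightarrow> (\<forall>j\<in>{1..N}. \<rho> j y = 0)"
    using F' by (subst AE_ball_countable) (auto simp: F_def)
  have cover: "interior J \<subseteq> \<Union>F"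
  proof
    fix x assume x: "x \<in> interior J"
    obtain \<delta> where "\<delta> > 0" "AE y in lborel. y \<in> ball x \<delta> \<longrightarrow> (\<forall>j\<in>{1..N}. \<rho> j y = 0)"
      using densities_vanish_near[OF J x all[OF x]] by auto
    hence "ball x \<delta> \<in> F" "x \<in> ball x \<delta>" by (simp_all add: F_def)
    thus "x \<in> \<Union>F" by blast
  qed
  have "AE y in lborel. y \<notin> frontier J"
  proof (rule AE_not_in)
    have "frontier J \<in> null_sets lebesgue"
      using negligible_convex_frontier[OF conv] by (simp add: negligible_iff_null_sets)
    thus "frontier J \<in> null_sets lborel" by (subst (asm) null_sets_completion_iff) (simp_all add: borel_closed)
  qed
  with van_F' have van: "AE y in lborel. y \<in> closure J \<longrightarrow> (\<forall>j\<in>{1..N}. \<rho> j y = 0)"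
  proof eventually_elim
    case (elim y)
    show ?case
    proof
      assume "y \<in> closure J"
      hence "y \<in> \<Union>F'" using elim(2) cover unfolding F'(3) frontier_def by blast
      thus "\<forall>j\<in>{1..N}. \<rho> j y = 0" using elim(1) by blast
    qed
  qed
  have comp: "emeasure \<mu> (closure J \<times> {i}) = 0" if i: "i \<in> {1..N}" for i
  proof -
    have "emeasure \<mu> (closure J \<times> {i}) = emeasure (component \<mu> i) (closure J)"
      using i by (simp add: emeasure_component borel_closed)
    also have "\<dots> = (\<integral>\<^sup>+x. ennreal (\<rho> i x) * indicator (closure J) x \<partial>lborel)"
      unfolding component_eq[OF i] using i by (intro emeasure_density) (auto simp: borel_closed)
    also have "\<dots> = (\<integral>\<^sup>+(x::real). 0 \<partial>lborel)"
      using van by (intro nn_integral_cong_AE, eventually_elim) (use i in \<open>auto simp: indicator_def\<close>)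
    finally show ?thesis by simp
  qed
  have sets: "closure J \<times> {i} \<in> sets \<mu>" if "i \<in> {1..N}" for i
    using that by (simp add: sets_mu borel_closed)
  have "emeasure \<mu> (J \<times> {1..N}) \<le> emeasure \<mu> (\<Union>i\<in>{1..N}. closure J \<times> {i})"
    using sets closure_subset by (intro emeasure_mono sets.finite_UN) auto
  also have "\<dots> \<le> (\<Sum>i\<in>{1..N}. emeasure \<mu> (closure J \<times> {i}))"
    using sets by (intro emeasure_subadditive_finite) auto
  also have "\<dots> = 0" using comp by simp
  finally show ?thesis by simp
qed

lemma positive_mass_not_singleton:
  assumes J: "emeasure \<mu> (J \<times> {1..N}) > 0"
  obtains y where "y \<in> J" "y \<noteq> x"
proof (rule ccontr)
  assume "\<not> thesis"
  hence "J \<subseteq> {x}" using that by blast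
  have sets: "{x} \<times> {i} \<in> sets \<mu>" if "i \<in> {1..N}" for i
    unfolding sets_mu by (rule pair_measureI) (use that in auto)
  have "emeasure \<mu> (J \<times> {1..N}) \<le> emeasure \<mu> (\<Union>i\<in>{1..N}. {x} \<times> {i})"
    using sets \<open>J \<subseteq> {x}\<close> by (intro emeasure_mono sets.finite_UN) auto
  also have "\<dots> \<le> (\<Sum>i\<in>{1..N}. emeasure \<mu> ({x} \<times> {i}))"
    using sets by (intro emeasure_subadditive_finite) auto
  also have "\<dots> = 0"
  proof (rule sum.neutral, rule ballI)
    fix i assume i: "i \<in> {1..N}"
    have "AE y in component \<mu> i. y \<noteq> x" by (rule AE_component[OF i AE_lborel_singleton])
    hence "{x} \<in> null_sets (component \<mu> i)" by (subst AE_iff_null_sets) auto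
    hence "emeasure (component \<mu> i) {x} = 0" by (simp add: null_sets_def)
    thus "emeasure \<mu> ({x} \<times> {i}) = 0" by (subst emeasure_component[OF i, symmetric]) auto
  qed
  finally show False using J by simp
qed

lemma case_B_minimal_set:
  assumes "case_B N u \<mu>"
  obtains J where "minimal_invariant_set N u J" "emeasure \<mu> (J \<times> {1..N}) > 0" "0 \<in> interior J"
proof -
  obtain J where J: "minimal_invariant_set N u J" "emeasure \<mu> (J \<times> {1..N}) > 0" "0 \<in> interior (closure J)"
    using assms by (auto simp: case_B_def support_intervals_def)
  have "interior (closure J) = interior J"
    by (rule convex_interior_closure[OF minimal_invariant_set_convex[OF complete J(1)]])
  thus thesis using J that by auto
qed

lemma densities_do_not_vanish_right_of_zero:
  assumes "case_B N u \<mu> \<or> case_C N u \<mu>" and "\<epsilon> > 0"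
  shows "\<not> (AE x in lborel. x \<in> {0<..<\<epsilon>} \<longrightarrow> (\<forall>j\<in>{1..N}. \<rho> j x = 0))"
proof
  assume van: "AE x in lborel. x \<in> {0<..<\<epsilon>} \<longrightarrow> (\<forall>j\<in>{1..N}. \<rho> j x = 0)"
  obtain J y where J: "minimal_invariant_set N u J" "emeasure \<mu> (J \<times> {1..N}) > 0"
    and y: "y > 0" "{0<..<y} \<subseteq> J"
  proof (cases "case_B N u \<mu>")
    case True
    then obtain J where J: "minimal_invariant_set N u J" "emeasure \<mu> (J \<times> {1..N}) > 0" "0 \<in> interior J"
      by (rule case_B_minimal_set)
    then obtain e where e: "e > 0" "ball 0 e \<subseteq> J" by (auto simp: mem_interior)
    moreover have "{0<..<e} \<subseteq> ball 0 e" by (auto simp: dist_real_def)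
    ultimately show thesis using J that by blast
  next
    case False
    then obtain J where J: "minimal_invariant_set N u J" "emeasure \<mu> (J \<times> {1..N}) > 0"
      "0 \<in> closure J" "\<And>x. x \<in> closure J \<Longrightarrow> 0 \<le> x"
      using assms by (auto simp: case_C_def support_intervals_def)
    obtain y where y: "y \<in> J" "y \<noteq> 0" using positive_mass_not_singleton[OF J(2)] by blast
    hence "y > 0" using J(4)[of y] closure_subset by force
    moreover have "{0<..<y} \<subseteq> J"
    proof
      fix x assume x: "x \<in> {0<..<y}"
      then obtain z where z: "z \<in> J" "dist z 0 < x"
        using J(3) unfolding closure_approachable by auto
      have "z \<le> x" "x \<le> y" using z x by (auto simp: dist_real_def)
      thus "x \<in> J"
        using minimal_invariant_set_convex[OF complete J(1)] z(1) y(1)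
        by (metis mem_is_interval_1_I is_interval_convex_1)
    qed
    ultimately show thesis using J that by blast
  qed
  have "emeasure \<mu> (J \<times> {1..N}) = 0"
  proof (rule minimal_set_null_if_densities_vanish[OF J(1)])
    show "0 < min y \<epsilon>" using y assms by simp
    show "{0<..<min y \<epsilon>} \<subseteq> J" using y by auto
    show "AE x in lborel. x \<in> {0<..<min y \<epsilon>} \<longrightarrow> (\<forall>j\<in>{1..N}. \<rho> j x = 0)"
      using van by eventually_elim auto
  qed
  thus False using J by simp
qed

end

section \<open>A linear equation with a singular point\<close>

text \<open>In this section \<open>v' = s v - h\<close>, where \<open>s\<close> differs from \<open>p / x\<close> by at most \<open>K\<close>. The
  homogeneous equation with \<open>s = p / x\<close> has the solution \<open>x powr p\<close>, and the exponential factors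
  absorb the bounded error. Here \<open>x powr (- p) * exp (- K * x)\<close> is the integrating factor for the
  largest admissible \<open>s\<close>, and the inhomogeneity has the favourable sign.\<close>

lemma singular_ode_lower:
  fixes v s h :: "real \<Rightarrow> real"
  assumes deriv: "\<And>x. x \<in> {0<..<\<epsilon>} \<Longrightarrow> (v has_real_derivative (s x * v x - h x)) (at x)"
    and v: "\<And>x. x \<in> {0<..<\<epsilon>} \<Longrightarrow> 0 \<le> v x" and h: "\<And>x. x \<in> {0<..<\<epsilon>} \<Longrightarrow> 0 \<le> h x"
    and s: "\<And>x. x \<in> {0<..<\<epsilon>} \<Longrightarrow> s x \<le> p / x + K"
    and xy: "0 < x" "x \<le> y" "y < \<epsilon>"
  shows "v y * y powr (- p) * exp (- K * y) \<le> v x * x powr (- p) * exp (- K * x)"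
proof (rule DERIV_nonpos_imp_nonincreasing[OF xy(2)])
  fix z assume "x \<le> z" "z \<le> y"
  hence z: "z \<in> {0<..<\<epsilon>}" using xy by auto
  hence z0: "z > 0" by simp
  define D where "D = (s z * v z - h z) * z powr (- p) * exp (- K * z)
      + v z * (- p * z powr (- p - 1)) * exp (- K * z) + v z * z powr (- p) * (- K * exp (- K * z))"
  have "((\<lambda>x. v x * x powr (- p) * exp (- K * x)) has_real_derivative D) (at z)"
    unfolding D_def
    by (rule derivative_eq_intros deriv[OF z] has_real_derivative_powr[OF z0] refl)+
       (simp add: algebra_simps)
  moreover have "D = z powr (- p) * exp (- K * z) * ((s z - p / z - K) * v z - h z)"
    using z0 by (simp add: D_def powr_diff algebra_simps)
  moreover have "(s z - p / z - K) * v z - h z \<le> 0"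
    using mult_nonpos_nonneg[OF _ v[OF z], of "s z - p / z - K"] s[OF z] h[OF z] by linarith
  ultimately show "\<exists>D. ((\<lambda>x. v x * x powr (- p) * exp (- K * x)) has_real_derivative D) (at z) \<and> D \<le> 0"
    by (auto intro!: mult_nonneg_nonpos)
qed

text \<open>After multiplication with the integrating factor \<open>x powr (- p)\<close> the bounded inhomogeneity
  contributes at most the integral of a multiple of \<open>t powr (- p)\<close> over \<open>t \<ge> x\<close>, which is of the order
  \<open>x powr (1 - p)\<close> for \<open>p > 1\<close>. Multiplying back by \<open>x powr p\<close> gives a linear term, which dominates
  the solution \<open>x powr p\<close> of the homogeneous equation.\<close>

lemma singular_ode_upper:
  fixes v s h :: "real \<Rightarrow> real"
  assumes deriv: "\<And>x. x \<in> {0<..<\<epsilon>} \<Longrightarrow> (v has_real_derivative (s x * v x - h x)) (at x)"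
    and v: "\<And>x. x \<in> {0<..<\<epsilon>} \<Longrightarrow> 0 \<le> v x"
    and h: "\<And>x. x \<in> {0<..<\<epsilon>} \<Longrightarrow> 0 \<le> h x" "\<And>x. x \<in> {0<..<\<epsilon>} \<Longrightarrow> h x \<le> H"
    and s: "\<And>x. x \<in> {0<..<\<epsilon>} \<Longrightarrow> p / x - K \<le> s x"
    and p: "p > 1" and K: "K \<ge> 0" and \<delta>: "0 < \<delta>" "\<delta> < \<epsilon>" "\<delta> \<le> 1"
  obtains C where "\<And>x. 0 < x \<Longrightarrow> x \<le> \<delta> \<Longrightarrow> v x \<le> C * x"
proof -
  have H: "H \<ge> 0" using h[of \<delta>] \<delta> by auto
  define G where "G = H * exp (K * \<epsilon>)"
  have G: "G \<ge> 0" using H by (simp add: G_def)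
  define Q where "Q x = v x * x powr (- p) * exp (K * x) + G / (1 - p) * x powr (1 - p)" for x
  have mono: "Q x \<le> Q \<delta>" if x: "0 < x" "x \<le> \<delta>" for x
  proof (rule DERIV_nonneg_imp_nondecreasing[OF x(2)])
    fix z assume "x \<le> z" "z \<le> \<delta>"
    hence z: "z \<in> {0<..<\<epsilon>}" using x \<delta> by auto
    hence z0: "z > 0" by simp
    define D where "D = (s z * v z - h z) * z powr (- p) * exp (K * z)
      + v z * (- p * z powr (- p - 1)) * exp (K * z) + v z * z powr (- p) * (K * exp (K * z))
      + G / (1 - p) * ((1 - p) * z powr (1 - p - 1))"
    have "(Q has_real_derivative D) (at z)"
      unfolding D_def Q_def[abs_def]
      by (rule derivative_eq_intros deriv[OF z] has_real_derivative_powr[OF z0] refl)+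
         (simp add: algebra_simps)
    moreover have pow: "G / (1 - p) * ((1 - p) * z powr (1 - p - 1)) = G * z powr (- p)" using p by simp
    have "D = z powr (- p) * (exp (K * z) * ((s z - p / z + K) * v z) + (G - h z * exp (K * z)))"
      unfolding D_def pow using z0 by (simp add: powr_diff algebra_simps)
    moreover have "h z * exp (K * z) \<le> G"
      unfolding G_def using h[OF z] z K by (intro mult_mono) (auto intro: mult_left_mono)
    moreover have "0 \<le> (s z - p / z + K) * v z"
      using s[OF z] v[OF z] by (intro mult_nonneg_nonneg) auto
    ultimately show "\<exists>D. (Q has_real_derivative D) (at z) \<and> 0 \<le> D"
      by (auto intro!: mult_nonneg_nonneg add_nonneg_nonneg)
  qed
  have "v x \<le> (\<bar>Q \<delta>\<bar> + G / (p - 1)) * x" if x: "0 < x" "x \<le> \<delta>" for x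
  proof -
    have "G / (1 - p) = - (G / (p - 1))" by (metis minus_diff_eq minus_divide_right)
    hence "v x * x powr (- p) * exp (K * x) \<le> \<bar>Q \<delta>\<bar> + G / (p - 1) * x powr (1 - p)"
      using mono[OF x] by (simp add: Q_def)
    moreover have "v x * x powr (- p) * 1 \<le> v x * x powr (- p) * exp (K * x)"
      using x \<delta> v[of x] K by (intro mult_left_mono) auto
    ultimately have "v x * x powr (- p) \<le> \<bar>Q \<delta>\<bar> + G / (p - 1) * x powr (1 - p)" by simp
    hence "v x * x powr (- p) * x powr p \<le> (\<bar>Q \<delta>\<bar> + G / (p - 1) * x powr (1 - p)) * x powr p"
      by (rule mult_right_mono) simp
    moreover have "x powr (- p) * x powr p = 1" "x powr (1 - p) * x powr p = x"
      using x by (simp_all flip: powr_add)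
    ultimately have "v x \<le> \<bar>Q \<delta>\<bar> * x powr p + G / (p - 1) * x"
      by (simp add: distrib_right mult.assoc)
    moreover have "x powr p \<le> x" using powr_mono'[of 1 p x] x \<delta> p by simp
    hence "\<bar>Q \<delta>\<bar> * x powr p \<le> \<bar>Q \<delta>\<bar> * x" by (intro mult_left_mono) auto
    ultimately show ?thesis by (simp add: distrib_right)
  qed
  thus thesis using that by blast
qed

text \<open>For \<open>p = 1\<close> an inhomogeneity bounded away from zero produces a logarithm.\<close>

lemma singular_ode_critical:
  fixes v s h :: "real \<Rightarrow> real"
  assumes deriv: "\<And>x. x \<in> {0<..<\<epsilon>} \<Longrightarrow> (v has_real_derivative (s x * v x - h x)) (at x)"
    and v: "\<And>x. x \<in> {0<..<\<epsilon>} \<Longrightarrow> 0 \<le> v x"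
    and h: "\<And>x. x \<in> {0<..<\<epsilon>} \<Longrightarrow> h0 \<le> h x" "h0 > 0"
    and s: "\<And>x. x \<in> {0<..<\<epsilon>} \<Longrightarrow> s x \<le> 1 / x + K"
    and K: "K \<ge> 0" and \<delta>: "0 < \<delta>" "\<delta> < \<epsilon>"
  obtains c b where "c > 0" "\<And>x. 0 < x \<Longrightarrow> x \<le> \<delta> \<Longrightarrow> b - c * ln x \<le> v x / x"
proof -
  define c where "c = h0 * exp (- K * \<epsilon>)"
  have c: "c > 0" using h by (simp add: c_def)
  define Q where "Q x = v x * (1 / x) * exp (- K * x) + c * ln x" for x
  have mono: "Q \<delta> \<le> Q x" if x: "0 < x" "x \<le> \<delta>" for x
  proof (rule DERIV_nonpos_imp_nonincreasing[OF x(2)])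
    fix z assume "x \<le> z" "z \<le> \<delta>"
    hence z: "z \<in> {0<..<\<epsilon>}" using x \<delta> by auto
    hence z0: "z > 0" by simp
    define D where "D = (s z * v z - h z) * (1 / z) * exp (- K * z)
      + v z * (- 1 / z ^ 2) * exp (- K * z) + v z * (1 / z) * (- K * exp (- K * z)) + c * (1 / z)"
    have "(Q has_real_derivative D) (at z)"
      unfolding D_def Q_def[abs_def]
      by (rule derivative_eq_intros deriv[OF z] refl | use z0 in force)+
         (use z0 in \<open>simp add: field_simps power2_eq_square\<close>)
    moreover have "D = 1 / z * (exp (- K * z) * ((s z - 1 / z - K) * v z) + (c - h z * exp (- K * z)))"
      using z0 by (simp add: D_def field_simps power2_eq_square)
    moreover have "c \<le> h z * exp (- K * z)"
      unfolding c_def using h(1)[OF z] h(2) z K by (intro mult_mono) (auto intro: mult_left_mono)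
    moreover have "(s z - 1 / z - K) * v z \<le> 0"
      using s[OF z] v[OF z] by (intro mult_nonpos_nonneg) auto
    ultimately show "\<exists>D. (Q has_real_derivative D) (at z) \<and> D \<le> 0"
      using z0 by (auto intro!: divide_nonpos_pos add_nonpos_nonpos mult_nonneg_nonpos)
  qed
  have "Q \<delta> - c * ln x \<le> v x / x" if x: "0 < x" "x \<le> \<delta>" for x
  proof -
    have "v x * (1 / x) * exp (- K * x) \<le> v x * (1 / x) * 1"
      using x v[of x] \<delta> K by (intro mult_left_mono) auto
    thus ?thesis using mono[OF x] by (simp add: Q_def)
  qed
  with c show thesis using that by blast
qed

section \<open>The density near the critical point\<close>

text \<open>The flux is known through integrals over open intervals of a function that is defined up to
  null sets; a continuous version of that function turns this into a classical derivative.\<close>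

lemma has_real_derivative_if_interval_integrals:
  fixes F k :: "real \<Rightarrow> real"
  assumes k: "continuous_on {0<..<\<epsilon>} k" and z: "z \<in> {0<..<\<epsilon>}"
    and F: "\<And>x y. 0 < x \<Longrightarrow> x \<le> y \<Longrightarrow> y < \<epsilon> \<Longrightarrow> F y - F x = (LINT t:{x<..<y}|lborel. k t)"
  shows "(F has_real_derivative k z) (at z)"
proof -
  define a where "a = z / 2"
  define b where "b = (z + \<epsilon>) / 2"
  have ab: "0 < a" "a < z" "z < b" "b < \<epsilon>" using z by (auto simp: a_def b_def)
  have kc: "continuous_on {a..b} k" by (rule continuous_on_subset[OF k]) (use ab in auto)
  have "((\<lambda>x. integral {a..x} k) has_real_derivative k z) (at z within {a..b})"
    by (rule integral_has_real_derivative[OF kc]) (use ab in auto)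
  hence "((\<lambda>x. integral {a..x} k) has_real_derivative k z) (at z)"
    using ab by (subst (asm) at_within_interior) (auto simp: interior_cbox)
  hence d: "((\<lambda>x. F a + integral {a..x} k) has_real_derivative k z) (at z)"
    by (auto intro!: derivative_eq_intros)
  have eq: "F x = F a + integral {a..x} k" if "x \<in> {a<..<b}" for x
  proof -
    have "set_integrable lborel {a..x} k"
      by (rule borel_integrable_atLeastAtMost'[OF continuous_on_subset[OF kc]]) (use that in auto)
    hence "set_integrable lborel {a<..<x} k" by (rule set_integrable_subset) auto
    hence "(LINT t:{a<..<x}|lborel. k t) = integral {a<..<x} k"
      by (rule set_borel_integral_eq_integral(2))
    also have "\<dots> = integral {a..x} k" using integral_open_interval[of a x k] by simp
    finally show ?thesis using F[of a x] that ab by simp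
  qed
  have "\<forall>\<^sub>F x in nhds z. F x = F a + integral {a..x} k"
    using eventually_nhds_in_open[of "{a<..<b}" z] ab by (auto elim!: eventually_mono simp: eq)
  with d show ?thesis by (subst DERIV_cong_ev[OF refl _ refl])
qed


lemma nhds_eventually_interval_right:
  fixes x :: real
  assumes "\<forall>\<^sub>F y in nhds x. P y"
  obtains d where "d > 0" "\<And>y. y \<in> {x - d<..<x + d} \<Longrightarrow> P y"
  using assms unfolding eventually_nhds_metric dist_real_def
  by (smt (verit) greaterThanLessThan_iff)

locale attracting_critical_point = stationary_switching +
  fixes a :: real
  assumes critical: "u 1 0 = 0"
    and noncritical: "\<And>i. i \<in> {1..N} - {1} \<Longrightarrow> u i 0 \<noteq> 0"
    and attracting: "a > 0"
    and linearization: "(\<lambda>\<eta>. u 1 \<eta> - (- a * \<eta>)) \<in> O[at_right 0](\<lambda>\<eta>. \<eta>\<^sup>2)"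
begin

text \<open>The rate at which mass enters the state 1, expressed by the representatives \<open>flux j / u j\<close> of the
  densities, which are continuous near \<open>0\<close>.\<close>

definition inflow :: "real \<Rightarrow> real" where
  "inflow x = (\<Sum>j\<in>{1..N} - {1}. lam j 1 * (flux j x / u j x))"

lemma one_state: "1 \<in> {1..N}"
  using two_states by simp

lemma inflow_nonneg: "0 \<le> inflow x"
  unfolding inflow_def
proof (intro sum_nonneg mult_nonneg_nonneg)
  fix j assume j: "j \<in> {1..N} - {1}"
  show "0 \<le> lam j 1" using rate_pos[of j 1] j one_state by (auto simp: less_imp_le)
  show "0 \<le> flux j x / u j x"
    using flux_times_field_nonneg[of j x] j by (auto simp: zero_le_divide_iff zero_le_mult_iff)
qed

text \<open>Near \<open>0\<close> all densities except \<open>\<rho>\<^sub>1\<close> have continuous representatives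
  \<open>flux j / u j\<close>, hence to the right of \<open>0\<close> \<open>v = - flux 1\<close> solves \<open>v' = (rate 1 / \<bar>u 1\<bar>) v - inflow\<close>, where
  \<open>rate 1 / \<bar>u 1 x\<bar> = (rate 1 / a) / x + O(1)\<close>.\<close>

lemma flux_near_critical_point:
  obtains \<epsilon> K H where "\<epsilon> > 0" "K \<ge> 0"
    "\<And>x. x \<in> {0<..<\<epsilon>} \<Longrightarrow> a * x / 2 \<le> - u 1 x \<and> - u 1 x \<le> 2 * a * x"
    "\<And>x. x \<in> {0<..<\<epsilon>} \<Longrightarrow> ((\<lambda>x. - flux 1 x) has_real_derivative
      (rate 1 / - u 1 x * - flux 1 x - inflow x)) (at x)"
    "\<And>x. x \<in> {0<..<\<epsilon>} \<Longrightarrow> 0 \<le> - flux 1 x"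
    "\<And>x. x \<in> {0<..<\<epsilon>} \<Longrightarrow> \<bar>rate 1 / - u 1 x - (rate 1 / a) / x\<bar> \<le> K"
    "\<And>x. x \<in> {0<..<\<epsilon>} \<Longrightarrow> inflow x \<le> H"
    "isCont inflow 0"
    "\<And>x j. x \<in> {0<..<\<epsilon>} \<Longrightarrow> j \<in> {1..N} \<Longrightarrow> u j x \<noteq> 0"
proof -
  obtain C where "C > 0" "\<forall>\<^sub>F x in at_right 0. norm (u 1 x - (- a * x)) \<le> C * norm (x\<^sup>2)"
    using linearization by (elim landau_o.bigE)
  then obtain b where C: "C > 0" and b: "b > 0" "\<And>x. 0 < x \<Longrightarrow> x < b \<Longrightarrow> \<bar>u 1 x + a * x\<bar> \<le> C * x\<^sup>2"
    by (auto simp: eventually_at_right_field)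
  have uc: "isCont (u j) x" if "j \<in> {1..N}" for j x
    using continuous_field[OF that] by (simp add: continuous_on_eq_continuous_at)
  have fc: "isCont (flux j) x" if "j \<in> {1..N}" for j x
    using flux_continuous[OF that] by (simp add: continuous_on_eq_continuous_at)
  have "\<forall>\<^sub>F x in nhds 0. u j x \<noteq> 0" if j: "j \<in> {1..N} - {1}" for j
    using uc[of j 0] noncritical[OF j] j
    by (intro tendsto_imp_eventually_ne[of "u j" "u j 0"])
       (auto simp: isCont_def tendsto_at_iff_tendsto_nhds)
  hence "\<forall>\<^sub>F x in nhds 0. \<forall>j\<in>{1..N} - {1}. u j x \<noteq> 0" by (intro eventually_ball_finite) auto
  then obtain d where d: "d > 0" "\<And>x j. x \<in> {0 - d<..<0 + d} \<Longrightarrow> j \<in> {1..N} - {1} \<Longrightarrow> u j x \<noteq> 0"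
    by (rule nhds_eventually_interval_right) blast
  have inflow_cont: "continuous_on {- d<..<d} inflow"
    unfolding inflow_def
    by (intro continuous_intros continuous_on_subset[OF continuous_field]
        continuous_on_subset[OF flux_continuous]) (use d(2) in auto)
  define \<epsilon> where "\<epsilon> = min (min b (d / 2)) (a / (2 * C))"
  have "C * \<epsilon> \<le> C * (a / (2 * C))" using C by (intro mult_left_mono) (auto simp: \<epsilon>_def)
  hence \<epsilon>: "\<epsilon> > 0" "\<epsilon> \<le> b" "\<epsilon> < d" "C * \<epsilon> \<le> a / 2"
    using b(1) d(1) C attracting by (auto simp: \<epsilon>_def)
  have u1: "a * x / 2 \<le> - u 1 x \<and> - u 1 x \<le> 2 * a * x" if x: "x \<in> {0<..<\<epsilon>}" for x
  proof -
    have "C * x\<^sup>2 = (C * x) * x" by (simp add: power2_eq_square)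
    also have "\<dots> \<le> a / 2 * x"
    proof (rule mult_right_mono)
      have "C * x \<le> C * \<epsilon>" using x C by (intro mult_left_mono) auto
      thus "C * x \<le> a / 2" using \<epsilon> by simp
    qed (use x in auto)
    finally have "\<bar>u 1 x + a * x\<bar> \<le> a / 2 * x" using b(2)[of x] x \<epsilon> by auto
    moreover have "0 < a * x" using attracting x by simp
    moreover have "a / 2 * x = a * x / 2" "2 * a * x = 2 * (a * x)" by simp_all
    ultimately show ?thesis by (intro conjI) linarith+
  qed
  have u1neg: "u 1 x < 0" if x: "x \<in> {0<..<\<epsilon>}" for x
  proof -
    have "0 < a * x" using attracting x by simp
    thus ?thesis using u1[OF x] by linarith
  qed
  define k where "k x = inflow x - rate 1 * (flux 1 x / u 1 x)" for x
  have kc: "continuous_on {0<..<\<epsilon>} k"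
    unfolding k_def
    by (intro continuous_intros continuous_on_subset[OF inflow_cont]
        continuous_on_subset[OF continuous_field[OF one_state]] continuous_on_subset[OF flux_continuous[OF one_state]])
       (use \<epsilon> u1neg in force)+
  have u_ne: "u j x \<noteq> 0" if "x \<in> {0<..<\<epsilon>}" "j \<in> {1..N}" for x j
    using that u1neg[OF that(1)] d(2)[of x j] \<epsilon> by (cases "j = 1") auto
  have "AE x in lborel. \<forall>j\<in>{1..N}. flux j x = u j x * \<rho> j x"
    using flux_eq by (intro AE_finite_allI) auto
  hence src: "AE x in lborel. x \<in> {0<..<\<epsilon>} \<longrightarrow> source 1 x = k x"
  proof eventually_elim
    case (elim x)
    show ?case
    proof
      assume x: "x \<in> {0<..<\<epsilon>}"
      have "flux j x / u j x = \<rho> j x" if "j \<in> {1..N}" for j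
        using elim that u_ne[OF x that] by simp
      thus "source 1 x = k x" using one_state by (simp add: source_def k_def inflow_def)
    qed
  qed
  have der: "(flux 1 has_real_derivative k x) (at x)" if x: "x \<in> {0<..<\<epsilon>}" for x
  proof (rule has_real_derivative_if_interval_integrals[OF kc x])
    fix p q :: real assume pq: "0 < p" "p \<le> q" "q < \<epsilon>"
    have "continuous_on {p..q} k" by (rule continuous_on_subset[OF kc]) (use pq in auto)
    hence "set_integrable lborel {p<..<q} k"
      by (intro set_integrable_subset[OF borel_integrable_atLeastAtMost']) auto
    hence m: "(\<lambda>t. indicator {p<..<q} t *\<^sub>R k t) \<in> borel_measurable lborel"
      by (simp add: set_integrable_def)
    have "flux 1 q - flux 1 p = (LINT t:{p<..<q}|lborel. source 1 t)"
      by (rule flux_diff[OF one_state pq(2)])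
    also have "\<dots> = (LINT t:{p<..<q}|lborel. k t)"
      unfolding set_lebesgue_integral_def
    proof (rule integral_cong_AE)
      show "AE t in lborel. indicator {p<..<q} t *\<^sub>R source 1 t = indicator {p<..<q} t *\<^sub>R k t"
        using src by eventually_elim (use pq in \<open>auto simp: indicator_def\<close>)
    qed (use m source_integrable[OF one_state] in auto)
    finally show "flux 1 q - flux 1 p = (LINT t:{p<..<q}|lborel. k t)" .
  qed
  have der': "((\<lambda>x. - flux 1 x) has_real_derivative (rate 1 / - u 1 x * - flux 1 x - inflow x)) (at x)"
    if x: "x \<in> {0<..<\<epsilon>}" for x
  proof -
    have "((\<lambda>x. - flux 1 x) has_real_derivative - k x) (at x)"
      by (rule DERIV_minus[OF der[OF x]])
    thus ?thesis by (simp add: k_def)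
  qed
  have fneg: "0 \<le> - flux 1 x" if x: "x \<in> {0<..<\<epsilon>}" for x
    using flux_times_field_nonneg[OF one_state, of x] u1neg[OF x] by (auto simp: zero_le_mult_iff)
  have rb: "\<bar>rate 1 / - u 1 x - (rate 1 / a) / x\<bar> \<le> 2 * rate 1 * C / a\<^sup>2" if x: "x \<in> {0<..<\<epsilon>}" for x
  proof -
    define w where "w = - u 1 x"
    have w: "a * x / 2 \<le> w" "w > 0" using u1[OF x] u1neg[OF x] by (auto simp: w_def)
    have x0: "x > 0" using x by simp
    have "rate 1 / w - (rate 1 / a) / x = rate 1 * (a * x - w) / (w * (a * x))"
      using w x0 attracting by (simp add: field_simps)
    hence "\<bar>rate 1 / w - (rate 1 / a) / x\<bar> = rate 1 * \<bar>a * x - w\<bar> / (w * (a * x))"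
      using w x0 attracting exit_rate_pos[OF one_state] by (simp add: abs_mult)
    also have "\<dots> \<le> rate 1 * (C * x\<^sup>2) / (a * x / 2 * (a * x))"
    proof (rule frac_le)
      show "rate 1 * \<bar>a * x - w\<bar> \<le> rate 1 * (C * x\<^sup>2)"
        using b(2)[of x] x \<epsilon> exit_rate_pos[OF one_state]
        by (intro mult_left_mono) (auto simp: w_def add.commute)
      show "0 \<le> rate 1 * (C * x\<^sup>2)" using exit_rate_pos[OF one_state] C by simp
      show "0 < a * x / 2 * (a * x)" using attracting x0 by simp
      show "a * x / 2 * (a * x) \<le> w * (a * x)" using w attracting x0 by (intro mult_right_mono) auto
    qed
    also have "\<dots> = 2 * rate 1 * C / a\<^sup>2" using x0 attracting by (simp add: field_simps power2_eq_square)
    finally show ?thesis by (simp add: w_def)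
  qed
  have "bounded (inflow ` {0..\<epsilon>})"
    by (intro compact_imp_bounded compact_continuous_image continuous_on_subset[OF inflow_cont])
       (use \<epsilon> in auto)
  then obtain H where "\<forall>y\<in>inflow ` {0..\<epsilon>}. norm y \<le> H" unfolding bounded_iff by blast
  hence H: "\<bar>inflow x\<bar> \<le> H" if "x \<in> {0..\<epsilon>}" for x using that by auto
  have Hb: "inflow x \<le> H" if "x \<in> {0<..<\<epsilon>}" for x using H[of x] that by auto
  have ic: "isCont inflow 0"
    using inflow_cont d(1) by (simp add: continuous_on_eq_continuous_at)
  have K0: "0 \<le> 2 * rate 1 * C / a\<^sup>2" using exit_rate_pos[OF one_state] C by simp
  show thesis by (rule that[OF \<epsilon>(1) K0 u1 der' fneg rb Hb ic u_ne])
qed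

text \<open>Since \<open>flux 1 = u 1 * \<rho> 1\<close> and \<open>u 1\<close> vanishes linearly, a bounded density means that the flux is
  at most linear. The almost everywhere bound holds at every point by continuity.\<close>

lemma bounded_imp_flux_linear:
  assumes "bounded_right_of_zero (\<rho> 1)"
  obtains \<epsilon> M where "\<epsilon> > 0" "\<And>x. x \<in> {0<..<\<epsilon>} \<Longrightarrow> - flux 1 x \<le> M * x"
proof -
  obtain \<epsilon> where \<epsilon>: "\<epsilon> > 0"
    "\<And>x. x \<in> {0<..<\<epsilon>} \<Longrightarrow> a * x / 2 \<le> - u 1 x \<and> - u 1 x \<le> 2 * a * x"
    by (rule flux_near_critical_point) blast
  obtain g e where g: "AE x in lborel. g x = \<rho> 1 x" "e > 0" "bounded (g ` {0<..<e})"
    using assms by (auto simp: bounded_right_of_zero_def)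
  then obtain M where "\<forall>y\<in>g ` {0<..<e}. norm y \<le> M" unfolding bounded_iff by blast
  hence M: "\<bar>g x\<bar> \<le> M" if "x \<in> {0<..<e}" for x using that by auto
  have M0: "M \<ge> 0" using M[of "e / 2"] g(2) by auto
  define r where "r = min e \<epsilon>"
  have key: "0 \<le> M * (2 * a * x) - - flux 1 x" if x: "x \<in> {0<..<r}" for x
  proof (rule continuous_nonneg_if_AE[where f = "\<lambda>x. M * (2 * a * x) - - flux 1 x", OF _ _ x])
    show "continuous_on {0<..<r} (\<lambda>x. M * (2 * a * x) - - flux 1 x)"
      by (intro continuous_intros continuous_on_subset[OF flux_continuous[OF one_state]]) auto
    show "AE y in lborel. y \<in> {0<..<r} \<longrightarrow> 0 \<le> M * (2 * a * y) - - flux 1 y"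
      using g(1) flux_eq[OF one_state]
    proof eventually_elim
      case (elim y)
      show ?case
      proof
        assume y: "y \<in> {0<..<r}"
        have "a * y > 0" using attracting y by simp
        hence u: "0 \<le> - u 1 y" "- u 1 y \<le> 2 * a * y" using \<epsilon>(2)[of y] y by (auto simp: r_def)
        have "\<rho> 1 y \<le> M" using M[of y] y elim by (auto simp: r_def)
        hence "- u 1 y * \<rho> 1 y \<le> - u 1 y * M" using u by (intro mult_left_mono)
        also have "\<dots> \<le> 2 * a * y * M" using u M0 by (intro mult_right_mono)
        finally show "0 \<le> M * (2 * a * y) - - flux 1 y" using elim by (simp add: mult_ac)
      qed
    qed
  qed
  have "- flux 1 x \<le> M * (2 * a) * x" if "x \<in> {0<..<r}" for x
    using key[OF that] by (simp add: mult.assoc)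
  moreover have "r > 0" using \<epsilon>(1) g(2) by (simp add: r_def)
  ultimately show thesis using that by blast
qed

text \<open>If the flux in the state 1 vanished near \<open>0\<close>, its equation would force the inflow to vanish, and
  with it all other densities.\<close>

lemma flux_not_zero_right_of_zero:
  assumes support: "case_B N u \<mu> \<or> case_C N u \<mu>" and "e > 0"
  obtains x where "0 < x" "x < e" "- flux 1 x > 0"
proof (rule ccontr)
  assume "\<not> thesis"
  hence no: "\<not> (0 < x \<and> x < e \<and> - flux 1 x > 0)" for x using that by blast
  obtain \<epsilon> where \<epsilon>: "\<epsilon> > 0"
    "\<And>x. x \<in> {0<..<\<epsilon>} \<Longrightarrow> ((\<lambda>x. - flux 1 x) has_real_derivative
      (rate 1 / - u 1 x * - flux 1 x - inflow x)) (at x)"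
    "\<And>x. x \<in> {0<..<\<epsilon>} \<Longrightarrow> 0 \<le> - flux 1 x"
    "\<And>x j. x \<in> {0<..<\<epsilon>} \<Longrightarrow> j \<in> {1..N} \<Longrightarrow> u j x \<noteq> 0"
    by (rule flux_near_critical_point) blast
  define r where "r = min e \<epsilon>"
  have r: "r > 0" using \<epsilon>(1) assms by (simp add: r_def)
  have z1: "flux 1 x = 0" if "x \<in> {0<..<r}" for x
    using no[of x] \<epsilon>(3)[of x] that by (force simp: r_def)
  have in0: "inflow x = 0" if x: "x \<in> {0<..<r}" for x
  proof -
    have "\<forall>\<^sub>F y in nhds x. - flux 1 y = 0"
      using eventually_nhds_in_open[of "{0<..<r}" x] x by (auto elim!: eventually_mono simp: z1)
    hence "((\<lambda>x. - flux 1 x) has_real_derivative 0) (at x)"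
      by (subst DERIV_cong_ev[OF refl _ refl, where g = "\<lambda>_. 0"]) auto
    moreover have "((\<lambda>x. - flux 1 x) has_real_derivative (rate 1 / - u 1 x * - flux 1 x - inflow x)) (at x)"
      using \<epsilon>(2) x by (simp add: r_def)
    ultimately have "rate 1 / - u 1 x * - flux 1 x - inflow x = 0" by (blast intro: DERIV_unique)
    thus ?thesis using z1[OF x] by simp
  qed
  have z: "flux j x = 0" if x: "x \<in> {0<..<r}" and j: "j \<in> {1..N}" for x j
  proof (cases "j = 1")
    case False
    have "0 \<le> lam k 1 * (flux k x / u k x)" if "k \<in> {1..N} - {1}" for k
      using flux_times_field_nonneg[of k x] rate_pos[of k 1] that one_state
      by (intro mult_nonneg_nonneg) (auto simp: zero_le_divide_iff zero_le_mult_iff less_imp_le)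
    hence "lam j 1 * (flux j x / u j x) = 0"
      using in0[OF x] j False unfolding inflow_def
      by (subst (asm) sum_nonneg_eq_0_iff) auto
    thus ?thesis using rate_pos[OF j one_state False] \<epsilon>(4)[of x j] x j by (auto simp: r_def)
  qed (use z1 x in simp)
  have "AE x in lborel. \<forall>j\<in>{1..N}. flux j x = u j x * \<rho> j x"
    using flux_eq by (intro AE_finite_allI) auto
  hence "AE x in lborel. x \<in> {0<..<r} \<longrightarrow> (\<forall>j\<in>{1..N}. \<rho> j x = 0)"
  proof eventually_elim
    case (elim x)
    show ?case
    proof (intro impI ballI)
      fix j assume x: "x \<in> {0<..<r}" and j: "j \<in> {1..N}"
      have "u j x * \<rho> j x = 0" using z[OF x j] elim j by simp
      thus "\<rho> j x = 0" using \<epsilon>(4)[of x j] x j by (simp add: r_def)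
    qed
  qed
  thus False using densities_do_not_vanish_right_of_zero[OF support r] by blast
qed

text \<open>Some field crosses the interior point \<open>0\<close> from right to left. If no mass entered the state 1
  at \<open>0\<close>, the flux of that field would vanish at \<open>0\<close>, and no mass would be left on the right.\<close>

lemma inflow_at_zero_pos:
  assumes B: "case_B N u \<mu>"
  shows "inflow 0 > 0"
proof (rule ccontr)
  assume "\<not> ?thesis"
  hence in0: "inflow 0 = 0" using inflow_nonneg[of 0] by simp
  have nonneg: "0 \<le> lam k 1 * (flux k 0 / u k 0)" if "k \<in> {1..N} - {1}" for k
    using flux_times_field_nonneg[of k 0] rate_pos[of k 1] that one_state
    by (intro mult_nonneg_nonneg) (auto simp: zero_le_divide_iff zero_le_mult_iff less_imp_le)
  obtain J where J: "minimal_invariant_set N u J" "0 \<in> interior J"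
    using case_B_minimal_set[OF B] by metis
  obtain i where i: "i \<in> {1..N}" "1 * u i 0 < 0"
    using minimal_invariant_set_crossing[OF complete J, of 1] by auto
  have i1: "i \<noteq> 1" using i critical by auto
  have "lam i 1 * (flux i 0 / u i 0) = 0"
    using in0 nonneg i i1 unfolding inflow_def by (subst (asm) sum_nonneg_eq_0_iff) auto
  hence "flux i 0 = 0" using rate_pos[OF i(1) one_state i1] i by auto
  then obtain \<delta> where \<delta>: "\<delta> > 0"
    "AE x in lborel. 0 < 1 * (x - 0) \<and> 1 * (x - 0) < \<delta> \<longrightarrow> (\<forall>j\<in>{1..N}. \<rho> j x = 0)"
    using densities_vanish_on_side[OF i(1) _ i(2)] by auto
  thus False using densities_do_not_vanish_right_of_zero[of \<delta>] B by auto
qed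

text \<open>Towards \<open>0\<close> the flux decays no faster than \<open>x powr p\<close> with \<open>p = rate 1 / a < 1\<close>, hence slower
  than linearly.\<close>

theorem unbounded_if_rate_less:
  assumes support: "case_B N u \<mu> \<or> case_C N u \<mu>" and less: "rate 1 < a"
  shows "\<not> bounded_right_of_zero (\<rho> 1)"
proof
  assume "bounded_right_of_zero (\<rho> 1)"
  then obtain e M where e: "e > 0" "\<And>x. x \<in> {0<..<e} \<Longrightarrow> - flux 1 x \<le> M * x"
    using bounded_imp_flux_linear by blast
  define p where "p = rate 1 / a"
  have p: "p < 1" using less attracting by (simp add: p_def)
  obtain \<epsilon> K where \<epsilon>: "\<epsilon> > 0" "K \<ge> 0"
    "\<And>x. x \<in> {0<..<\<epsilon>} \<Longrightarrow> ((\<lambda>x. - flux 1 x) has_real_derivative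
      (rate 1 / - u 1 x * - flux 1 x - inflow x)) (at x)"
    "\<And>x. x \<in> {0<..<\<epsilon>} \<Longrightarrow> 0 \<le> - flux 1 x"
    "\<And>x. x \<in> {0<..<\<epsilon>} \<Longrightarrow> \<bar>rate 1 / - u 1 x - (rate 1 / a) / x\<bar> \<le> K"
    by (rule flux_near_critical_point) blast
  obtain y where y: "0 < y" "y < min e \<epsilon>" "- flux 1 y > 0"
    using flux_not_zero_right_of_zero[OF support, of "min e \<epsilon>"] e \<epsilon> by auto
  define c where "c = - flux 1 y * y powr (- p) * exp (- K * y)"
  have c: "c > 0" unfolding c_def using y by (intro mult_pos_pos) auto
  have low: "c \<le> M * x powr (1 - p)" if x: "0 < x" "x \<le> y" for x
  proof -
    have "c \<le> - flux 1 x * x powr (- p) * exp (- K * x)"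
      unfolding c_def
    proof (rule singular_ode_lower[OF \<epsilon>(3) \<epsilon>(4) inflow_nonneg _ x])
      fix z assume "z \<in> {0<..<\<epsilon>}"
      from \<epsilon>(5)[OF this] show "rate 1 / - u 1 z \<le> p / z + K" unfolding p_def by linarith
    qed (use y in auto)
    also have "\<dots> \<le> - flux 1 x * x powr (- p) * 1"
      using \<epsilon>(2) \<epsilon>(4)[of x] x y by (intro mult_left_mono mult_nonneg_nonneg) auto
    also have "\<dots> \<le> M * x * x powr (- p) * 1"
      using e(2)[of x] x y by (intro mult_right_mono) auto
    also have "\<dots> = M * x powr (1 - p)" using x by (simp add: powr_diff powr_minus divide_inverse)
    finally show ?thesis .
  qed
  have "((\<lambda>x. M * x powr (1 - p)) \<longlongrightarrow> M * 0) (at_right 0)"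
    using p by (intro tendsto_mult_left tendsto_zero_powrI[where b = "1 - p"] tendsto_const)
      (auto simp: eventually_at_right_field intro!: tendsto_ident_at exI[of _ 1])
  from order_tendstoD(2)[OF this, of c] have "\<forall>\<^sub>F x in at_right 0. M * x powr (1 - p) < c"
    using c by simp
  moreover have "\<forall>\<^sub>F x in at_right 0. x \<in> {0<..<y}"
    using eventually_at_right_real[OF y(1)] .
  ultimately have "\<forall>\<^sub>F x in at_right (0::real). False"
    by eventually_elim (use low in force)
  thus False by simp
qed

text \<open>For \<open>p = rate 1 / a > 1\<close> the flux is at most linear, as is \<open>u 1\<close>, and their quotient represents \<open>\<rho> 1\<close>.\<close>

theorem bounded_if_rate_greater:
  assumes greater: "rate 1 > a"
  shows "bounded_right_of_zero (\<rho> 1)"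
proof -
  define p where "p = rate 1 / a"
  have p: "p > 1" using greater attracting by (simp add: p_def)
  obtain \<epsilon> K H where \<epsilon>: "\<epsilon> > 0" "K \<ge> 0"
    "\<And>x. x \<in> {0<..<\<epsilon>} \<Longrightarrow> a * x / 2 \<le> - u 1 x \<and> - u 1 x \<le> 2 * a * x"
    "\<And>x. x \<in> {0<..<\<epsilon>} \<Longrightarrow> ((\<lambda>x. - flux 1 x) has_real_derivative
      (rate 1 / - u 1 x * - flux 1 x - inflow x)) (at x)"
    "\<And>x. x \<in> {0<..<\<epsilon>} \<Longrightarrow> 0 \<le> - flux 1 x"
    "\<And>x. x \<in> {0<..<\<epsilon>} \<Longrightarrow> \<bar>rate 1 / - u 1 x - (rate 1 / a) / x\<bar> \<le> K"
    "\<And>x. x \<in> {0<..<\<epsilon>} \<Longrightarrow> inflow x \<le> H"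
    "\<And>x j. x \<in> {0<..<\<epsilon>} \<Longrightarrow> j \<in> {1..N} \<Longrightarrow> u j x \<noteq> 0"
    by (rule flux_near_critical_point) blast
  define \<delta> where "\<delta> = min 1 (\<epsilon> / 2)"
  have \<delta>: "0 < \<delta>" "\<delta> < \<epsilon>" "\<delta> \<le> 1" using \<epsilon>(1) by (auto simp: \<delta>_def)
  have s: "p / x - K \<le> rate 1 / - u 1 x" if "x \<in> {0<..<\<epsilon>}" for x
    using \<epsilon>(6)[OF that] unfolding p_def by linarith
  obtain C where C: "\<And>x. 0 < x \<Longrightarrow> x \<le> \<delta> \<Longrightarrow> - flux 1 x \<le> C * x"
    using singular_ode_upper[OF \<epsilon>(4) \<epsilon>(5) inflow_nonneg \<epsilon>(7) s p \<epsilon>(2) \<delta>] by blast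
  define g where "g x = (if x \<in> {0<..<\<delta>} then flux 1 x / u 1 x else \<rho> 1 x)" for x
  have "\<bar>g x\<bar> \<le> 2 * C / a" if x: "x \<in> {0<..<\<delta>}" for x
  proof -
    have ax: "a * x > 0" using attracting x by simp
    have b: "a * x / 2 \<le> - u 1 x" using \<epsilon>(3)[of x] x \<delta> by auto
    have f: "0 \<le> - flux 1 x" "- flux 1 x \<le> C * x" using \<epsilon>(5)[of x] C[of x] x \<delta> by auto
    have "\<bar>g x\<bar> = - flux 1 x / - u 1 x" using x f b ax by (simp add: g_def abs_divide)
    also have "\<dots> \<le> C * x / (a * x / 2)" using f b ax by (intro frac_le) auto
    also have "\<dots> = 2 * C / a" using x by simp
    finally show ?thesis .
  qed
  hence "bounded (g ` {0<..<\<delta>})" unfolding bounded_iff by (intro exI[of _ "2 * C / a"]) auto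
  moreover have "g \<in> borel_measurable lborel"
  proof -
    have [measurable]: "flux 1 \<in> borel_measurable borel" "u 1 \<in> borel_measurable borel" "\<rho> 1 \<in> borel_measurable borel"
      using borel_measurable_continuous_onI flux_continuous continuous_field density_measurable one_state by blast+
    show ?thesis unfolding g_def by measurable
  qed
  moreover have "AE x in lborel. g x = \<rho> 1 x"
    using flux_eq[OF one_state]
    by eventually_elim (use \<epsilon>(8) \<delta> one_state in \<open>auto simp: g_def\<close>)
  ultimately show ?thesis using \<delta>(1) unfolding bounded_right_of_zero_def by blast
qed

text \<open>The positive inflow at \<open>0\<close> makes \<open>flux 1 / u 1\<close> grow at least logarithmically.\<close>

theorem unbounded_if_rate_equal:
  assumes B: "case_B N u \<mu>" and eq: "rate 1 = a"
  shows "\<not> bounded_right_of_zero (\<rho> 1)"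
proof
  assume "bounded_right_of_zero (\<rho> 1)"
  then obtain e M where e: "e > 0" "\<And>x. x \<in> {0<..<e} \<Longrightarrow> - flux 1 x \<le> M * x"
    using bounded_imp_flux_linear by blast
  obtain \<epsilon> K where \<epsilon>: "\<epsilon> > 0" "K \<ge> 0"
    "\<And>x. x \<in> {0<..<\<epsilon>} \<Longrightarrow> ((\<lambda>x. - flux 1 x) has_real_derivative
      (rate 1 / - u 1 x * - flux 1 x - inflow x)) (at x)"
    "\<And>x. x \<in> {0<..<\<epsilon>} \<Longrightarrow> 0 \<le> - flux 1 x"
    "\<And>x. x \<in> {0<..<\<epsilon>} \<Longrightarrow> \<bar>rate 1 / - u 1 x - (rate 1 / a) / x\<bar> \<le> K"
    "isCont inflow 0"
    by (rule flux_near_critical_point) blast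
  have pos: "inflow 0 > 0" by (rule inflow_at_zero_pos[OF B])
  have "\<forall>\<^sub>F x in nhds 0. inflow 0 / 2 < inflow x"
    using \<epsilon>(6) pos tendsto_at_iff_tendsto_nhds[of inflow 0]
    by (intro order_tendstoD(1)[where y = "inflow 0"]) (auto simp: isCont_def)
  then obtain d where d: "d > 0" "\<And>x. x \<in> {0 - d<..<0 + d} \<Longrightarrow> inflow 0 / 2 < inflow x"
    using nhds_eventually_interval_right by blast
  define r where "r = min (min e d) \<epsilon>"
  have r: "r > 0" "r \<le> e" "r \<le> d" "r \<le> \<epsilon>" using e d \<epsilon> by (auto simp: r_def)
  obtain c b where c: "c > 0" "\<And>x. 0 < x \<Longrightarrow> x \<le> r / 2 \<Longrightarrow> b - c * ln x \<le> - flux 1 x / x"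
  proof (rule singular_ode_critical[where \<epsilon> = r and \<delta> = "r / 2" and ?h0.0 = "inflow 0 / 2" and K = K])
    fix x assume x: "x \<in> {0<..<r}"
    hence x': "x \<in> {0<..<\<epsilon>}" using r by auto
    show "((\<lambda>x. - flux 1 x) has_real_derivative (rate 1 / - u 1 x * - flux 1 x - inflow x)) (at x)"
      by (rule \<epsilon>(3)[OF x'])
    show "0 \<le> - flux 1 x" by (rule \<epsilon>(4)[OF x'])
    show "inflow 0 / 2 \<le> inflow x" using d(2)[of x] x r by auto
    show "rate 1 / - u 1 x \<le> 1 / x + K" using \<epsilon>(5)[OF x'] eq attracting by simp
  qed (use pos r \<epsilon>(2) that in auto)
  have "\<forall>\<^sub>F x in at_right (0::real). ln x < (b - M) / c"
    using ln_at_0 by (simp add: filterlim_at_bot_dense)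
  moreover have "\<forall>\<^sub>F x in at_right 0. x \<in> {0<..<r / 2}"
    using eventually_at_right_real[of 0 "r / 2"] r by simp
  ultimately have "\<forall>\<^sub>F x in at_right (0::real). False"
  proof eventually_elim
    case (elim x)
    hence "b - c * ln x \<le> - flux 1 x / x" using c(2) by simp
    also have "\<dots> \<le> M" using e(2)[of x] elim r by (subst pos_divide_le_eq) auto
    finally show False using elim c(1) by (simp add: pos_less_divide_eq mult.commute)
  qed
  thus False by simp
qed

end

section \<open>Boundedness of the density to the right of a critical point\<close>

theorem corollary1:
  fixes N :: nat
    and u :: "nat \<Rightarrow> real \<Rightarrow> real"
    and lam :: "nat \<Rightarrow> nat \<Rightarrow> real"
    and \<mu> :: "(real \<times> nat) measure"
    and \<rho> :: "nat \<Rightarrow> real \<Rightarrow> real"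
    and a :: real
  assumes "N \<ge> 2"
    and "\<And>i. i \<in> {1..N} \<Longrightarrow> u i C1_differentiable_on UNIV"
    and "\<And>i. i \<in> {1..N} \<Longrightarrow> forward_complete (u i)"
    and "\<And>i j. i \<in> {1..N} \<Longrightarrow> j \<in> {1..N} \<Longrightarrow> i \<noteq> j \<Longrightarrow> lam i j > 0"
    and "\<And>x. \<not> x islimpt critical_points N u"
    and "invariant_measure N u lam \<mu>"
    and "absolutely_continuous (lborel \<Otimes>\<^sub>M count_space {1..N}) \<mu>"
    and "\<And>i. i \<in> {1..N} \<Longrightarrow> lebesgue_density (component \<mu> i) (\<rho> i)"
    and "u 1 0 = 0"
    and "\<And>i. i \<in> {1..N} - {1} \<Longrightarrow> u i 0 \<noteq> 0"
    and "a \<noteq> 0"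
    and "(\<lambda>\<eta>. u 1 \<eta> - (- a * \<eta>)) \<in> O[at_right 0](\<lambda>\<eta>. \<eta>\<^sup>2)"
  shows "(exit_rate N lam 1 < a \<longrightarrow> case_B N u \<mu> \<or> case_C N u \<mu> \<longrightarrow> \<not> bounded_right_of_zero (\<rho> 1)) \<and>
         (exit_rate N lam 1 > a \<and> a > 0 \<longrightarrow> case_B N u \<mu> \<or> case_C N u \<mu> \<longrightarrow> bounded_right_of_zero (\<rho> 1)) \<and>
         (exit_rate N lam 1 = a \<longrightarrow> case_B N u \<mu> \<longrightarrow> \<not> bounded_right_of_zero (\<rho> 1))"
proof -
  interpret stationary_switching N u lam \<mu> \<rho>
    by unfold_locales
       (use assms(1-8) in \<open>auto intro: C1_differentiable_imp_continuous_on\<close>)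
  have pos: "exit_rate N lam 1 > 0" by (rule exit_rate_pos) (use assms(1) in simp)
  have loc: "attracting_critical_point N u lam \<mu> \<rho> a" if "a > 0"
    by unfold_locales (use that assms(9-12) in auto)
  show ?thesis
  proof (intro conjI impI)
    assume "exit_rate N lam 1 < a" "case_B N u \<mu> \<or> case_C N u \<mu>"
    thus "\<not> bounded_right_of_zero (\<rho> 1)"
      using attracting_critical_point.unbounded_if_rate_less[OF loc] pos by simp
  next
    assume "exit_rate N lam 1 > a \<and> a > 0"
    thus "bounded_right_of_zero (\<rho> 1)"
      using attracting_critical_point.bounded_if_rate_greater[OF loc] by simp
  next
    assume "exit_rate N lam 1 = a" "case_B N u \<mu>"
    thus "\<not> bounded_right_of_zero (\<rho> 1)"
      using attracting_critical_point.unbounded_if_rate_equal[OF loc] pos by simp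
  qed
qed

end
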